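(* Let $\mathcal X$ and $\mathcal Y$ be categories. Then $(\Gamma:\mathsf{Mor}(\mathcal X,\mathcal Y)\to\mathsf{Adj}(\mathcal X,\mathcal Y),\ \Upsilon:\mathsf{Adj}(\mathcal X,\mathcal Y)\to\mathsf{Mor}(\mathcal X,\mathcal Y))$ is an adjoint pair ($\Gamma$ being the left adjoint) and $\Gamma$ is a full and faithful functor.
   Context: Composition of functors is juxtaposition; identities are denoted by the object/functor itself. Bialgebra functors. For monads $\mathbf A=(A,\mathsf m^A,\mathsf u^A)$ on $\mathcal X$ and $\mathbf B=(B,\mathsf m^B,\mathsf u^B)$ on $\mathcal Y$, an $\mathbf A$-$\mathbf B$ bialgebra functor $\mathbf T=(T,\lambda,\rho)$ is a functor $T:\mathcal Y\to\mathcal X$ with natural transformations $\lambda:AT\to T$, $\rho:TB\to T$ such that $\rho\circ T\mathsf m^B=\rho\circ\rho B$, $\rho\circ T\mathsf u^B=T$, $\lambda\circ\mathsf m^AT=\lambda\circ A\lambda$, $\lambda\circ\mathsf u^AT=T$, $\rho\circ\lambda B=\lambda\circ A\rho$. Category $\mathsf{Mor}(\mathcal X,\mathcal Y)$ of Morita contexts. Objects $\mathbb T=(\mathbf A,\mathbf B,\mathbf T,\widehat{\mathbf T},\mathrm{ev},\widehat{\mathrm{ev}})$: monads $\mathbf A$ on $\mathcal X$, $\mathbf B$ on $\mathcal Y$, an $\mathbf A$-$\mathbf B$ bialgebra functor $\mathbf T=(T,\lambda,\rho)$, a $\mathbf B$-$\mathbf A$ bialgebra functor $\widehat{\mathbf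 T}=(\widehat T:\mathcal X\to\mathcal Y,\ \hat\lambda:B\widehat T\to\widehat T,\ \hat\rho:\widehat TA\to\widehat T)$, and natural transformations $\mathrm{ev}:T\widehat T\to A$, $\widehat{\mathrm{ev}}:\widehat TT\to B$ with: (bialgebra morphisms) $\mathrm{ev}\circ\lambda\widehat T=\mathsf m^A\circ A\,\mathrm{ev}$, $\mathrm{ev}\circ T\hat\rho=\mathsf m^A\circ\mathrm{ev}A$, $\widehat{\mathrm{ev}}\circ\hat\lambda T=\mathsf m^B\circ B\,\widehat{\mathrm{ev}}$, $\widehat{\mathrm{ev}}\circ\widehat T\rho=\mathsf m^B\circ\widehat{\mathrm{ev}}B$; (compatibility) $\rho\circ T\widehat{\mathrm{ev}}=\lambda\circ\mathrm{ev}T$, $\hat\lambda\circ\widehat{\mathrm{ev}}\widehat T=\hat\rho\circ\widehat T\mathrm{ev}$; (balancedness) $\widehat{\mathrm{ev}}\circ\widehat T\lambda=\widehat{\mathrm{ev}}\circ\hat\rho T$, $\mathrm{ev}\circ\rho\widehat T=\mathrm{ev}\circ T\hat\lambda$. Morphisms $\mathbb T\to\mathbb T'$ are quadruples $(\phi^1,\phi^2,\phi^3,\phi^4)$ with $\phi^1:\mathbf A\to\mathbf A'$, $\phi^2:\mathbf B\to\mathbf B'$ monad morphisms (natural transformations commuting with multiplications and units), and natural transformations $\phi^3:T\to T'$, $\phi^4:\widehat T\to\widehat T'$ such that $\phi^3\circ\rho=\rho'\circ T'\phi^2\circ\phi^3B$, $\phi^3\circ\lambda=\lambda'\circ\phi^1T'\circ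 A\phi^3$, $\phi^4\circ\hat\rho=\hat\rho'\circ\widehat T'\phi^1\circ\phi^4A$, $\phi^4\circ\hat\lambda=\hat\lambda'\circ\phi^2\widehat T'\circ B\phi^4$, $\phi^1\circ\mathrm{ev}=\mathrm{ev}'\circ\phi^3\phi^4$, $\phi^2\circ\widehat{\mathrm{ev}}=\widehat{\mathrm{ev}}'\circ\phi^4\phi^3$ (Godement products). Category $\mathsf{Adj}(\mathcal X,\mathcal Y)$ of double adjunctions. Objects $\mathfrak Z=(\mathcal Z,(L_A,R_A),(L_B,R_B))$: a category $\mathcal Z$ with adjunctions $(L_A:\mathcal X\to\mathcal Z,R_A:\mathcal Z\to\mathcal X)$, $(L_B:\mathcal Y\to\mathcal Z,R_B:\mathcal Z\to\mathcal Y)$ (left adjoint first), units $\eta^A,\eta^B$, counits $\varepsilon^A,\varepsilon^B$. A morphism $\mathfrak Z\to\mathfrak Z'$ is a functor $F:\mathcal Z'\to\mathcal Z$ (note the direction) with $R_AF=R'_A$, $R_BF=R'_B$. Functor $\Upsilon$. $\Upsilon(\mathfrak Z)$ has monads $(R_AL_A,R_A\varepsilon^AL_A,\eta^A)$, $(R_BL_B,R_B\varepsilon^BL_B,\eta^B)$, bialgebra functors $(R_AL_B,R_A\varepsilon^AL_B,R_A\varepsilon^BL_B)$, $(R_BL_A,R_B\varepsilon^BL_A,R_B\varepsilon^AL_A)$ (left action, then right action), and $\mathrm{ev}=R_A\varepsilon^BL_A$, $\widehat{\mathrm{ev}}=R_B\varepsilon^AL_B$. For $F:\mathfrak Z\to\mathfrak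 Z'$ put $a=(\varepsilon^AFL'_A)\circ(L_A\eta'^A):L_A\to FL'_A$, $b=(\varepsilon^BFL'_B)\circ(L_B\eta'^B):L_B\to FL'_B$; then $\Upsilon(F)=(R_Aa,R_Bb,R_Ab,R_Ba)$. Eilenberg-Moore category $(\mathcal X,\mathcal Y)^{\mathbb T}$ of a Morita context $\mathbb T$. Objects $((X,\rho^X),(Y,\rho^Y),v,w)$ with $(X,\rho^X)$ an $\mathbf A$-algebra, $(Y,\rho^Y)$ a $\mathbf B$-algebra, $v:TY\to X$, $w:\widehat TX\to Y$ with $v\circ\lambda Y=\rho^X\circ Av$, $w\circ\hat\lambda X=\rho^Y\circ Bw$, $v\circ Tw=\rho^X\circ\mathrm{ev}X$, $w\circ\widehat Tv=\rho^Y\circ\widehat{\mathrm{ev}}Y$, $w\circ\widehat T\rho^X=w\circ\hat\rho X$, $v\circ T\rho^Y=v\circ\rho Y$. Morphisms: pairs $(f,g)$ of an $\mathbf A$-algebra morphism $f:X\to X'$ and a $\mathbf B$-algebra morphism $g:Y\to Y'$ with $g\circ w=w'\circ\widehat Tf$, $f\circ v=v'\circ Tg$. Functor $\Gamma$. $\Gamma(\mathbb T)=((\mathcal X,\mathcal Y)^{\mathbb T},(G_A,U_A),(G_B,U_B))$, where $U_A,U_B$ are the forgetful functors to $X$, resp. $Y$, and $G_AX=((AX,\mathsf m^AX),(\widehat TX,\hat\lambda X),\mathrm{ev}X,\hat\rho X)$, $G_Af=(Af,\widehat Tf)$, $G_BY=((TY,\lambda Y),(BY,\mathsf m^BY),\rho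 Y,\widehat{\mathrm{ev}}Y)$, $G_Bg=(Tg,Bg)$; the units are $\mathsf u^A$, $\mathsf u^B$ and the counits at $((X,\rho^X),(Y,\rho^Y),v,w)$ are $(\rho^X,w)$ and $(v,\rho^Y)$ respectively. For a morphism $\phi:\mathbb T\to\mathbb T'$, $\Gamma(\phi)$ is the functor $(\mathcal X,\mathcal Y)^{\mathbb T'}\to(\mathcal X,\mathcal Y)^{\mathbb T}$, $((X,\rho^X),(Y,\rho^Y),v,w)\mapsto((X,\rho^X\circ\phi^1X),(Y,\rho^Y\circ\phi^2Y),v\circ\phi^3Y,w\circ\phi^4X)$, identity on morphisms. *)

theory Defs
  imports "HOL-Library.FuncSet"
begin

section \<open>Categories, functors, natural transformations\<close>

text \<open>
  A category has a set of objects and a set of arrows, carved out of arbitrary types; the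
  operations are unconstrained outside these sets.  Functors and natural transformations, on the
  other hand, are required to be \<^emph>\<open>extensional\<close> (they take the value \<^term>\<open>undefined\<close> outside the
  source category), so that HOL equality is the usual strict equality of functors and of
  natural transformations.
\<close>

record ('o, 'm) cat =
  Obj :: "'o set"
  Arr :: "'m set"
  Dom :: "'m \<Rightarrow> 'o"
  Cod :: "'m \<Rightarrow> 'o"
  Idt :: "'o \<Rightarrow> 'm"
  Comp :: "'m \<Rightarrow> 'm \<Rightarrow> 'm"  (infixr "\<cdot>\<index>" 65)

definition Hom :: "('o, 'm) cat \<Rightarrow> 'o \<Rightarrow> 'o \<Rightarrow> 'm set" where
  "Hom C a b = {f \<in> Arr C. Dom C f = a \<and> Cod C f = b}"

locale category =
  fixes C :: "('o, 'm) cat"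
  assumes Dom_in: "f \<in> Arr C \<Longrightarrow> Dom C f \<in> Obj C"
    and Cod_in: "f \<in> Arr C \<Longrightarrow> Cod C f \<in> Obj C"
    and Idt_in: "a \<in> Obj C \<Longrightarrow> Idt C a \<in> Hom C a a"
    and Comp_in: "f \<in> Hom C a b \<Longrightarrow> g \<in> Hom C b c \<Longrightarrow> g \<cdot>\<^bsub>C\<^esub> f \<in> Hom C a c"
    and Comp_Idt: "f \<in> Hom C a b \<Longrightarrow> f \<cdot>\<^bsub>C\<^esub> Idt C a = f"
    and Idt_Comp: "f \<in> Hom C a b \<Longrightarrow> Idt C b \<cdot>\<^bsub>C\<^esub> f = f"
    and Comp_assoc: "f \<in> Hom C a b \<Longrightarrow> g \<in> Hom C b c \<Longrightarrow> h \<in> Hom C c d \<Longrightarrow>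
          (h \<cdot>\<^bsub>C\<^esub> g) \<cdot>\<^bsub>C\<^esub> f = h \<cdot>\<^bsub>C\<^esub> (g \<cdot>\<^bsub>C\<^esub> f)"

record ('o, 'm, 'p, 'n) ftr =
  OM :: "'o \<Rightarrow> 'p"
  AM :: "'m \<Rightarrow> 'n"

locale cat_functor = C: category C + D: category D
  for C :: "('o, 'm) cat" and D :: "('p, 'n) cat" +
  fixes F :: "('o, 'm, 'p, 'n) ftr"
  assumes OM_in: "OM F \<in> Obj C \<rightarrow>\<^sub>E Obj D"
    and AM_ext: "AM F \<in> extensional (Arr C)"
    and AM_in: "f \<in> Hom C a b \<Longrightarrow> AM F f \<in> Hom D (OM F a) (OM F b)"
    and AM_Idt: "a \<in> Obj C \<Longrightarrow> AM F (Idt C a) = Idt D (OM F a)"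
    and AM_Comp: "f \<in> Hom C a b \<Longrightarrow> g \<in> Hom C b c \<Longrightarrow>
          AM F (g \<cdot>\<^bsub>C\<^esub> f) = AM F g \<cdot>\<^bsub>D\<^esub> AM F f"

text \<open>In both definitions below \<^term>\<open>C\<close> is the source category of the resulting functor.\<close>

definition fid :: "('o, 'm) cat \<Rightarrow> ('o, 'm, 'o, 'm) ftr" where
  "fid C = \<lparr>OM = (\<lambda>a\<in>Obj C. a), AM = (\<lambda>f\<in>Arr C. f)\<rparr>"

definition fcomp ::
  "('o, 'm) cat \<Rightarrow> ('p, 'n, 'q, 'l) ftr \<Rightarrow> ('o, 'm, 'p, 'n) ftr \<Rightarrow> ('o, 'm, 'q, 'l) ftr" where
  "fcomp C G F = \<lparr>OM = (\<lambda>a\<in>Obj C. OM G (OM F a)), AM = (\<lambda>f\<in>Arr C. AM G (AM F f))\<rparr>"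

locale nat_trans = F: cat_functor C D F + G: cat_functor C D G
  for C :: "('o, 'm) cat" and D :: "('p, 'n) cat" and F G +
  fixes t :: "'o \<Rightarrow> 'n"
  assumes ext: "t \<in> extensional (Obj C)"
    and component: "a \<in> Obj C \<Longrightarrow> t a \<in> Hom D (OM F a) (OM G a)"
    and natural: "f \<in> Hom C a b \<Longrightarrow> AM G f \<cdot>\<^bsub>D\<^esub> t a = t b \<cdot>\<^bsub>D\<^esub> AM F f"

text \<open>
  Component at \<open>a\<close> of the Godement product of \<open>s : G \<rightarrow> G'\<close> and \<open>t : F \<rightarrow> F'\<close>, a natural
  transformation from \<open>G F\<close> to \<open>G' F'\<close>; \<open>D\<close> is the target category of \<open>G\<close>.
\<close>

definition godement ::
  "('q, 'l) cat \<Rightarrow> ('p, 'n, 'q, 'l) ftr \<Rightarrow> ('p \<Rightarrow> 'l) \<Rightarrow> ('o, 'm, 'p, 'n) ftr \<Rightarrow> ('o \<Rightarrow> 'n)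
    \<Rightarrow> 'o \<Rightarrow> 'l" where
  "godement D G s F' t a = s (OM F' a) \<cdot>\<^bsub>D\<^esub> AM G (t a)"

locale adjunction =
  L: cat_functor C D L + R: cat_functor D C R +
  eta: nat_trans C C "fid C" "fcomp C R L" eta +
  eps: nat_trans D D "fcomp D L R" "fid D" eps
  for C :: "('o, 'm) cat" and D :: "('p, 'n) cat" and L R eta eps +
  assumes triangle_L: "a \<in> Obj C \<Longrightarrow> eps (OM L a) \<cdot>\<^bsub>D\<^esub> AM L (eta a) = Idt D (OM L a)"
    and triangle_R: "z \<in> Obj D \<Longrightarrow> AM R (eps z) \<cdot>\<^bsub>C\<^esub> eta (OM R z) = Idt C (OM R z)"

definition adjoint_pair ::
  "('o, 'm) cat \<Rightarrow> ('p, 'n) cat \<Rightarrow> ('o, 'm, 'p, 'n) ftr \<Rightarrow> ('p, 'n, 'o, 'm) ftr \<Rightarrow> bool" where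
  "adjoint_pair C D L R \<longleftrightarrow> (\<exists>eta eps. adjunction C D L R eta eps)"

definition full_functor ::
  "('o, 'm) cat \<Rightarrow> ('p, 'n) cat \<Rightarrow> ('o, 'm, 'p, 'n) ftr \<Rightarrow> bool" where
  "full_functor C D F \<longleftrightarrow> cat_functor C D F \<and>
     (\<forall>a\<in>Obj C. \<forall>b\<in>Obj C. \<forall>g\<in>Hom D (OM F a) (OM F b). \<exists>f\<in>Hom C a b. AM F f = g)"

definition faithful_functor ::
  "('o, 'm) cat \<Rightarrow> ('p, 'n) cat \<Rightarrow> ('o, 'm, 'p, 'n) ftr \<Rightarrow> bool" where
  "faithful_functor C D F \<longleftrightarrow> cat_functor C D F \<and>
     (\<forall>a\<in>Obj C. \<forall>b\<in>Obj C. inj_on (AM F) (Hom C a b))"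


section \<open>Monads, algebras and bialgebra functors\<close>

locale monad =
  A: cat_functor C C A +
  m: nat_trans C C "fcomp C A A" A m +
  u: nat_trans C C "fid C" A u
  for C :: "('o, 'm) cat" and A m u +
  assumes assoc: "a \<in> Obj C \<Longrightarrow> m a \<cdot>\<^bsub>C\<^esub> AM A (m a) = m a \<cdot>\<^bsub>C\<^esub> m (OM A a)"
    and unit_left: "a \<in> Obj C \<Longrightarrow> m a \<cdot>\<^bsub>C\<^esub> u (OM A a) = Idt C (OM A a)"
    and unit_right: "a \<in> Obj C \<Longrightarrow> m a \<cdot>\<^bsub>C\<^esub> AM A (u a) = Idt C (OM A a)"

definition monad_algebra where
  "monad_algebra C A m u x r \<longleftrightarrow>
     x \<in> Obj C \<and> r \<in> Hom C (OM A x) x \<and>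
     r \<cdot>\<^bsub>C\<^esub> AM A r = r \<cdot>\<^bsub>C\<^esub> m x \<and> r \<cdot>\<^bsub>C\<^esub> u x = Idt C x"

definition algebra_morphism where
  "algebra_morphism C A x r x' r' f \<longleftrightarrow> f \<in> Hom C x x' \<and> f \<cdot>\<^bsub>C\<^esub> r = r' \<cdot>\<^bsub>C\<^esub> AM A f"

locale monad_morphism =
  A: monad C A m u + A': monad C A' m' u' + nat_trans C C A A' p
  for C :: "('o, 'm) cat" and A m u A' m' u' p +
  assumes mult: "a \<in> Obj C \<Longrightarrow> p a \<cdot>\<^bsub>C\<^esub> m a = m' a \<cdot>\<^bsub>C\<^esub> godement C A p A' p a"
    and unit: "a \<in> Obj C \<Longrightarrow> p a \<cdot>\<^bsub>C\<^esub> u a = u' a"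

text \<open>\<open>T : Y \<rightarrow> X\<close>, with left action \<open>l : A T \<rightarrow> T\<close> and right action \<open>r : T B \<rightarrow> T\<close>.\<close>

locale bialgebra_functor =
  A: monad X A mA uA + B: monad Y B mB uB + T: cat_functor Y X T +
  l: nat_trans Y X "fcomp Y A T" T l +
  r: nat_trans Y X "fcomp Y T B" T r
  for X :: "('xo, 'xm) cat" and Y :: "('yo, 'ym) cat" and A mA uA B mB uB T l r +
  assumes r_mult: "y \<in> Obj Y \<Longrightarrow> r y \<cdot>\<^bsub>X\<^esub> AM T (mB y) = r y \<cdot>\<^bsub>X\<^esub> r (OM B y)"
    and r_unit: "y \<in> Obj Y \<Longrightarrow> r y \<cdot>\<^bsub>X\<^esub> AM T (uB y) = Idt X (OM T y)"
    and l_mult: "y \<in> Obj Y \<Longrightarrow> l y \<cdot>\<^bsub>X\<^esub> mA (OM T y) = l y \<cdot>\<^bsub>X\<^esub> AM A (l y)"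
    and l_unit: "y \<in> Obj Y \<Longrightarrow> l y \<cdot>\<^bsub>X\<^esub> uA (OM T y) = Idt X (OM T y)"
    and l_r: "y \<in> Obj Y \<Longrightarrow> r y \<cdot>\<^bsub>X\<^esub> l (OM B y) = l y \<cdot>\<^bsub>X\<^esub> AM A (r y)"


section \<open>The category of Morita contexts\<close>

text \<open>The suffix \<open>h\<close> stands for a hat.\<close>

record ('xo, 'xm, 'yo, 'ym) morita =
  fA :: "('xo, 'xm, 'xo, 'xm) ftr"
  mulA :: "'xo \<Rightarrow> 'xm"
  uniA :: "'xo \<Rightarrow> 'xm"
  fB :: "('yo, 'ym, 'yo, 'ym) ftr"
  mulB :: "'yo \<Rightarrow> 'ym"
  uniB :: "'yo \<Rightarrow> 'ym"
  fT :: "('yo, 'ym, 'xo, 'xm) ftr"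
  lact :: "'yo \<Rightarrow> 'xm"
  ract :: "'yo \<Rightarrow> 'xm"
  fTh :: "('xo, 'xm, 'yo, 'ym) ftr"
  lacth :: "'xo \<Rightarrow> 'ym"
  racth :: "'xo \<Rightarrow> 'ym"
  ev :: "'xo \<Rightarrow> 'xm"
  evh :: "'yo \<Rightarrow> 'ym"

locale morita_context_data =
  T: bialgebra_functor X Y A mA uA B mB uB T l r +
  Th: bialgebra_functor Y X B mB uB A mA uA Th lh rh +
  e: nat_trans X X "fcomp X T Th" A e +
  eh: nat_trans Y Y "fcomp Y Th T" B eh
  for X :: "('xo, 'xm) cat" and Y :: "('yo, 'ym) cat"
    and A mA uA B mB uB T l r Th lh rh e eh +
  assumes e_left: "x \<in> Obj X \<Longrightarrow> e x \<cdot>\<^bsub>X\<^esub> l (OM Th x) = mA x \<cdot>\<^bsub>X\<^esub> AM A (e x)"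
    and e_right: "x \<in> Obj X \<Longrightarrow> e x \<cdot>\<^bsub>X\<^esub> AM T (rh x) = mA x \<cdot>\<^bsub>X\<^esub> e (OM A x)"
    and eh_left: "y \<in> Obj Y \<Longrightarrow> eh y \<cdot>\<^bsub>Y\<^esub> lh (OM T y) = mB y \<cdot>\<^bsub>Y\<^esub> AM B (eh y)"
    and eh_right: "y \<in> Obj Y \<Longrightarrow> eh y \<cdot>\<^bsub>Y\<^esub> AM Th (r y) = mB y \<cdot>\<^bsub>Y\<^esub> eh (OM B y)"
    and compat: "y \<in> Obj Y \<Longrightarrow> r y \<cdot>\<^bsub>X\<^esub> AM T (eh y) = l y \<cdot>\<^bsub>X\<^esub> e (OM T y)"
    and compath: "x \<in> Obj X \<Longrightarrow> lh x \<cdot>\<^bsub>Y\<^esub> eh (OM Th x) = rh x \<cdot>\<^bsub>Y\<^esub> AM Th (e x)"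
    and balancedh: "y \<in> Obj Y \<Longrightarrow> eh y \<cdot>\<^bsub>Y\<^esub> AM Th (l y) = eh y \<cdot>\<^bsub>Y\<^esub> rh (OM T y)"
    and balanced: "x \<in> Obj X \<Longrightarrow> e x \<cdot>\<^bsub>X\<^esub> r (OM Th x) = e x \<cdot>\<^bsub>X\<^esub> AM T (lh x)"

definition morita_context ::
  "('xo, 'xm) cat \<Rightarrow> ('yo, 'ym) cat \<Rightarrow> ('xo, 'xm, 'yo, 'ym) morita \<Rightarrow> bool" where
  "morita_context X Y M \<longleftrightarrow> morita_context_data X Y
     (fA M) (mulA M) (uniA M) (fB M) (mulB M) (uniB M)
     (fT M) (lact M) (ract M) (fTh M) (lacth M) (racth M) (ev M) (evh M)"

record ('xo, 'xm, 'yo, 'ym) morita_arr =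
  src :: "('xo, 'xm, 'yo, 'ym) morita"
  tgt :: "('xo, 'xm, 'yo, 'ym) morita"
  ph1 :: "'xo \<Rightarrow> 'xm"
  ph2 :: "'yo \<Rightarrow> 'ym"
  ph3 :: "'yo \<Rightarrow> 'xm"
  ph4 :: "'xo \<Rightarrow> 'ym"

locale morita_morphism =
  p1: monad_morphism X "fA M" "mulA M" "uniA M" "fA M'" "mulA M'" "uniA M'" p1 +
  p2: monad_morphism Y "fB M" "mulB M" "uniB M" "fB M'" "mulB M'" "uniB M'" p2 +
  p3: nat_trans Y X "fT M" "fT M'" p3 +
  p4: nat_trans X Y "fTh M" "fTh M'" p4
  for X :: "('xo, 'xm) cat" and Y :: "('yo, 'ym) cat"
    and M M' :: "('xo, 'xm, 'yo, 'ym) morita" and p1 p2 p3 p4 +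
  assumes p3_ract: "y \<in> Obj Y \<Longrightarrow>
      p3 y \<cdot>\<^bsub>X\<^esub> ract M y = ract M' y \<cdot>\<^bsub>X\<^esub> AM (fT M') (p2 y) \<cdot>\<^bsub>X\<^esub> p3 (OM (fB M) y)"
    and p3_lact: "y \<in> Obj Y \<Longrightarrow>
      p3 y \<cdot>\<^bsub>X\<^esub> lact M y = lact M' y \<cdot>\<^bsub>X\<^esub> p1 (OM (fT M') y) \<cdot>\<^bsub>X\<^esub> AM (fA M) (p3 y)"
    and p4_racth: "x \<in> Obj X \<Longrightarrow>
      p4 x \<cdot>\<^bsub>Y\<^esub> racth M x = racth M' x \<cdot>\<^bsub>Y\<^esub> AM (fTh M') (p1 x) \<cdot>\<^bsub>Y\<^esub> p4 (OM (fA M) x)"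
    and p4_lacth: "x \<in> Obj X \<Longrightarrow>
      p4 x \<cdot>\<^bsub>Y\<^esub> lacth M x = lacth M' x \<cdot>\<^bsub>Y\<^esub> p2 (OM (fTh M') x) \<cdot>\<^bsub>Y\<^esub> AM (fB M) (p4 x)"
    and p1_ev: "x \<in> Obj X \<Longrightarrow>
      p1 x \<cdot>\<^bsub>X\<^esub> ev M x = ev M' x \<cdot>\<^bsub>X\<^esub> godement X (fT M) p3 (fTh M') p4 x"
    and p2_evh: "y \<in> Obj Y \<Longrightarrow>
      p2 y \<cdot>\<^bsub>Y\<^esub> evh M y = evh M' y \<cdot>\<^bsub>Y\<^esub> godement Y (fTh M) p4 (fT M') p3 y"

definition Mor :: "('xo, 'xm) cat \<Rightarrow> ('yo, 'ym) cat \<Rightarrow>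
    (('xo, 'xm, 'yo, 'ym) morita, ('xo, 'xm, 'yo, 'ym) morita_arr) cat" where
  "Mor X Y = \<lparr>
     Obj = {M. morita_context X Y M},
     Arr = {p. morita_context X Y (src p) \<and> morita_context X Y (tgt p) \<and>
               morita_morphism X Y (src p) (tgt p) (ph1 p) (ph2 p) (ph3 p) (ph4 p)},
     Dom = src,
     Cod = tgt,
     Idt = (\<lambda>M. \<lparr>src = M, tgt = M,
       ph1 = (\<lambda>x\<in>Obj X. Idt X (OM (fA M) x)),
       ph2 = (\<lambda>y\<in>Obj Y. Idt Y (OM (fB M) y)),
       ph3 = (\<lambda>y\<in>Obj Y. Idt X (OM (fT M) y)),
       ph4 = (\<lambda>x\<in>Obj X. Idt Y (OM (fTh M) x))\<rparr>),
     Comp = (\<lambda>q p. \<lparr>src = src p, tgt = tgt q,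
       ph1 = (\<lambda>x\<in>Obj X. ph1 q x \<cdot>\<^bsub>X\<^esub> ph1 p x),
       ph2 = (\<lambda>y\<in>Obj Y. ph2 q y \<cdot>\<^bsub>Y\<^esub> ph2 p y),
       ph3 = (\<lambda>y\<in>Obj Y. ph3 q y \<cdot>\<^bsub>X\<^esub> ph3 p y),
       ph4 = (\<lambda>x\<in>Obj X. ph4 q x \<cdot>\<^bsub>Y\<^esub> ph4 p x)\<rparr>)\<rparr>"


section \<open>The category of double adjunctions\<close>

record ('xo, 'xm, 'yo, 'ym, 'zo, 'zm) dadj =
  Zc :: "('zo, 'zm) cat"
  LA :: "('xo, 'xm, 'zo, 'zm) ftr"
  RA :: "('zo, 'zm, 'xo, 'xm) ftr"
  etaA :: "'xo \<Rightarrow> 'xm"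
  epsA :: "'zo \<Rightarrow> 'zm"
  LB :: "('yo, 'ym, 'zo, 'zm) ftr"
  RB :: "('zo, 'zm, 'yo, 'ym) ftr"
  etaB :: "'yo \<Rightarrow> 'ym"
  epsB :: "'zo \<Rightarrow> 'zm"

definition double_adjunction ::
  "('xo, 'xm) cat \<Rightarrow> ('yo, 'ym) cat \<Rightarrow> ('xo, 'xm, 'yo, 'ym, 'zo, 'zm) dadj \<Rightarrow> bool" where
  "double_adjunction X Y Z \<longleftrightarrow>
     adjunction X (Zc Z) (LA Z) (RA Z) (etaA Z) (epsA Z) \<and>
     adjunction Y (Zc Z) (LB Z) (RB Z) (etaB Z) (epsB Z)"

record ('xo, 'xm, 'yo, 'ym, 'zo, 'zm) dadj_arr =
  asrc :: "('xo, 'xm, 'yo, 'ym, 'zo, 'zm) dadj"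
  atgt :: "('xo, 'xm, 'yo, 'ym, 'zo, 'zm) dadj"
  afun :: "('zo, 'zm, 'zo, 'zm) ftr"

definition dadj_morphism where
  "dadj_morphism Z Z' F \<longleftrightarrow> cat_functor (Zc Z') (Zc Z) F \<and>
     fcomp (Zc Z') (RA Z) F = RA Z' \<and> fcomp (Zc Z') (RB Z) F = RB Z'"

text \<open>
  The types \<open>'zo\<close> and \<open>'zm\<close> act as the universe in which the categories at the apex of
  a double adjunction live.  Two apex categories differing only in the irrelevant values of
  their operations (outside objects, arrows and composable pairs) give distinct objects, which are
  isomorphic via the identity functor.
\<close>

definition Adj :: "('xo, 'xm) cat \<Rightarrow> ('yo, 'ym) cat \<Rightarrow>
    (('xo, 'xm, 'yo, 'ym, 'zo, 'zm) dadj, ('xo, 'xm, 'yo, 'ym, 'zo, 'zm) dadj_arr) cat" where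
  "Adj X Y = \<lparr>
     Obj = {Z. double_adjunction X Y Z},
     Arr = {F. double_adjunction X Y (asrc F) \<and> double_adjunction X Y (atgt F) \<and>
               dadj_morphism (asrc F) (atgt F) (afun F)},
     Dom = asrc,
     Cod = atgt,
     Idt = (\<lambda>Z. \<lparr>asrc = Z, atgt = Z, afun = fid (Zc Z)\<rparr>),
     Comp = (\<lambda>G F. \<lparr>asrc = asrc F, atgt = atgt G,
       afun = fcomp (Zc (atgt G)) (afun F) (afun G)\<rparr>)\<rparr>"


section \<open>The functor from double adjunctions to Morita contexts\<close>

definition Upsilon_obj :: "('xo, 'xm) cat \<Rightarrow> ('yo, 'ym) cat \<Rightarrow>
    ('xo, 'xm, 'yo, 'ym, 'zo, 'zm) dadj \<Rightarrow> ('xo, 'xm, 'yo, 'ym) morita" where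
  "Upsilon_obj X Y Z = \<lparr>
     fA = fcomp X (RA Z) (LA Z),
     mulA = (\<lambda>x\<in>Obj X. AM (RA Z) (epsA Z (OM (LA Z) x))),
     uniA = etaA Z,
     fB = fcomp Y (RB Z) (LB Z),
     mulB = (\<lambda>y\<in>Obj Y. AM (RB Z) (epsB Z (OM (LB Z) y))),
     uniB = etaB Z,
     fT = fcomp Y (RA Z) (LB Z),
     lact = (\<lambda>y\<in>Obj Y. AM (RA Z) (epsA Z (OM (LB Z) y))),
     ract = (\<lambda>y\<in>Obj Y. AM (RA Z) (epsB Z (OM (LB Z) y))),
     fTh = fcomp X (RB Z) (LA Z),
     lacth = (\<lambda>x\<in>Obj X. AM (RB Z) (epsB Z (OM (LA Z) x))),
     racth = (\<lambda>x\<in>Obj X. AM (RB Z) (epsA Z (OM (LA Z) x))),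
     ev = (\<lambda>x\<in>Obj X. AM (RA Z) (epsB Z (OM (LA Z) x))),
     evh = (\<lambda>y\<in>Obj Y. AM (RB Z) (epsA Z (OM (LB Z) y)))\<rparr>"

text \<open>The mates \<open>a : L\<^sub>A \<rightarrow> F L'\<^sub>A\<close> and \<open>b : L\<^sub>B \<rightarrow> F L'\<^sub>B\<close> of the identities \<open>R\<^sub>A F = R'\<^sub>A\<close>, \<open>R\<^sub>B F = R'\<^sub>B\<close>.\<close>

definition mateA where
  "mateA Z Z' F x = epsA Z (OM F (OM (LA Z') x)) \<cdot>\<^bsub>Zc Z\<^esub> AM (LA Z) (etaA Z' x)"

definition mateB where
  "mateB Z Z' F y = epsB Z (OM F (OM (LB Z') y)) \<cdot>\<^bsub>Zc Z\<^esub> AM (LB Z) (etaB Z' y)"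

definition Upsilon_arr :: "('xo, 'xm) cat \<Rightarrow> ('yo, 'ym) cat \<Rightarrow>
    ('xo, 'xm, 'yo, 'ym, 'zo, 'zm) dadj_arr \<Rightarrow> ('xo, 'xm, 'yo, 'ym) morita_arr" where
  "Upsilon_arr X Y F = (let Z = asrc F; Z' = atgt F in \<lparr>
     src = Upsilon_obj X Y Z,
     tgt = Upsilon_obj X Y Z',
     ph1 = (\<lambda>x\<in>Obj X. AM (RA Z) (mateA Z Z' (afun F) x)),
     ph2 = (\<lambda>y\<in>Obj Y. AM (RB Z) (mateB Z Z' (afun F) y)),
     ph3 = (\<lambda>y\<in>Obj Y. AM (RA Z) (mateB Z Z' (afun F) y)),
     ph4 = (\<lambda>x\<in>Obj X. AM (RB Z) (mateA Z Z' (afun F) x))\<rparr>)"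

definition Upsilon :: "('xo, 'xm) cat \<Rightarrow> ('yo, 'ym) cat \<Rightarrow>
    (('xo, 'xm, 'yo, 'ym, 'zo, 'zm) dadj, ('xo, 'xm, 'yo, 'ym, 'zo, 'zm) dadj_arr,
     ('xo, 'xm, 'yo, 'ym) morita, ('xo, 'xm, 'yo, 'ym) morita_arr) ftr" where
  "Upsilon X Y = \<lparr>OM = (\<lambda>Z\<in>Obj (Adj X Y). Upsilon_obj X Y Z),
                  AM = (\<lambda>F\<in>Arr (Adj X Y). Upsilon_arr X Y F)\<rparr>"


section \<open>The Eilenberg-Moore category of a Morita context\<close>

record ('xo, 'xm, 'yo, 'ym) em_obj =
  xob :: 'xo
  xact :: 'xm
  yob :: 'yo
  yact :: 'ym
  vmap :: 'xm
  wmap :: 'ym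

record ('xo, 'xm, 'yo, 'ym) em_arr =
  esrc :: "('xo, 'xm, 'yo, 'ym) em_obj"
  etgt :: "('xo, 'xm, 'yo, 'ym) em_obj"
  xarr :: 'xm
  yarr :: 'ym

definition is_em_obj :: "('xo, 'xm) cat \<Rightarrow> ('yo, 'ym) cat \<Rightarrow>
    ('xo, 'xm, 'yo, 'ym) morita \<Rightarrow> ('xo, 'xm, 'yo, 'ym) em_obj \<Rightarrow> bool" where
  "is_em_obj X Y M E \<longleftrightarrow>
     (let x = xob E; rX = xact E; y = yob E; rY = yact E; v = vmap E; w = wmap E in
       monad_algebra X (fA M) (mulA M) (uniA M) x rX \<and>
       monad_algebra Y (fB M) (mulB M) (uniB M) y rY \<and>
       v \<in> Hom X (OM (fT M) y) x \<and>
       w \<in> Hom Y (OM (fTh M) x) y \<and>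
       v \<cdot>\<^bsub>X\<^esub> lact M y = rX \<cdot>\<^bsub>X\<^esub> AM (fA M) v \<and>
       w \<cdot>\<^bsub>Y\<^esub> lacth M x = rY \<cdot>\<^bsub>Y\<^esub> AM (fB M) w \<and>
       v \<cdot>\<^bsub>X\<^esub> AM (fT M) w = rX \<cdot>\<^bsub>X\<^esub> ev M x \<and>
       w \<cdot>\<^bsub>Y\<^esub> AM (fTh M) v = rY \<cdot>\<^bsub>Y\<^esub> evh M y \<and>
       w \<cdot>\<^bsub>Y\<^esub> AM (fTh M) rX = w \<cdot>\<^bsub>Y\<^esub> racth M x \<and>
       v \<cdot>\<^bsub>X\<^esub> AM (fT M) rY = v \<cdot>\<^bsub>X\<^esub> ract M y)"

definition is_em_arr :: "('xo, 'xm) cat \<Rightarrow> ('yo, 'ym) cat \<Rightarrow>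
    ('xo, 'xm, 'yo, 'ym) morita \<Rightarrow> ('xo, 'xm, 'yo, 'ym) em_arr \<Rightarrow> bool" where
  "is_em_arr X Y M h \<longleftrightarrow>
     (let E = esrc h; E' = etgt h; f = xarr h; g = yarr h in
       is_em_obj X Y M E \<and> is_em_obj X Y M E' \<and>
       algebra_morphism X (fA M) (xob E) (xact E) (xob E') (xact E') f \<and>
       algebra_morphism Y (fB M) (yob E) (yact E) (yob E') (yact E') g \<and>
       g \<cdot>\<^bsub>Y\<^esub> wmap E = wmap E' \<cdot>\<^bsub>Y\<^esub> AM (fTh M) f \<and>
       f \<cdot>\<^bsub>X\<^esub> vmap E = vmap E' \<cdot>\<^bsub>X\<^esub> AM (fT M) g)"

definition EM :: "('xo, 'xm) cat \<Rightarrow> ('yo, 'ym) cat \<Rightarrow> ('xo, 'xm, 'yo, 'ym) morita \<Rightarrow>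
    (('xo, 'xm, 'yo, 'ym) em_obj, ('xo, 'xm, 'yo, 'ym) em_arr) cat" where
  "EM X Y M = \<lparr>
     Obj = {E. is_em_obj X Y M E},
     Arr = {h. is_em_arr X Y M h},
     Dom = esrc,
     Cod = etgt,
     Idt = (\<lambda>E. \<lparr>esrc = E, etgt = E, xarr = Idt X (xob E), yarr = Idt Y (yob E)\<rparr>),
     Comp = (\<lambda>k h. \<lparr>esrc = esrc h, etgt = etgt k,
               xarr = xarr k \<cdot>\<^bsub>X\<^esub> xarr h, yarr = yarr k \<cdot>\<^bsub>Y\<^esub> yarr h\<rparr>)\<rparr>"

definition UA :: "('xo, 'xm) cat \<Rightarrow> ('yo, 'ym) cat \<Rightarrow> ('xo, 'xm, 'yo, 'ym) morita \<Rightarrow>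
    (('xo, 'xm, 'yo, 'ym) em_obj, ('xo, 'xm, 'yo, 'ym) em_arr, 'xo, 'xm) ftr" where
  "UA X Y M = \<lparr>OM = (\<lambda>E\<in>Obj (EM X Y M). xob E), AM = (\<lambda>h\<in>Arr (EM X Y M). xarr h)\<rparr>"

definition UB :: "('xo, 'xm) cat \<Rightarrow> ('yo, 'ym) cat \<Rightarrow> ('xo, 'xm, 'yo, 'ym) morita \<Rightarrow>
    (('xo, 'xm, 'yo, 'ym) em_obj, ('xo, 'xm, 'yo, 'ym) em_arr, 'yo, 'ym) ftr" where
  "UB X Y M = \<lparr>OM = (\<lambda>E\<in>Obj (EM X Y M). yob E), AM = (\<lambda>h\<in>Arr (EM X Y M). yarr h)\<rparr>"

definition GA_obj ::
  "('xo, 'xm, 'yo, 'ym) morita \<Rightarrow> 'xo \<Rightarrow> ('xo, 'xm, 'yo, 'ym) em_obj" where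
  "GA_obj M x = \<lparr>xob = OM (fA M) x, xact = mulA M x, yob = OM (fTh M) x, yact = lacth M x,
                 vmap = ev M x, wmap = racth M x\<rparr>"

definition GB_obj ::
  "('xo, 'xm, 'yo, 'ym) morita \<Rightarrow> 'yo \<Rightarrow> ('xo, 'xm, 'yo, 'ym) em_obj" where
  "GB_obj M y = \<lparr>xob = OM (fT M) y, xact = lact M y, yob = OM (fB M) y, yact = mulB M y,
                 vmap = ract M y, wmap = evh M y\<rparr>"

definition GA :: "('xo, 'xm) cat \<Rightarrow> ('xo, 'xm, 'yo, 'ym) morita \<Rightarrow>
    ('xo, 'xm, ('xo, 'xm, 'yo, 'ym) em_obj, ('xo, 'xm, 'yo, 'ym) em_arr) ftr" where
  "GA X M = \<lparr>
     OM = (\<lambda>x\<in>Obj X. GA_obj M x),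
     AM = (\<lambda>f\<in>Arr X. \<lparr>esrc = GA_obj M (Dom X f), etgt = GA_obj M (Cod X f),
                       xarr = AM (fA M) f, yarr = AM (fTh M) f\<rparr>)\<rparr>"

definition GB :: "('yo, 'ym) cat \<Rightarrow> ('xo, 'xm, 'yo, 'ym) morita \<Rightarrow>
    ('yo, 'ym, ('xo, 'xm, 'yo, 'ym) em_obj, ('xo, 'xm, 'yo, 'ym) em_arr) ftr" where
  "GB Y M = \<lparr>
     OM = (\<lambda>y\<in>Obj Y. GB_obj M y),
     AM = (\<lambda>g\<in>Arr Y. \<lparr>esrc = GB_obj M (Dom Y g), etgt = GB_obj M (Cod Y g),
                       xarr = AM (fT M) g, yarr = AM (fB M) g\<rparr>)\<rparr>"

definition em_epsA :: "('xo, 'xm, 'yo, 'ym) morita \<Rightarrow>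
    ('xo, 'xm, 'yo, 'ym) em_obj \<Rightarrow> ('xo, 'xm, 'yo, 'ym) em_arr" where
  "em_epsA M E = \<lparr>esrc = GA_obj M (xob E), etgt = E, xarr = xact E, yarr = wmap E\<rparr>"

definition em_epsB :: "('xo, 'xm, 'yo, 'ym) morita \<Rightarrow>
    ('xo, 'xm, 'yo, 'ym) em_obj \<Rightarrow> ('xo, 'xm, 'yo, 'ym) em_arr" where
  "em_epsB M E = \<lparr>esrc = GB_obj M (yob E), etgt = E, xarr = vmap E, yarr = yact E\<rparr>"

definition em_restrict_obj :: "('xo, 'xm) cat \<Rightarrow> ('yo, 'ym) cat \<Rightarrow>
    ('xo, 'xm, 'yo, 'ym) morita_arr \<Rightarrow>
    ('xo, 'xm, 'yo, 'ym) em_obj \<Rightarrow> ('xo, 'xm, 'yo, 'ym) em_obj" where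
  "em_restrict_obj X Y p E = \<lparr>
     xob = xob E, xact = xact E \<cdot>\<^bsub>X\<^esub> ph1 p (xob E),
     yob = yob E, yact = yact E \<cdot>\<^bsub>Y\<^esub> ph2 p (yob E),
     vmap = vmap E \<cdot>\<^bsub>X\<^esub> ph3 p (yob E),
     wmap = wmap E \<cdot>\<^bsub>Y\<^esub> ph4 p (xob E)\<rparr>"

definition em_restrict :: "('xo, 'xm) cat \<Rightarrow> ('yo, 'ym) cat \<Rightarrow>
    ('xo, 'xm, 'yo, 'ym) morita_arr \<Rightarrow>
    (('xo, 'xm, 'yo, 'ym) em_obj, ('xo, 'xm, 'yo, 'ym) em_arr,
     ('xo, 'xm, 'yo, 'ym) em_obj, ('xo, 'xm, 'yo, 'ym) em_arr) ftr" where
  "em_restrict X Y p = \<lparr>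
     OM = (\<lambda>E\<in>Obj (EM X Y (tgt p)). em_restrict_obj X Y p E),
     AM = (\<lambda>h\<in>Arr (EM X Y (tgt p)). \<lparr>esrc = em_restrict_obj X Y p (esrc h),
            etgt = em_restrict_obj X Y p (etgt h), xarr = xarr h, yarr = yarr h\<rparr>)\<rparr>"


section \<open>The functor from Morita contexts to double adjunctions\<close>

text \<open>
  Eilenberg-Moore categories live in the types \<open>em_obj\<close> and \<open>em_arr\<close>.  To view them as objects of
  the category of double adjunctions over an arbitrary pair of types \<open>'zo\<close>, \<open>'zm\<close> that is large
  enough, they are relabelled along injections \<open>io\<close> and \<open>im\<close> of \<open>em_obj\<close> into \<open>'zo\<close> and of \<open>em_arr\<close>
  into \<open>'zm\<close>.  The functors \<open>enc\<close> and \<open>dec\<close> are the mutually inverse isomorphisms between a category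
  and its relabelling.
\<close>

definition relabel :: "('o \<Rightarrow> 'p) \<Rightarrow> ('m \<Rightarrow> 'n) \<Rightarrow> ('o, 'm) cat \<Rightarrow> ('p, 'n) cat" where
  "relabel io im C = \<lparr>
     Obj = io ` Obj C,
     Arr = im ` Arr C,
     Dom = (\<lambda>f. io (Dom C (inv im f))),
     Cod = (\<lambda>f. io (Cod C (inv im f))),
     Idt = (\<lambda>a. im (Idt C (inv io a))),
     Comp = (\<lambda>g f. im (inv im g \<cdot>\<^bsub>C\<^esub> inv im f))\<rparr>"

definition enc :: "('o \<Rightarrow> 'p) \<Rightarrow> ('m \<Rightarrow> 'n) \<Rightarrow> ('o, 'm) cat \<Rightarrow> ('o, 'm, 'p, 'n) ftr" where
  "enc io im C = \<lparr>OM = (\<lambda>a\<in>Obj C. io a), AM = (\<lambda>f\<in>Arr C. im f)\<rparr>"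

definition dec :: "('o \<Rightarrow> 'p) \<Rightarrow> ('m \<Rightarrow> 'n) \<Rightarrow> ('o, 'm) cat \<Rightarrow> ('p, 'n, 'o, 'm) ftr" where
  "dec io im C = \<lparr>OM = (\<lambda>a\<in>io ` Obj C. inv io a), AM = (\<lambda>f\<in>im ` Arr C. inv im f)\<rparr>"

definition Gamma_obj ::
  "(('xo, 'xm, 'yo, 'ym) em_obj \<Rightarrow> 'zo) \<Rightarrow> (('xo, 'xm, 'yo, 'ym) em_arr \<Rightarrow> 'zm) \<Rightarrow>
   ('xo, 'xm) cat \<Rightarrow> ('yo, 'ym) cat \<Rightarrow>
   ('xo, 'xm, 'yo, 'ym) morita \<Rightarrow> ('xo, 'xm, 'yo, 'ym, 'zo, 'zm) dadj" where
  "Gamma_obj io im X Y M = (let E = EM X Y M; E' = relabel io im E in \<lparr>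
     Zc = E',
     LA = fcomp X (enc io im E) (GA X M),
     RA = fcomp E' (UA X Y M) (dec io im E),
     etaA = uniA M,
     epsA = (\<lambda>z\<in>Obj E'. im (em_epsA M (inv io z))),
     LB = fcomp Y (enc io im E) (GB Y M),
     RB = fcomp E' (UB X Y M) (dec io im E),
     etaB = uniB M,
     epsB = (\<lambda>z\<in>Obj E'. im (em_epsB M (inv io z)))\<rparr>)"

definition Gamma_arr ::
  "(('xo, 'xm, 'yo, 'ym) em_obj \<Rightarrow> 'zo) \<Rightarrow> (('xo, 'xm, 'yo, 'ym) em_arr \<Rightarrow> 'zm) \<Rightarrow>
   ('xo, 'xm) cat \<Rightarrow> ('yo, 'ym) cat \<Rightarrow>
   ('xo, 'xm, 'yo, 'ym) morita_arr \<Rightarrow> ('xo, 'xm, 'yo, 'ym, 'zo, 'zm) dadj_arr" where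
  "Gamma_arr io im X Y p = (let E = EM X Y (src p); E' = EM X Y (tgt p) in \<lparr>
     asrc = Gamma_obj io im X Y (src p),
     atgt = Gamma_obj io im X Y (tgt p),
     afun = fcomp (relabel io im E') (enc io im E)
              (fcomp (relabel io im E') (em_restrict X Y p) (dec io im E'))\<rparr>)"

definition Gamma ::
  "(('xo, 'xm, 'yo, 'ym) em_obj \<Rightarrow> 'zo) \<Rightarrow> (('xo, 'xm, 'yo, 'ym) em_arr \<Rightarrow> 'zm) \<Rightarrow>
   ('xo, 'xm) cat \<Rightarrow> ('yo, 'ym) cat \<Rightarrow>
   (('xo, 'xm, 'yo, 'ym) morita, ('xo, 'xm, 'yo, 'ym) morita_arr,
    ('xo, 'xm, 'yo, 'ym, 'zo, 'zm) dadj, ('xo, 'xm, 'yo, 'ym, 'zo, 'zm) dadj_arr) ftr" where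
  "Gamma io im X Y = \<lparr>OM = (\<lambda>M\<in>Obj (Mor X Y). Gamma_obj io im X Y M),
                      AM = (\<lambda>p\<in>Arr (Mor X Y). Gamma_arr io im X Y p)\<rparr>"

end

theory Submission
  imports Defs
begin

text \<open>
  The idea is to read all the data as \<open>2 \<times> 2\<close> matrices indexed by \<open>A\<close> and \<open>B\<close>.  A Morita context is
  a matrix of functors \<open>M\<^sub>A\<^sub>A = A\<close>, \<open>M\<^sub>A\<^sub>B = T\<close>, \<open>M\<^sub>B\<^sub>A = \<close> the hat of \<open>T\<close>, \<open>M\<^sub>B\<^sub>B = B\<close>, with a
  multiplication \<open>\<mu>\<^sub>i\<^sub>j\<^sub>k : M\<^sub>i\<^sub>j M\<^sub>j\<^sub>k \<rightarrow> M\<^sub>i\<^sub>k\<close> for each of the eight triples of indices (the two monad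
  multiplications, the four actions and the two evaluations) and units on the diagonal; its axioms are
  the sixteen associativity laws and the eight unit laws of a monad.  A morphism is a matrix
  \<open>\<phi>\<^sub>i\<^sub>j\<close> compatible with each \<open>\<mu>\<^sub>i\<^sub>j\<^sub>k\<close> and with the units.  An object of the Eilenberg-Moore
  category is a pair of objects with actions \<open>\<alpha>\<^sub>i\<^sub>j : M\<^sub>i\<^sub>j x\<^sub>j \<rightarrow> x\<^sub>i\<close> satisfying
  \<open>\<alpha>\<^sub>i\<^sub>j \<circ> M\<^sub>i\<^sub>j \<alpha>\<^sub>j\<^sub>k = \<alpha>\<^sub>i\<^sub>k \<circ> \<mu>\<^sub>i\<^sub>j\<^sub>k\<close> and unit laws.  Every verification is thus one computation
  with arbitrary indices, made once in a lemma about arbitrary categories and used for the eight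
  triples.

  A double adjunction has \<open>M\<^sub>i\<^sub>j = R\<^sub>i L\<^sub>j\<close> and \<open>\<mu>\<^sub>i\<^sub>j\<^sub>k = R\<^sub>i \<epsilon>\<^sup>j L\<^sub>k\<close>; associativity is naturality of
  the counits (\<open>counit_exchange\<close>).  A functor \<open>F\<close> over the right adjoints has mates \<open>L\<^sub>j \<rightarrow> F L'\<^sub>j\<close>, and
  applying \<open>R\<^sub>i\<close> to them gives a morphism of Morita contexts (\<open>mate_multiplicative\<close>).

  For a Morita context \<open>M\<close> the free functors \<open>G\<^sub>A\<close>, \<open>G\<^sub>B\<close> into the Eilenberg-Moore category satisfy
  \<open>U\<^sub>i G\<^sub>j = M\<^sub>i\<^sub>j\<close>, so \<open>\<Upsilon> \<Gamma>\<close> is the identity functor on the nose (\<open>Upsilon_Gamma\<close>) and the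
  unit of the adjunction can be taken to be the identity.  The counit at a double adjunction is the
  comparison functor \<open>z \<mapsto> (R\<^sub>i z, R\<^sub>i \<epsilon>\<^sup>j\<^sub>z)\<close> from its apex to the Eilenberg-Moore category of its
  Morita context.  Its naturality says that \<open>F\<close> carries the counits of one double adjunction to
  those of the other up to the mates (\<open>counit_mate\<close>).  At \<open>\<Gamma> M\<close> the comparison functor is the
  identity (\<open>counit_Gamma_obj\<close>), and \<open>\<Upsilon>\<close> sends it to an identity (\<open>Upsilon_counit\<close>); these are the two
  triangle identities.  Since the unit and the counit at each \<open>\<Gamma> M\<close> are identities, \<open>\<Gamma>\<close> is full and
  faithful.
\<close>

section \<open>Categories, functors and natural transformations\<close>

lemma mem_Hom [simp]: "f \<in> Hom C a b \<longleftrightarrow> f \<in> Arr C \<and> Dom C f = a \<and> Cod C f = b"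
  by (simp add: Hom_def)

text \<open>Typing is expressed by conditional rewrite rules for arrows, domains and codomains.  In contrast to
  membership in a hom-set, their premises mention no intermediate objects that would have to be
  guessed, so the simplifier itself discharges the typing conditions of associativity and
  functoriality and brings every composite into right-nested form.\<close>

context category
begin

lemma Dom_Obj [simp]: "f \<in> Arr C \<Longrightarrow> Dom C f \<in> Obj C"
  by (rule Dom_in)

lemma Cod_Obj [simp]: "f \<in> Arr C \<Longrightarrow> Cod C f \<in> Obj C"
  by (rule Cod_in)

lemma Idt_typing [simp]:
  assumes "a \<in> Obj C"
  shows "Idt C a \<in> Arr C" "Dom C (Idt C a) = a" "Cod C (Idt C a) = a"
  using Idt_in[OF assms] by simp_all

lemma Comp_typing [simp]:
  assumes "f \<in> Arr C" "g \<in> Arr C" "Cod C f = Dom C g"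
  shows "g \<cdot>\<^bsub>C\<^esub> f \<in> Arr C" "Dom C (g \<cdot>\<^bsub>C\<^esub> f) = Dom C f" "Cod C (g \<cdot>\<^bsub>C\<^esub> f) = Cod C g"
  using Comp_in[of f "Dom C f" "Cod C f" g "Cod C g"] assms by simp_all

lemma Comp_Idt_right [simp]: "f \<in> Arr C \<Longrightarrow> Dom C f = a \<Longrightarrow> f \<cdot>\<^bsub>C\<^esub> Idt C a = f"
  by (rule Comp_Idt) simp

lemma Idt_Comp_left [simp]: "f \<in> Arr C \<Longrightarrow> Cod C f = b \<Longrightarrow> Idt C b \<cdot>\<^bsub>C\<^esub> f = f"
  by (rule Idt_Comp) simp

lemma Comp_assoc_right [simp]:
  "f \<in> Arr C \<Longrightarrow> g \<in> Arr C \<Longrightarrow> h \<in> Arr C \<Longrightarrow> Cod C f = Dom C g \<Longrightarrow> Cod C g = Dom C h \<Longrightarrow>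
    (h \<cdot>\<^bsub>C\<^esub> g) \<cdot>\<^bsub>C\<^esub> f = h \<cdot>\<^bsub>C\<^esub> (g \<cdot>\<^bsub>C\<^esub> f)"
  by (rule Comp_assoc) simp_all

text \<open>Composites are kept right-nested, so an equation between two-fold composites cannot be used as
  a rewrite rule inside a longer one; this lemma supplies its right-extended form.\<close>

lemma Comp_extend:
  assumes "g \<cdot>\<^bsub>C\<^esub> f = k \<cdot>\<^bsub>C\<^esub> h"
    and "f \<in> Arr C" "g \<in> Arr C" "h \<in> Arr C" "k \<in> Arr C" "p \<in> Arr C"
    and "Cod C p = Dom C f" "Cod C f = Dom C g" "Dom C h = Dom C f" "Cod C h = Dom C k"
  shows "g \<cdot>\<^bsub>C\<^esub> (f \<cdot>\<^bsub>C\<^esub> p) = k \<cdot>\<^bsub>C\<^esub> (h \<cdot>\<^bsub>C\<^esub> p)"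
  using arg_cong[OF assms(1), of "\<lambda>q. q \<cdot>\<^bsub>C\<^esub> p"] assms(2-) by simp

end

context cat_functor
begin

lemma OM_Obj [simp]: "a \<in> Obj C \<Longrightarrow> OM F a \<in> Obj D"
  using OM_in by auto

lemma AM_typing [simp]:
  assumes "f \<in> Arr C"
  shows "AM F f \<in> Arr D" "Dom D (AM F f) = OM F (Dom C f)" "Cod D (AM F f) = OM F (Cod C f)"
  using AM_in[of f "Dom C f" "Cod C f"] assms by simp_all

lemma AM_Idt_simp [simp]: "a \<in> Obj C \<Longrightarrow> AM F (Idt C a) = Idt D (OM F a)"
  by (rule AM_Idt)

lemma AM_Comp_simp [simp]:
  "f \<in> Arr C \<Longrightarrow> g \<in> Arr C \<Longrightarrow> Cod C f = Dom C g \<Longrightarrow>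
    AM F (g \<cdot>\<^bsub>C\<^esub> f) = AM F g \<cdot>\<^bsub>D\<^esub> AM F f"
  by (rule AM_Comp) simp_all

lemma AM_cong:
  assumes "g \<cdot>\<^bsub>C\<^esub> f = k \<cdot>\<^bsub>C\<^esub> h"
    and "f \<in> Arr C" "g \<in> Arr C" "h \<in> Arr C" "k \<in> Arr C"
    and "Cod C f = Dom C g" "Cod C h = Dom C k"
  shows "AM F g \<cdot>\<^bsub>D\<^esub> AM F f = AM F k \<cdot>\<^bsub>D\<^esub> AM F h"
  using arg_cong[OF assms(1), of "AM F"] assms(2-) by simp

end

lemma fcomp_apply [simp]:
  "a \<in> Obj C \<Longrightarrow> OM (fcomp C G F) a = OM G (OM F a)"
  "f \<in> Arr C \<Longrightarrow> AM (fcomp C G F) f = AM G (AM F f)"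
  by (simp_all add: fcomp_def)

lemma fid_apply [simp]:
  "a \<in> Obj C \<Longrightarrow> OM (fid C) a = a"
  "f \<in> Arr C \<Longrightarrow> AM (fid C) f = f"
  by (simp_all add: fid_def)

lemma cat_functorI:
  assumes "category C" "category D"
    and "OM F \<in> extensional (Obj C)" "AM F \<in> extensional (Arr C)"
    and "\<And>a. a \<in> Obj C \<Longrightarrow> OM F a \<in> Obj D"
    and "\<And>f. f \<in> Arr C \<Longrightarrow> AM F f \<in> Arr D \<and> Dom D (AM F f) = OM F (Dom C f)
          \<and> Cod D (AM F f) = OM F (Cod C f)"
    and "\<And>a. a \<in> Obj C \<Longrightarrow> AM F (Idt C a) = Idt D (OM F a)"
    and "\<And>f g. f \<in> Arr C \<Longrightarrow> g \<in> Arr C \<Longrightarrow> Cod C f = Dom C g \<Longrightarrow>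
          AM F (g \<cdot>\<^bsub>C\<^esub> f) = AM F g \<cdot>\<^bsub>D\<^esub> AM F f"
  shows "cat_functor C D F"
proof -
  interpret C: category C by fact
  interpret D: category D by fact
  show ?thesis
    by unfold_locales (use assms(3-) in \<open>auto simp: PiE_iff\<close>)
qed

lemma ftr_eqI:
  assumes "OM F \<in> extensional (Obj C)" "OM G \<in> extensional (Obj C)"
    and "AM F \<in> extensional (Arr C)" "AM G \<in> extensional (Arr C)"
    and "\<And>a. a \<in> Obj C \<Longrightarrow> OM F a = OM G a" "\<And>f. f \<in> Arr C \<Longrightarrow> AM F f = AM G f"
  shows "F = (G :: ('o, 'm, 'p, 'n) ftr)"
  using extensionalityI[OF assms(1,2,5)] extensionalityI[OF assms(3,4,6)] by simp

lemma (in cat_functor) functor_ext [simp]: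
  "OM F \<in> extensional (Obj C)" "AM F \<in> extensional (Arr C)"
  using OM_in AM_ext by (auto simp: PiE_iff)

lemma fcomp_ext [simp]:
  "OM (fcomp C G F) \<in> extensional (Obj C)" "AM (fcomp C G F) \<in> extensional (Arr C)"
  by (simp_all add: fcomp_def)

lemma fid_ext [simp]:
  "OM (fid C) \<in> extensional (Obj C)" "AM (fid C) \<in> extensional (Arr C)"
  by (simp_all add: fid_def)

lemma cat_functor_fid:
  assumes "category C"
  shows "cat_functor C C (fid C)"
proof -
  interpret category C by fact
  show ?thesis by (rule cat_functorI) (use assms in auto)
qed

lemma cat_functor_fcomp:
  assumes "cat_functor C D F" "cat_functor D E G"
  shows "cat_functor C E (fcomp C G F)"
proof -
  interpret F: cat_functor C D F by fact
  interpret G: cat_functor D E G by fact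
  show ?thesis by (rule cat_functorI) (use F.C.category_axioms G.D.category_axioms in auto)
qed

lemma fcomp_assoc:
  assumes "cat_functor C D F"
  shows "fcomp C H (fcomp C G F) = fcomp C (fcomp D H G) F"
proof -
  interpret F: cat_functor C D F by fact
  show ?thesis by (rule ftr_eqI[where C=C]) auto
qed

lemma fcomp_fid_left:
  assumes "cat_functor C D F"
  shows "fcomp C (fid D) F = F"
proof -
  interpret F: cat_functor C D F by fact
  show ?thesis by (rule ftr_eqI[where C=C]) (use assms in auto)
qed

lemma fcomp_fid_right:
  assumes "cat_functor C D F"
  shows "fcomp C F (fid C) = F"
proof -
  interpret F: cat_functor C D F by fact
  show ?thesis by (rule ftr_eqI[where C=C]) (use assms in auto)
qed

context nat_trans
begin

lemma component_typing [simp]: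
  assumes "a \<in> Obj C"
  shows "t a \<in> Arr D" "Dom D (t a) = OM F a" "Cod D (t a) = OM G a"
  using component[OF assms] by simp_all

lemma naturality:
  "f \<in> Arr C \<Longrightarrow> Dom C f = a \<Longrightarrow> Cod C f = b \<Longrightarrow> AM G f \<cdot>\<^bsub>D\<^esub> t a = t b \<cdot>\<^bsub>D\<^esub> AM F f"
  by (rule natural) simp

end

lemma nat_transI:
  assumes "cat_functor C D F" "cat_functor C D G" "t \<in> extensional (Obj C)"
    and "\<And>a. a \<in> Obj C \<Longrightarrow> t a \<in> Arr D \<and> Dom D (t a) = OM F a \<and> Cod D (t a) = OM G a"
    and "\<And>f. f \<in> Arr C \<Longrightarrow> AM G f \<cdot>\<^bsub>D\<^esub> t (Dom C f) = t (Cod C f) \<cdot>\<^bsub>D\<^esub> AM F f"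
  shows "nat_trans C D F G t"
proof -
  interpret F: cat_functor C D F by fact
  interpret G: cat_functor C D G by fact
  show ?thesis by unfold_locales (use assms(3-) in auto)
qed

lemma nat_trans_Idt:
  assumes "cat_functor C D F"
  shows "nat_trans C D F F (\<lambda>a\<in>Obj C. Idt D (OM F a))"
proof -
  interpret F: cat_functor C D F by fact
  show ?thesis by (rule nat_transI) (use assms in auto)
qed

lemma nat_trans_Comp:
  assumes "nat_trans C D F G s" "nat_trans C D G H t"
  shows "nat_trans C D F H (\<lambda>a\<in>Obj C. t a \<cdot>\<^bsub>D\<^esub> s a)"
proof -
  interpret s: nat_trans C D F G s by fact
  interpret t: nat_trans C D G H t by fact
  show ?thesis
  proof (rule nat_transI)
    fix f assume f: "f \<in> Arr C"
    let ?a = "Dom C f" and ?b = "Cod C f"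
    have s: "AM G f \<cdot>\<^bsub>D\<^esub> s ?a = s ?b \<cdot>\<^bsub>D\<^esub> AM F f" by (rule s.naturality) (use f in auto)
    have t: "AM H f \<cdot>\<^bsub>D\<^esub> t ?a = t ?b \<cdot>\<^bsub>D\<^esub> AM G f" by (rule t.naturality) (use f in auto)
    have "AM H f \<cdot>\<^bsub>D\<^esub> (t ?a \<cdot>\<^bsub>D\<^esub> s ?a) = t ?b \<cdot>\<^bsub>D\<^esub> (AM G f \<cdot>\<^bsub>D\<^esub> s ?a)"
      by (rule s.F.D.Comp_extend[OF t]) (use f in auto)
    then show "AM H f \<cdot>\<^bsub>D\<^esub> (\<lambda>a\<in>Obj C. t a \<cdot>\<^bsub>D\<^esub> s a) ?a = (\<lambda>a\<in>Obj C. t a \<cdot>\<^bsub>D\<^esub> s a) ?b \<cdot>\<^bsub>D\<^esub> AM F f"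
      using f s by simp
  qed (use s.F.cat_functor_axioms t.G.cat_functor_axioms in auto)
qed

section \<open>The category of Morita contexts\<close>

locale morita = morita_context_data X Y
    "fA M" "mulA M" "uniA M" "fB M" "mulB M" "uniB M"
    "fT M" "lact M" "ract M" "fTh M" "lacth M" "racth M" "ev M" "evh M"
  for X :: "('xo, 'xm) cat" and Y :: "('yo, 'ym) cat"
    and M :: "('xo, 'xm, 'yo, 'ym) morita"

lemma morita_context_iff: "morita_context X Y M \<longleftrightarrow> morita X Y M"
  by (simp add: morita_context_def morita_def)

text \<open>Pasting the square for \<open>w\<close> with the square for \<open>w'\<close> leaves \<open>P' t'\<close> to the left of \<open>s q'\<close>; naturality
  of \<open>s\<close> exchanges the two.  With \<open>s\<close>, \<open>t\<close>, \<open>w\<close> the components of \<open>\<phi>\<^sub>i\<^sub>j\<close>, \<open>\<phi>\<^sub>j\<^sub>k\<close>, \<open>\<phi>\<^sub>i\<^sub>k\<close>, this proves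
  that compatibility with \<open>\<mu>\<^sub>i\<^sub>j\<^sub>k\<close> is preserved by composition, for all eight triples of indices.\<close>

lemma multiplicative_Comp:
  assumes "nat_trans J I P P' s" "nat_trans J I P' P'' s'"
    and sq: "w \<cdot>\<^bsub>I\<^esub> \<mu> = \<mu>' \<cdot>\<^bsub>I\<^esub> s q' \<cdot>\<^bsub>I\<^esub> AM P t"
    and sq': "w' \<cdot>\<^bsub>I\<^esub> \<mu>' = \<mu>'' \<cdot>\<^bsub>I\<^esub> s' q'' \<cdot>\<^bsub>I\<^esub> AM P' t'"
    and "t \<in> Arr J" "t' \<in> Arr J" "Cod J t = q'" "Dom J t' = q'" "Cod J t' = q''"
    and "\<mu> \<in> Arr I" "\<mu>' \<in> Arr I" "\<mu>'' \<in> Arr I" "w \<in> Arr I" "w' \<in> Arr I"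
    and "Dom I \<mu> = OM P (Dom J t)" "Dom I \<mu>' = OM P' q'" "Dom I \<mu>'' = OM P'' q''"
    and "Cod I \<mu> = Dom I w" "Cod I \<mu>' = Cod I w" "Dom I w' = Cod I w"
  shows "(w' \<cdot>\<^bsub>I\<^esub> w) \<cdot>\<^bsub>I\<^esub> \<mu> = \<mu>'' \<cdot>\<^bsub>I\<^esub> (s' q'' \<cdot>\<^bsub>I\<^esub> s q'') \<cdot>\<^bsub>I\<^esub> AM P (t' \<cdot>\<^bsub>J\<^esub> t)"
proof -
  interpret s: nat_trans J I P P' s by fact
  interpret s': nat_trans J I P' P'' s' by fact
  note [simp] = assms(5-)
  have q [simp]: "q' \<in> Obj J" "q'' \<in> Obj J"
    using s.F.C.Cod_in[of t] s.F.C.Cod_in[of t'] by simp_all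
  have "w' \<cdot>\<^bsub>I\<^esub> w \<cdot>\<^bsub>I\<^esub> \<mu> = w' \<cdot>\<^bsub>I\<^esub> \<mu>' \<cdot>\<^bsub>I\<^esub> s q' \<cdot>\<^bsub>I\<^esub> AM P t"
    by (simp only: sq)
  also have "\<dots> = (w' \<cdot>\<^bsub>I\<^esub> \<mu>') \<cdot>\<^bsub>I\<^esub> s q' \<cdot>\<^bsub>I\<^esub> AM P t"
    by simp
  also have "\<dots> = \<mu>'' \<cdot>\<^bsub>I\<^esub> s' q'' \<cdot>\<^bsub>I\<^esub> AM P' t' \<cdot>\<^bsub>I\<^esub> s q' \<cdot>\<^bsub>I\<^esub> AM P t"
    by (subst sq') simp
  also have "AM P' t' \<cdot>\<^bsub>I\<^esub> s q' \<cdot>\<^bsub>I\<^esub> AM P t = s q'' \<cdot>\<^bsub>I\<^esub> AM P t' \<cdot>\<^bsub>I\<^esub> AM P t"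
    by (rule s.F.D.Comp_extend[OF s.naturality]) simp_all
  finally show ?thesis
    by simp
qed

text \<open>The two conditions on right actions are stated with the Godement product written in the other
  order.  By naturality they take the common form
  \<open>\<phi>\<^sub>i\<^sub>k \<circ> \<mu>\<^sub>i\<^sub>j\<^sub>k = \<mu>'\<^sub>i\<^sub>j\<^sub>k \<circ> \<phi>\<^sub>i\<^sub>j M'\<^sub>j\<^sub>k \<circ> M\<^sub>i\<^sub>j \<phi>\<^sub>j\<^sub>k\<close> as well.\<close>

context morita_morphism
begin

lemma p3_ract_godement:
  assumes "y \<in> Obj Y"
  shows "p3 y \<cdot>\<^bsub>X\<^esub> ract M y = ract M' y \<cdot>\<^bsub>X\<^esub> p3 (OM (fB M') y) \<cdot>\<^bsub>X\<^esub> AM (fT M) (p2 y)"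
  using p3_ract[OF assms] p3.naturality[of "p2 y", OF _ refl refl] assms by simp

lemma p4_racth_godement:
  assumes "x \<in> Obj X"
  shows "p4 x \<cdot>\<^bsub>Y\<^esub> racth M x = racth M' x \<cdot>\<^bsub>Y\<^esub> p4 (OM (fA M') x) \<cdot>\<^bsub>Y\<^esub> AM (fTh M) (p1 x)"
  using p4_racth[OF assms] p4.naturality[of "p1 x", OF _ refl refl] assms by simp

lemmas multiplicative =
  p1.mult[unfolded godement_def] p2.mult[unfolded godement_def] p3_lact p4_lacth
  p3_ract_godement p4_racth_godement p1_ev[unfolded godement_def] p2_evh[unfolded godement_def]

end

text \<open>The converse of \<open>multiplicative\<close>: it suffices to check the eight conditions in their common form.\<close>

lemma morita_morphismI:
  assumes "morita_context X Y M" "morita_context X Y M'"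
    and nat: "nat_trans X X (fA M) (fA M') p1" "nat_trans Y Y (fB M) (fB M') p2"
      "nat_trans Y X (fT M) (fT M') p3" "nat_trans X Y (fTh M) (fTh M') p4"
    and unit: "\<And>x. x \<in> Obj X \<Longrightarrow> p1 x \<cdot>\<^bsub>X\<^esub> uniA M x = uniA M' x"
      "\<And>y. y \<in> Obj Y \<Longrightarrow> p2 y \<cdot>\<^bsub>Y\<^esub> uniB M y = uniB M' y"
    and mult: "\<And>x. x \<in> Obj X \<Longrightarrow>
        p1 x \<cdot>\<^bsub>X\<^esub> mulA M x = mulA M' x \<cdot>\<^bsub>X\<^esub> p1 (OM (fA M') x) \<cdot>\<^bsub>X\<^esub> AM (fA M) (p1 x)"
      "\<And>y. y \<in> Obj Y \<Longrightarrow>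
        p2 y \<cdot>\<^bsub>Y\<^esub> mulB M y = mulB M' y \<cdot>\<^bsub>Y\<^esub> p2 (OM (fB M') y) \<cdot>\<^bsub>Y\<^esub> AM (fB M) (p2 y)"
      "\<And>y. y \<in> Obj Y \<Longrightarrow>
        p3 y \<cdot>\<^bsub>X\<^esub> lact M y = lact M' y \<cdot>\<^bsub>X\<^esub> p1 (OM (fT M') y) \<cdot>\<^bsub>X\<^esub> AM (fA M) (p3 y)"
      "\<And>x. x \<in> Obj X \<Longrightarrow>
        p4 x \<cdot>\<^bsub>Y\<^esub> lacth M x = lacth M' x \<cdot>\<^bsub>Y\<^esub> p2 (OM (fTh M') x) \<cdot>\<^bsub>Y\<^esub> AM (fB M) (p4 x)"
      "\<And>y. y \<in> Obj Y \<Longrightarrow>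
        p3 y \<cdot>\<^bsub>X\<^esub> ract M y = ract M' y \<cdot>\<^bsub>X\<^esub> p3 (OM (fB M') y) \<cdot>\<^bsub>X\<^esub> AM (fT M) (p2 y)"
      "\<And>x. x \<in> Obj X \<Longrightarrow>
        p4 x \<cdot>\<^bsub>Y\<^esub> racth M x = racth M' x \<cdot>\<^bsub>Y\<^esub> p4 (OM (fA M') x) \<cdot>\<^bsub>Y\<^esub> AM (fTh M) (p1 x)"
      "\<And>x. x \<in> Obj X \<Longrightarrow>
        p1 x \<cdot>\<^bsub>X\<^esub> ev M x = ev M' x \<cdot>\<^bsub>X\<^esub> p3 (OM (fTh M') x) \<cdot>\<^bsub>X\<^esub> AM (fT M) (p4 x)"
      "\<And>y. y \<in> Obj Y \<Longrightarrow>
        p2 y \<cdot>\<^bsub>Y\<^esub> evh M y = evh M' y \<cdot>\<^bsub>Y\<^esub> p4 (OM (fT M') y) \<cdot>\<^bsub>Y\<^esub> AM (fTh M) (p3 y)"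
  shows "morita_morphism X Y M M' p1 p2 p3 p4"
proof -
  interpret M: morita X Y M using assms(1) by (simp add: morita_context_iff)
  interpret M': morita X Y M' using assms(2) by (simp add: morita_context_iff)
  interpret p1: nat_trans X X "fA M" "fA M'" p1 by fact
  interpret p2: nat_trans Y Y "fB M" "fB M'" p2 by fact
  interpret p3: nat_trans Y X "fT M" "fT M'" p3 by fact
  interpret p4: nat_trans X Y "fTh M" "fTh M'" p4 by fact
  have "AM (fT M') (p2 y) \<cdot>\<^bsub>X\<^esub> p3 (OM (fB M) y) = p3 (OM (fB M') y) \<cdot>\<^bsub>X\<^esub> AM (fT M) (p2 y)"
    if "y \<in> Obj Y" for y using that by (intro p3.naturality) simp_all
  moreover have "AM (fTh M') (p1 x) \<cdot>\<^bsub>Y\<^esub> p4 (OM (fA M) x) = p4 (OM (fA M') x) \<cdot>\<^bsub>Y\<^esub> AM (fTh M) (p1 x)"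
    if "x \<in> Obj X" for x using that by (intro p4.naturality) simp_all
  ultimately show ?thesis
    by (intro morita_morphism.intro morita_morphism_axioms.intro monad_morphism.intro
        monad_morphism_axioms.intro nat M.T.A.monad_axioms M.T.B.monad_axioms
        M'.T.A.monad_axioms M'.T.B.monad_axioms)
      (simp_all add: godement_def unit mult)
qed

lemma morita_morphism_Idt:
  assumes "morita_context X Y M"
  shows "morita_morphism X Y M M (\<lambda>x\<in>Obj X. Idt X (OM (fA M) x)) (\<lambda>y\<in>Obj Y. Idt Y (OM (fB M) y))
    (\<lambda>y\<in>Obj Y. Idt X (OM (fT M) y)) (\<lambda>x\<in>Obj X. Idt Y (OM (fTh M) x))"
proof -
  interpret morita X Y M using assms by (simp add: morita_context_iff)
  show ?thesis
    by (intro morita_morphismI assms nat_trans_Idt T.A.A.cat_functor_axioms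
        T.B.A.cat_functor_axioms T.T.cat_functor_axioms Th.T.cat_functor_axioms) simp_all
qed

lemma morita_morphism_Comp:
  assumes "morita_context X Y M" "morita_context X Y M'" "morita_context X Y M''"
    and "morita_morphism X Y M M' p1 p2 p3 p4" "morita_morphism X Y M' M'' q1 q2 q3 q4"
  shows "morita_morphism X Y M M'' (\<lambda>x\<in>Obj X. q1 x \<cdot>\<^bsub>X\<^esub> p1 x) (\<lambda>y\<in>Obj Y. q2 y \<cdot>\<^bsub>Y\<^esub> p2 y)
    (\<lambda>y\<in>Obj Y. q3 y \<cdot>\<^bsub>X\<^esub> p3 y) (\<lambda>x\<in>Obj X. q4 x \<cdot>\<^bsub>Y\<^esub> p4 x)"
proof -
  interpret M: morita X Y M using assms(1) by (simp add: morita_context_iff)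
  interpret M': morita X Y M' using assms(2) by (simp add: morita_context_iff)
  interpret M'': morita X Y M'' using assms(3) by (simp add: morita_context_iff)
  interpret p: morita_morphism X Y M M' p1 p2 p3 p4 by fact
  interpret q: morita_morphism X Y M' M'' q1 q2 q3 q4 by fact
  note nat1 = p.p1.nat_trans_axioms q.p1.nat_trans_axioms
  note nat2 = p.p2.nat_trans_axioms q.p2.nat_trans_axioms
  note nat3 = p.p3.nat_trans_axioms q.p3.nat_trans_axioms
  note nat4 = p.p4.nat_trans_axioms q.p4.nat_trans_axioms
  show ?thesis
    apply (rule morita_morphismI[OF assms(1,3) nat_trans_Comp[OF nat1] nat_trans_Comp[OF nat2]
          nat_trans_Comp[OF nat3] nat_trans_Comp[OF nat4]])
    subgoal for x
      by (simp add: p.p1.unit q.p1.unit)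
    subgoal for y
      by (simp add: p.p2.unit q.p2.unit)
    subgoal for x
      using multiplicative_Comp[OF nat1 p.multiplicative(1) q.multiplicative(1), of x] by simp
    subgoal for y
      using multiplicative_Comp[OF nat2 p.multiplicative(2) q.multiplicative(2), of y] by simp
    subgoal for y
      using multiplicative_Comp[OF nat1 p.multiplicative(3) q.multiplicative(3), of y] by simp
    subgoal for x
      using multiplicative_Comp[OF nat2 p.multiplicative(4) q.multiplicative(4), of x] by simp
    subgoal for y
      using multiplicative_Comp[OF nat3 p.multiplicative(5) q.multiplicative(5), of y] by simp
    subgoal for x
      using multiplicative_Comp[OF nat4 p.multiplicative(6) q.multiplicative(6), of x] by simp
    subgoal for x
      using multiplicative_Comp[OF nat3 p.multiplicative(7) q.multiplicative(7), of x] by simp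
    subgoal for y
      using multiplicative_Comp[OF nat4 p.multiplicative(8) q.multiplicative(8), of y] by simp
    done
qed

lemma Mor_simps [simp]:
  "Obj (Mor X Y) = {M. morita_context X Y M}"
  "Arr (Mor X Y) = {p. morita_context X Y (src p) \<and> morita_context X Y (tgt p) \<and>
     morita_morphism X Y (src p) (tgt p) (ph1 p) (ph2 p) (ph3 p) (ph4 p)}"
  "Dom (Mor X Y) = src" "Cod (Mor X Y) = tgt"
  by (simp_all add: Mor_def)

lemma category_Mor: "category (Mor X Y)"
proof
  fix f a b assume "f \<in> Hom (Mor X Y) a b"
  then have *: "morita_morphism X Y a b (ph1 f) (ph2 f) (ph3 f) (ph4 f)" "src f = a" "tgt f = b"
    by auto
  interpret p: morita_morphism X Y a b "ph1 f" "ph2 f" "ph3 f" "ph4 f" by fact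
  show "f \<cdot>\<^bsub>Mor X Y\<^esub> Idt (Mor X Y) a = f"
    unfolding Mor_def using *(2,3)
    by (auto intro!: morita_arr.equality extensionalityI[OF _ p.p1.ext] extensionalityI[OF _ p.p2.ext]
         extensionalityI[OF _ p.p3.ext] extensionalityI[OF _ p.p4.ext])
  show "Idt (Mor X Y) b \<cdot>\<^bsub>Mor X Y\<^esub> f = f"
    unfolding Mor_def using *(2,3)
    by (auto intro!: morita_arr.equality extensionalityI[OF _ p.p1.ext] extensionalityI[OF _ p.p2.ext]
         extensionalityI[OF _ p.p3.ext] extensionalityI[OF _ p.p4.ext])
next
  fix a assume "a \<in> Obj (Mor X Y)"
  then show "Idt (Mor X Y) a \<in> Hom (Mor X Y) a a"
    using morita_morphism_Idt[of X Y a] by (simp add: Mor_def)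
next
  fix f g a b c assume "f \<in> Hom (Mor X Y) a b" "g \<in> Hom (Mor X Y) b c"
  then show "g \<cdot>\<^bsub>Mor X Y\<^esub> f \<in> Hom (Mor X Y) a c"
    using morita_morphism_Comp[of X Y a b c "ph1 f" "ph2 f" "ph3 f" "ph4 f" "ph1 g" "ph2 g" "ph3 g" "ph4 g"]
    by (auto simp: Mor_def)
next
  fix f g h a b c d
  assume "f \<in> Hom (Mor X Y) a b" "g \<in> Hom (Mor X Y) b c" "h \<in> Hom (Mor X Y) c d"
  then have *: "morita_morphism X Y a b (ph1 f) (ph2 f) (ph3 f) (ph4 f)"
      "morita_morphism X Y b c (ph1 g) (ph2 g) (ph3 g) (ph4 g)"
      "morita_morphism X Y c d (ph1 h) (ph2 h) (ph3 h) (ph4 h)"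
    by auto
  interpret p: morita_morphism X Y a b "ph1 f" "ph2 f" "ph3 f" "ph4 f" by fact
  interpret q: morita_morphism X Y b c "ph1 g" "ph2 g" "ph3 g" "ph4 g" by fact
  interpret r: morita_morphism X Y c d "ph1 h" "ph2 h" "ph3 h" "ph4 h" by fact
  show "(h \<cdot>\<^bsub>Mor X Y\<^esub> g) \<cdot>\<^bsub>Mor X Y\<^esub> f = h \<cdot>\<^bsub>Mor X Y\<^esub> (g \<cdot>\<^bsub>Mor X Y\<^esub> f)"
    by (auto simp: Mor_def intro!: restrict_ext)
qed auto

section \<open>The category of double adjunctions\<close>

lemma Adj_simps [simp]:
  "Obj (Adj X Y) = {Z. double_adjunction X Y Z}"
  "Arr (Adj X Y) = {F. double_adjunction X Y (asrc F) \<and> double_adjunction X Y (atgt F) \<and>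
     dadj_morphism (asrc F) (atgt F) (afun F)}"
  "Dom (Adj X Y) = asrc" "Cod (Adj X Y) = atgt"
  by (simp_all add: Adj_def)

lemma double_adjunctionD:
  assumes "double_adjunction X Y Z"
  shows "category (Zc Z)" "cat_functor X (Zc Z) (LA Z)" "cat_functor (Zc Z) X (RA Z)"
    "cat_functor Y (Zc Z) (LB Z)" "cat_functor (Zc Z) Y (RB Z)"
proof -
  interpret A: adjunction X "Zc Z" "LA Z" "RA Z" "etaA Z" "epsA Z"
    using assms by (simp add: double_adjunction_def)
  interpret B: adjunction Y "Zc Z" "LB Z" "RB Z" "etaB Z" "epsB Z"
    using assms by (simp add: double_adjunction_def)
  show "category (Zc Z)" "cat_functor X (Zc Z) (LA Z)" "cat_functor (Zc Z) X (RA Z)"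
    "cat_functor Y (Zc Z) (LB Z)" "cat_functor (Zc Z) Y (RB Z)"
    by unfold_locales
qed

lemma dadj_morphism_fid:
  assumes "double_adjunction X Y Z"
  shows "dadj_morphism Z Z (fid (Zc Z))"
  using double_adjunctionD[OF assms]
  by (simp add: dadj_morphism_def cat_functor_fid fcomp_fid_right)

lemma dadj_morphism_fcomp:
  assumes "dadj_morphism Z Z' F" "dadj_morphism Z' Z'' F'"
  shows "dadj_morphism Z Z'' (fcomp (Zc Z'') F F')"
  using assms cat_functor_fcomp fcomp_assoc unfolding dadj_morphism_def by metis

lemma category_Adj: "category (Adj X Y)"
proof
  fix f a b assume f: "f \<in> Hom (Adj X Y) a b"
  then have "cat_functor (Zc b) (Zc a) (afun f)" by (auto simp: dadj_morphism_def)
  with f show "f \<cdot>\<^bsub>Adj X Y\<^esub> Idt (Adj X Y) a = f" "Idt (Adj X Y) b \<cdot>\<^bsub>Adj X Y\<^esub> f = f"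
    by (auto simp: Adj_def fcomp_fid_left fcomp_fid_right)
next
  fix a assume "a \<in> Obj (Adj X Y)"
  then show "Idt (Adj X Y) a \<in> Hom (Adj X Y) a a"
    using dadj_morphism_fid[of X Y a] by (simp add: Adj_def)
next
  fix f g a b c assume "f \<in> Hom (Adj X Y) a b" "g \<in> Hom (Adj X Y) b c"
  then show "g \<cdot>\<^bsub>Adj X Y\<^esub> f \<in> Hom (Adj X Y) a c"
    using dadj_morphism_fcomp[of a b "afun f" c "afun g"] by (auto simp: Adj_def)
next
  fix f g h a b c d
  assume "f \<in> Hom (Adj X Y) a b" "g \<in> Hom (Adj X Y) b c" "h \<in> Hom (Adj X Y) c d"
  moreover from this have "cat_functor (Zc d) (Zc c) (afun h)" by (auto simp: dadj_morphism_def)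
  ultimately show "(h \<cdot>\<^bsub>Adj X Y\<^esub> g) \<cdot>\<^bsub>Adj X Y\<^esub> f = h \<cdot>\<^bsub>Adj X Y\<^esub> (g \<cdot>\<^bsub>Adj X Y\<^esub> f)"
    by (auto simp: Adj_def fcomp_assoc)
qed auto

section \<open>Morita contexts from double adjunctions\<close>

text \<open>All sixteen associativity laws of the Morita context of a double adjunction are instances: there
  \<open>f\<close> is a component of one of the two counits and \<open>G\<close> is one of the two right adjoints.\<close>

lemma (in adjunction) counit_exchange:
  assumes "cat_functor D E G" "f \<in> Arr D" "Dom D f = z'" "Cod D f = z"
  shows "AM G (eps z) \<cdot>\<^bsub>E\<^esub> AM G (AM L (AM R f)) = AM G f \<cdot>\<^bsub>E\<^esub> AM G (eps z')"
proof -
  interpret G: cat_functor D E G by fact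
  have "eps z \<cdot>\<^bsub>D\<^esub> AM L (AM R f) = f \<cdot>\<^bsub>D\<^esub> eps z'"
    using eps.naturality[OF assms(2-4)] assms(2) by simp
  then show ?thesis
    by (rule G.AM_cong) (use assms in auto)
qed

text \<open>With \<open>G = R\<^sub>i\<close> and \<open>H = L\<^sub>k\<close> this is the multiplication \<open>\<mu>\<^sub>i\<^sub>j\<^sub>k\<close>, the adjunction at hand being the
  one with index \<open>j\<close>.\<close>

lemma (in adjunction) nat_trans_counit:
  assumes "cat_functor K D H" "cat_functor D E G"
  shows "nat_trans K E (fcomp K (fcomp C G L) (fcomp K R H)) (fcomp K G H)
           (\<lambda>x\<in>Obj K. AM G (eps (OM H x)))"
proof -
  interpret H: cat_functor K D H by fact
  interpret G: cat_functor D E G by fact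
  note functors = cat_functor_fcomp H.cat_functor_axioms G.cat_functor_axioms
    L.cat_functor_axioms R.cat_functor_axioms
  show ?thesis
    by (rule nat_transI) (auto intro: functors simp: counit_exchange[OF assms(2)])
qed

lemma (in adjunction) monad_of_adjunction:
  "monad C (fcomp C R L) (\<lambda>x\<in>Obj C. AM R (eps (OM L x))) eta"
proof -
  have "monad_axioms C (fcomp C R L) (\<lambda>x\<in>Obj C. AM R (eps (OM L x))) eta"
  proof
    fix x assume x: "x \<in> Obj C"
    show "(\<lambda>x\<in>Obj C. AM R (eps (OM L x))) x \<cdot>\<^bsub>C\<^esub>
        AM (fcomp C R L) ((\<lambda>x\<in>Obj C. AM R (eps (OM L x))) x) =
        (\<lambda>x\<in>Obj C. AM R (eps (OM L x))) x \<cdot>\<^bsub>C\<^esub>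
        (\<lambda>x\<in>Obj C. AM R (eps (OM L x))) (OM (fcomp C R L) x)"
      using x by (simp add: counit_exchange[OF R.cat_functor_axioms])
    show "(\<lambda>x\<in>Obj C. AM R (eps (OM L x))) x \<cdot>\<^bsub>C\<^esub> eta (OM (fcomp C R L) x) =
        Idt C (OM (fcomp C R L) x)"
      using x triangle_R by simp
    have "AM R (eps (OM L x) \<cdot>\<^bsub>D\<^esub> AM L (eta x)) = Idt C (OM R (OM L x))"
      using x triangle_L by simp
    then show "(\<lambda>x\<in>Obj C. AM R (eps (OM L x))) x \<cdot>\<^bsub>C\<^esub> AM (fcomp C R L) (eta x) =
        Idt C (OM (fcomp C R L) x)"
      using x by simp
  qed
  then show ?thesis
    by (intro monad.intro nat_trans_counit eta.nat_trans_axioms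
          cat_functor_fcomp[OF L.cat_functor_axioms R.cat_functor_axioms]
          L.cat_functor_axioms R.cat_functor_axioms)
qed

locale two_adjunctions =
  A: adjunction X Z La Ra etaa epsa + B: adjunction Y Z Lb Rb etab epsb
  for X :: "('xo, 'xm) cat" and Y :: "('yo, 'ym) cat" and Z :: "('zo, 'zm) cat"
    and La Ra etaa epsa Lb Rb etab epsb
begin

lemmas functors =
  A.L.cat_functor_axioms A.R.cat_functor_axioms B.L.cat_functor_axioms B.R.cat_functor_axioms

text \<open>The statement is not symmetric in the two adjunctions, but its hypotheses are: exchanging them
  gives the second bialgebra functor of the Morita context.\<close>

lemma bialgebra_functor_of_adjunctions:
  "bialgebra_functor X Y
     (fcomp X Ra La) (\<lambda>x\<in>Obj X. AM Ra (epsa (OM La x))) etaa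
     (fcomp Y Rb Lb) (\<lambda>y\<in>Obj Y. AM Rb (epsb (OM Lb y))) etab
     (fcomp Y Ra Lb) (\<lambda>y\<in>Obj Y. AM Ra (epsa (OM Lb y))) (\<lambda>y\<in>Obj Y. AM Ra (epsb (OM Lb y)))"
proof -
  have unit: "AM Ra (epsb (OM Lb y)) \<cdot>\<^bsub>X\<^esub> AM Ra (AM Lb (etab y)) = Idt X (OM Ra (OM Lb y))"
    if "y \<in> Obj Y" for y
    using that arg_cong[OF B.triangle_L, of y "AM Ra"] by simp
  show ?thesis
    by (intro bialgebra_functor.intro bialgebra_functor_axioms.intro A.monad_of_adjunction
          B.monad_of_adjunction A.nat_trans_counit B.nat_trans_counit cat_functor_fcomp[OF B.L.cat_functor_axioms A.R.cat_functor_axioms] functors)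
      (auto simp: unit A.triangle_R
         A.counit_exchange[OF A.R.cat_functor_axioms] B.counit_exchange[OF A.R.cat_functor_axioms])
qed

end

lemma two_adjunctions_swap:
  "two_adjunctions X Y Z La Ra etaa epsa Lb Rb etab epsb \<Longrightarrow>
   two_adjunctions Y X Z Lb Rb etab epsb La Ra etaa epsa"
  by (simp add: two_adjunctions_def)

lemma double_adjunction_iff:
  "double_adjunction X Y Z \<longleftrightarrow> two_adjunctions X Y (Zc Z)
     (LA Z) (RA Z) (etaA Z) (epsA Z) (LB Z) (RB Z) (etaB Z) (epsB Z)"
  by (simp add: double_adjunction_def two_adjunctions_def)

lemma morita_context_Upsilon_obj:
  assumes "double_adjunction X Y Z"
  shows "morita_context X Y (Upsilon_obj X Y Z)"
proof -
  interpret AB: two_adjunctions X Y "Zc Z"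
    "LA Z" "RA Z" "etaA Z" "epsA Z" "LB Z" "RB Z" "etaB Z" "epsB Z"
    using assms by (simp add: double_adjunction_iff)
  interpret BA: two_adjunctions Y X "Zc Z"
    "LB Z" "RB Z" "etaB Z" "epsB Z" "LA Z" "RA Z" "etaA Z" "epsA Z"
    by (rule two_adjunctions_swap) (rule AB.two_adjunctions_axioms)
  note exchange =
    AB.A.counit_exchange[OF AB.A.R.cat_functor_axioms]
    AB.A.counit_exchange[OF AB.B.R.cat_functor_axioms]
    AB.B.counit_exchange[OF AB.A.R.cat_functor_axioms]
    AB.B.counit_exchange[OF AB.B.R.cat_functor_axioms]
  show ?thesis
    unfolding morita_context_def Upsilon_obj_def morita.simps
    by (intro morita_context_data.intro morita_context_data_axioms.intro
          AB.bialgebra_functor_of_adjunctions BA.bialgebra_functor_of_adjunctions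
          AB.A.nat_trans_counit AB.B.nat_trans_counit AB.functors)
      (simp_all add: exchange)
qed

text \<open>The mate \<open>L \<rightarrow> F L'\<close> of the identity \<open>R F = R'\<close>, which treats the two adjunctions of a double
  adjunction uniformly.\<close>

definition mate where
  "mate D eps L F L' eta' x = eps (OM F (OM L' x)) \<cdot>\<^bsub>D\<^esub> AM L (eta' x)"

locale functor_over =
  L: adjunction C D L R eta eps + L': adjunction C D' L' R' eta' eps' + F: cat_functor D' D F
  for C :: "('o, 'm) cat" and D :: "('p, 'n) cat" and L R eta eps
    and D' :: "('q, 'l) cat" and L' R' eta' eps' and F +
  assumes over: "fcomp D' R F = R'"
begin

lemma over_apply [simp]:
  "z \<in> Obj D' \<Longrightarrow> OM R (OM F z) = OM R' z" "h \<in> Arr D' \<Longrightarrow> AM R (AM F h) = AM R' h"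
  using over by (metis fcomp_apply)+

abbreviation a where "a \<equiv> mate D eps L F L' eta'"

lemma mate_typing [simp]:
  assumes "x \<in> Obj C"
  shows "a x \<in> Arr D" "Dom D (a x) = OM L x" "Cod D (a x) = OM F (OM L' x)"
  using assms by (simp_all add: mate_def)

lemma mate_naturality:
  assumes f [simp]: "f \<in> Arr C" "Dom C f = x" "Cod C f = y"
  shows "AM F (AM L' f) \<cdot>\<^bsub>D\<^esub> a x = a y \<cdot>\<^bsub>D\<^esub> AM L f"
proof -
  have xy [simp]: "x \<in> Obj C" "y \<in> Obj C"
    using f L.L.C.Dom_in[of f] L.L.C.Cod_in[of f] by auto
  have "AM F (AM L' f) \<cdot>\<^bsub>D\<^esub> eps (OM F (OM L' x)) =
      eps (OM F (OM L' y)) \<cdot>\<^bsub>D\<^esub> AM L (AM R (AM F (AM L' f)))"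
    using L.eps.naturality[of "AM F (AM L' f)", OF _ refl refl] by simp
  then have "AM F (AM L' f) \<cdot>\<^bsub>D\<^esub> a x =
      eps (OM F (OM L' y)) \<cdot>\<^bsub>D\<^esub> (AM L (AM R (AM F (AM L' f))) \<cdot>\<^bsub>D\<^esub> AM L (eta' x))"
    unfolding mate_def by (rule L.L.D.Comp_extend) simp_all
  also have "AM L (AM R (AM F (AM L' f))) \<cdot>\<^bsub>D\<^esub> AM L (eta' x) = AM L (eta' y) \<cdot>\<^bsub>D\<^esub> AM L f"
    by (rule L.L.AM_cong) (use L'.eta.naturality[OF f] in simp_all)
  finally show ?thesis
    by (simp add: mate_def)
qed

text \<open>This is the sense in which \<open>F\<close> preserves counits.  Naturality of \<open>\<epsilon>\<close> at \<open>F \<epsilon>'\<^sub>z\<close> moves the mate past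
  the counit, after which a triangle identity of the adjunction over \<open>D'\<close> remains.\<close>

lemma counit_mate:
  assumes z [simp]: "z \<in> Obj D'"
  shows "AM F (eps' z) \<cdot>\<^bsub>D\<^esub> a (OM R' z) = eps (OM F z)"
proof -
  have "AM F (eps' z) \<cdot>\<^bsub>D\<^esub> eps (OM F (OM L' (OM R' z))) =
      eps (OM F z) \<cdot>\<^bsub>D\<^esub> AM L (AM R (AM F (eps' z)))"
    using L.eps.naturality[of "AM F (eps' z)", OF _ refl refl] by simp
  then have "AM F (eps' z) \<cdot>\<^bsub>D\<^esub> a (OM R' z) =
      eps (OM F z) \<cdot>\<^bsub>D\<^esub> (AM L (AM R (AM F (eps' z))) \<cdot>\<^bsub>D\<^esub> AM L (eta' (OM R' z)))"
    unfolding mate_def by (rule L.L.D.Comp_extend) simp_all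
  also have "AM L (AM R (AM F (eps' z))) \<cdot>\<^bsub>D\<^esub> AM L (eta' (OM R' z)) = AM L (Idt C (OM R' z))"
    using arg_cong[OF L'.triangle_R[OF z], of "AM L"] by simp
  finally show ?thesis
    by simp
qed

lemma mate_unit:
  assumes x [simp]: "x \<in> Obj C"
  shows "AM R (a x) \<cdot>\<^bsub>C\<^esub> eta x = eta' x"
proof -
  have "AM R (AM L (eta' x)) \<cdot>\<^bsub>C\<^esub> eta x = eta (OM R (OM F (OM L' x))) \<cdot>\<^bsub>C\<^esub> eta' x"
    using L.eta.naturality[of "eta' x", OF _ refl refl] by simp
  moreover have "AM R (eps (OM F (OM L' x))) \<cdot>\<^bsub>C\<^esub> eta (OM R (OM F (OM L' x))) =
      Idt C (OM R (OM F (OM L' x)))"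
    by (rule L.triangle_R) simp
  then have "AM R (eps (OM F (OM L' x))) \<cdot>\<^bsub>C\<^esub> (eta (OM R (OM F (OM L' x))) \<cdot>\<^bsub>C\<^esub> eta' x) = eta' x"
    by (subst L.L.C.Comp_assoc_right[symmetric]) simp_all
  ultimately show ?thesis
    by (simp add: mate_def)
qed

lemma nat_trans_mate:
  assumes "cat_functor D E G" "fcomp D' G F = G'"
  shows "nat_trans C E (fcomp C G L) (fcomp C G' L') (\<lambda>x\<in>Obj C. AM G (a x))"
proof -
  interpret G: cat_functor D E G by fact
  have G': "cat_functor D' E G'"
    using assms cat_functor_fcomp F.cat_functor_axioms by blast
  have over_G [simp]: "z \<in> Obj D' \<Longrightarrow> OM G' z = OM G (OM F z)"
      "h \<in> Arr D' \<Longrightarrow> AM G' h = AM G (AM F h)" for z h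
    using assms(2) by (metis fcomp_apply)+
  show ?thesis
  proof (rule nat_transI)
    show "cat_functor C E (fcomp C G L)" "cat_functor C E (fcomp C G' L')"
      by (rule cat_functor_fcomp[OF L.L.cat_functor_axioms assms(1)]
          cat_functor_fcomp[OF L'.L.cat_functor_axioms G'])+
    fix f assume [simp]: "f \<in> Arr C"
    have "AM G (AM F (AM L' f)) \<cdot>\<^bsub>E\<^esub> AM G (a (Dom C f)) = AM G (a (Cod C f)) \<cdot>\<^bsub>E\<^esub> AM G (AM L f)"
      by (rule G.AM_cong) (simp_all add: mate_naturality)
    then show "AM (fcomp C G' L') f \<cdot>\<^bsub>E\<^esub> (\<lambda>x\<in>Obj C. AM G (a x)) (Dom C f) =
        (\<lambda>x\<in>Obj C. AM G (a x)) (Cod C f) \<cdot>\<^bsub>E\<^esub> AM (fcomp C G L) f"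
      by simp
  qed auto
qed

text \<open>The compatibility of \<open>\<phi>\<^sub>i\<^sub>j = R\<^sub>i a\<^sub>j\<close> with \<open>\<mu>\<^sub>i\<^sub>j\<^sub>k = R\<^sub>i \<epsilon>\<^sup>j L\<^sub>k\<close>, where \<open>G = R\<^sub>i\<close> and \<open>g\<close> is a component of the
  mate \<open>a\<^sub>k\<close>.  Slide \<open>g\<close> past the counit by naturality, then factor the counit at an object \<open>F z'\<close> by
  \<open>counit_mate\<close>.\<close>

lemma mate_multiplicative:
  assumes G: "cat_functor D E G" and over_G: "fcomp D' G F = G'"
    and g [simp]: "g \<in> Arr D" "Dom D g = z" "Cod D g = OM F z'" and z' [simp]: "z' \<in> Obj D'"
  shows "AM G g \<cdot>\<^bsub>E\<^esub> AM G (eps z) =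
           AM G' (eps' z') \<cdot>\<^bsub>E\<^esub> AM G (a (OM R' z')) \<cdot>\<^bsub>E\<^esub> AM G (AM L (AM R g))"
proof -
  interpret G: cat_functor D E G by fact
  have G' [simp]: "z \<in> Obj D' \<Longrightarrow> OM G' z = OM G (OM F z)"
      "h \<in> Arr D' \<Longrightarrow> AM G' h = AM G (AM F h)" for z h
    using over_G by (metis fcomp_apply)+
  have z [simp]: "z \<in> Obj D"
    using g L.L.D.Dom_in[of g] by auto
  have "g \<cdot>\<^bsub>D\<^esub> eps z = eps (OM F z') \<cdot>\<^bsub>D\<^esub> AM L (AM R g)"
    using L.eps.naturality[OF g] by simp
  also have "\<dots> = (AM F (eps' z') \<cdot>\<^bsub>D\<^esub> a (OM R' z')) \<cdot>\<^bsub>D\<^esub> AM L (AM R g)"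
    by (simp only: counit_mate[OF z'])
  finally have "g \<cdot>\<^bsub>D\<^esub> eps z = AM F (eps' z') \<cdot>\<^bsub>D\<^esub> a (OM R' z') \<cdot>\<^bsub>D\<^esub> AM L (AM R g)"
    by simp
  from arg_cong[OF this, of "AM G"] show ?thesis
    by simp
qed

end

lemma mate_fid:
  assumes "adjunction C D L R eta eps" "x \<in> Obj C"
  shows "mate D eps L (fid D) L eta x = Idt D (OM L x)"
proof -
  interpret adjunction C D L R eta eps by fact
  show ?thesis using assms(2) by (simp add: mate_def triangle_L)
qed

text \<open>Together with \<open>mate_fid\<close> this is the functoriality of \<open>\<Upsilon>\<close>: mates compose as the functors do.\<close>

lemma mate_fcomp:
  assumes "functor_over C D L R eta eps D' L' R' eta' eps' F"
    and "functor_over C D' L' R' eta' eps' D'' L'' R'' eta'' eps'' F'"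
    and x [simp]: "x \<in> Obj C"
  shows "mate D eps L (fcomp D'' F F') L'' eta'' x =
           AM F (mate D' eps' L' F' L'' eta'' x) \<cdot>\<^bsub>D\<^esub> mate D eps L F L' eta' x"
proof -
  interpret F: functor_over C D L R eta eps D' L' R' eta' eps' F by fact
  interpret F': functor_over C D' L' R' eta' eps' D'' L'' R'' eta'' eps'' F' by fact
  let ?z = "OM F' (OM L'' x)"
  have "AM F (AM L' (eta'' x)) \<cdot>\<^bsub>D\<^esub> F.a x = F.a (OM R' ?z) \<cdot>\<^bsub>D\<^esub> AM L (eta'' x)"
    by (rule F.mate_naturality) simp_all
  then have "AM F (F'.a x) \<cdot>\<^bsub>D\<^esub> F.a x =
      AM F (eps' ?z) \<cdot>\<^bsub>D\<^esub> F.a (OM R' ?z) \<cdot>\<^bsub>D\<^esub> AM L (eta'' x)"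
    by (simp add: mate_def[of D'])
  also have "\<dots> = eps (OM F ?z) \<cdot>\<^bsub>D\<^esub> AM L (eta'' x)"
    using F.counit_mate[of ?z]
    by (subst F.L.L.D.Comp_assoc_right[symmetric]) simp_all
  finally show ?thesis
    by (simp add: mate_def[of D])
qed

lemma mateA_eq: "mateA Z Z' F = mate (Zc Z) (epsA Z) (LA Z) F (LA Z') (etaA Z')"
  by (rule ext) (simp add: mateA_def mate_def)

lemma mateB_eq: "mateB Z Z' F = mate (Zc Z) (epsB Z) (LB Z) F (LB Z') (etaB Z')"
  by (rule ext) (simp add: mateB_def mate_def)

lemma dadj_morphism_functor_over:
  assumes "double_adjunction X Y Z" "double_adjunction X Y Z'" "dadj_morphism Z Z' F"
  shows "functor_over X (Zc Z) (LA Z) (RA Z) (etaA Z) (epsA Z)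
           (Zc Z') (LA Z') (RA Z') (etaA Z') (epsA Z') F"
    and "functor_over Y (Zc Z) (LB Z) (RB Z) (etaB Z) (epsB Z)
           (Zc Z') (LB Z') (RB Z') (etaB Z') (epsB Z') F"
  using assms
  by (simp_all add: double_adjunction_def dadj_morphism_def functor_over_def functor_over_axioms_def)

lemma morita_morphism_Upsilon_arr:
  assumes "double_adjunction X Y (asrc F)" "double_adjunction X Y (atgt F)"
    and "dadj_morphism (asrc F) (atgt F) (afun F)"
  shows "morita_morphism X Y (Upsilon_obj X Y (asrc F)) (Upsilon_obj X Y (atgt F))
    (ph1 (Upsilon_arr X Y F)) (ph2 (Upsilon_arr X Y F))
    (ph3 (Upsilon_arr X Y F)) (ph4 (Upsilon_arr X Y F))"
proof -
  let ?Z = "asrc F" and ?Z' = "atgt F"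
  let ?M = "Upsilon_obj X Y ?Z" and ?M' = "Upsilon_obj X Y ?Z'"
  interpret A: functor_over X "Zc ?Z" "LA ?Z" "RA ?Z" "etaA ?Z" "epsA ?Z"
    "Zc ?Z'" "LA ?Z'" "RA ?Z'" "etaA ?Z'" "epsA ?Z'" "afun F"
    by (rule dadj_morphism_functor_over) fact+
  interpret B: functor_over Y "Zc ?Z" "LB ?Z" "RB ?Z" "etaB ?Z" "epsB ?Z"
    "Zc ?Z'" "LB ?Z'" "RB ?Z'" "etaB ?Z'" "epsB ?Z'" "afun F"
    by (rule dadj_morphism_functor_over) fact+
  note RA = A.L.R.cat_functor_axioms A.over
  note RB = B.L.R.cat_functor_axioms B.over
  have phi: "ph1 (Upsilon_arr X Y F) = (\<lambda>x\<in>Obj X. AM (RA ?Z) (A.a x))"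
      "ph2 (Upsilon_arr X Y F) = (\<lambda>y\<in>Obj Y. AM (RB ?Z) (B.a y))"
      "ph3 (Upsilon_arr X Y F) = (\<lambda>y\<in>Obj Y. AM (RA ?Z) (B.a y))"
      "ph4 (Upsilon_arr X Y F) = (\<lambda>x\<in>Obj X. AM (RB ?Z) (A.a x))"
    by (simp_all add: Upsilon_arr_def Let_def mateA_eq mateB_eq)
  have nat: "nat_trans X X (fA ?M) (fA ?M') (ph1 (Upsilon_arr X Y F))"
      "nat_trans Y Y (fB ?M) (fB ?M') (ph2 (Upsilon_arr X Y F))"
      "nat_trans Y X (fT ?M) (fT ?M') (ph3 (Upsilon_arr X Y F))"
      "nat_trans X Y (fTh ?M) (fTh ?M') (ph4 (Upsilon_arr X Y F))"
    unfolding phi Upsilon_obj_def morita.simps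
    by (intro A.nat_trans_mate RA B.nat_trans_mate RB)+
  show ?thesis
    by (rule morita_morphismI[OF morita_context_Upsilon_obj morita_context_Upsilon_obj nat])
      (simp_all add: assms phi Upsilon_obj_def A.mate_unit B.mate_unit
        A.mate_multiplicative[OF RA] A.mate_multiplicative[OF RB]
        B.mate_multiplicative[OF RA] B.mate_multiplicative[OF RB])
qed

lemma Upsilon_arr_simps [simp]:
  "src (Upsilon_arr X Y F) = Upsilon_obj X Y (asrc F)"
  "tgt (Upsilon_arr X Y F) = Upsilon_obj X Y (atgt F)"
  by (simp_all add: Upsilon_arr_def Let_def)

lemma Upsilon_arr_Idt:
  assumes "double_adjunction X Y Z"
  shows "Upsilon_arr X Y (Idt (Adj X Y) Z) = Idt (Mor X Y) (Upsilon_obj X Y Z)"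
proof -
  have A: "adjunction X (Zc Z) (LA Z) (RA Z) (etaA Z) (epsA Z)"
    and B: "adjunction Y (Zc Z) (LB Z) (RB Z) (etaB Z) (epsB Z)"
    using assms by (simp_all add: double_adjunction_def)
  interpret A: adjunction X "Zc Z" "LA Z" "RA Z" "etaA Z" "epsA Z" by fact
  interpret B: adjunction Y "Zc Z" "LB Z" "RB Z" "etaB Z" "epsB Z" by fact
  show ?thesis
    by (auto simp: Upsilon_arr_def Adj_def Mor_def Upsilon_obj_def mateA_eq mateB_eq
        mate_fid[OF A] mate_fid[OF B] intro!: restrict_ext)
qed

lemma Upsilon_arr_Comp:
  assumes "F \<in> Arr (Adj X Y)" "G \<in> Arr (Adj X Y)" "atgt F = asrc G"
  shows "Upsilon_arr X Y (G \<cdot>\<^bsub>Adj X Y\<^esub> F) = Upsilon_arr X Y G \<cdot>\<^bsub>Mor X Y\<^esub> Upsilon_arr X Y F"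
proof -
  let ?Z = "asrc F" and ?Z' = "asrc G" and ?Z'' = "atgt G"
  have FA: "functor_over X (Zc ?Z) (LA ?Z) (RA ?Z) (etaA ?Z) (epsA ?Z)
           (Zc ?Z') (LA ?Z') (RA ?Z') (etaA ?Z') (epsA ?Z') (afun F)"
    and FB: "functor_over Y (Zc ?Z) (LB ?Z) (RB ?Z) (etaB ?Z) (epsB ?Z)
           (Zc ?Z') (LB ?Z') (RB ?Z') (etaB ?Z') (epsB ?Z') (afun F)"
    and GA: "functor_over X (Zc ?Z') (LA ?Z') (RA ?Z') (etaA ?Z') (epsA ?Z')
           (Zc ?Z'') (LA ?Z'') (RA ?Z'') (etaA ?Z'') (epsA ?Z'') (afun G)"
    and GB: "functor_over Y (Zc ?Z') (LB ?Z') (RB ?Z') (etaB ?Z') (epsB ?Z')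
           (Zc ?Z'') (LB ?Z'') (RB ?Z'') (etaB ?Z'') (epsB ?Z'') (afun G)"
    using assms dadj_morphism_functor_over[of X Y] by auto
  interpret FA: functor_over X "Zc ?Z" "LA ?Z" "RA ?Z" "etaA ?Z" "epsA ?Z"
    "Zc ?Z'" "LA ?Z'" "RA ?Z'" "etaA ?Z'" "epsA ?Z'" "afun F" by fact
  interpret FB: functor_over Y "Zc ?Z" "LB ?Z" "RB ?Z" "etaB ?Z" "epsB ?Z"
    "Zc ?Z'" "LB ?Z'" "RB ?Z'" "etaB ?Z'" "epsB ?Z'" "afun F" by fact
  interpret GA: functor_over X "Zc ?Z'" "LA ?Z'" "RA ?Z'" "etaA ?Z'" "epsA ?Z'"
    "Zc ?Z''" "LA ?Z''" "RA ?Z''" "etaA ?Z''" "epsA ?Z''" "afun G" by fact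
  interpret GB: functor_over Y "Zc ?Z'" "LB ?Z'" "RB ?Z'" "etaB ?Z'" "epsB ?Z'"
    "Zc ?Z''" "LB ?Z''" "RB ?Z''" "etaB ?Z''" "epsB ?Z''" "afun G" by fact
  show ?thesis
    using assms(3)
    by (auto simp: Upsilon_arr_def Let_def Adj_def Mor_def mateA_eq mateB_eq
        mate_fcomp[OF FA GA] mate_fcomp[OF FB GB] intro!: restrict_ext)
qed

lemma Upsilon_apply [simp]:
  "double_adjunction X Y Z \<Longrightarrow> OM (Upsilon X Y) Z = Upsilon_obj X Y Z"
  "F \<in> Arr (Adj X Y) \<Longrightarrow> AM (Upsilon X Y) F = Upsilon_arr X Y F"
  by (simp_all add: Upsilon_def)

lemma cat_functor_Upsilon: "cat_functor (Adj X Y) (Mor X Y) (Upsilon X Y)"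
proof -
  interpret Adj: category "Adj X Y" by (rule category_Adj)
  interpret Mor: category "Mor X Y" by (rule category_Mor)
  show ?thesis
  proof (rule cat_functorI)
    show "OM (Upsilon X Y) \<in> extensional (Obj (Adj X Y))"
      "AM (Upsilon X Y) \<in> extensional (Arr (Adj X Y))"
      by (simp_all add: Upsilon_def)
    fix F assume "F \<in> Arr (Adj X Y)"
    then show "AM (Upsilon X Y) F \<in> Arr (Mor X Y) \<and>
        Dom (Mor X Y) (AM (Upsilon X Y) F) = OM (Upsilon X Y) (Dom (Adj X Y) F) \<and>
        Cod (Mor X Y) (AM (Upsilon X Y) F) = OM (Upsilon X Y) (Cod (Adj X Y) F)"
      using morita_morphism_Upsilon_arr[of X Y F]
      by (auto simp: morita_context_Upsilon_obj)
  next
    fix F G assume "F \<in> Arr (Adj X Y)" "G \<in> Arr (Adj X Y)" "Cod (Adj X Y) F = Dom (Adj X Y) G"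
    then show "AM (Upsilon X Y) (G \<cdot>\<^bsub>Adj X Y\<^esub> F) =
        AM (Upsilon X Y) G \<cdot>\<^bsub>Mor X Y\<^esub> AM (Upsilon X Y) F"
      using Upsilon_arr_Comp[of F X Y G] Adj.Comp_typing(1)[of F G] Upsilon_apply(2)[of _ X Y] by simp
  next
    fix Z assume "Z \<in> Obj (Adj X Y)"
    then show "AM (Upsilon X Y) (Idt (Adj X Y) Z) = Idt (Mor X Y) (OM (Upsilon X Y) Z)"
      using Upsilon_arr_Idt[of X Y Z] Adj.Idt_typing(1)[of Z] Upsilon_apply(2)[of _ X Y] by simp
  qed (auto simp: category_Adj category_Mor morita_context_Upsilon_obj)
qed

section \<open>Eilenberg-Moore categories of Morita contexts\<close>

text \<open>An arrow of the Eilenberg-Moore category satisfies four such squares, one for each entry of the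
  matrix.\<close>

lemma equivariant_Comp:
  assumes "cat_functor J I P"
    and sq: "g \<cdot>\<^bsub>I\<^esub> w = w' \<cdot>\<^bsub>I\<^esub> AM P f" and sq': "g' \<cdot>\<^bsub>I\<^esub> w' = w'' \<cdot>\<^bsub>I\<^esub> AM P f'"
    and "f \<in> Arr J" "f' \<in> Arr J" "Cod J f = Dom J f'"
    and "g \<in> Arr I" "g' \<in> Arr I" "Cod I g = Dom I g'"
    and "w \<in> Arr I" "w' \<in> Arr I" "w'' \<in> Arr I"
    and "Cod I w = Dom I g" "Dom I w' = OM P (Cod J f)" "Cod I w' = Cod I g"
      "Dom I w'' = OM P (Cod J f')"
  shows "(g' \<cdot>\<^bsub>I\<^esub> g) \<cdot>\<^bsub>I\<^esub> w = w'' \<cdot>\<^bsub>I\<^esub> AM P (f' \<cdot>\<^bsub>J\<^esub> f)"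
proof -
  interpret P: cat_functor J I P by fact
  note [simp] = assms(4-)
  have "g' \<cdot>\<^bsub>I\<^esub> (w' \<cdot>\<^bsub>I\<^esub> AM P f) = w'' \<cdot>\<^bsub>I\<^esub> (AM P f' \<cdot>\<^bsub>I\<^esub> AM P f)"
    by (rule P.D.Comp_extend[OF sq']) simp_all
  then show ?thesis
    by (simp add: sq)
qed

lemma EM_simps [simp]:
  "Obj (EM X Y M) = {E. is_em_obj X Y M E}" "Arr (EM X Y M) = {h. is_em_arr X Y M h}"
  "Dom (EM X Y M) = esrc" "Cod (EM X Y M) = etgt"
  "Idt (EM X Y M) E = \<lparr>esrc = E, etgt = E, xarr = Idt X (xob E), yarr = Idt Y (yob E)\<rparr>"
  "k \<cdot>\<^bsub>EM X Y M\<^esub> h = \<lparr>esrc = esrc h, etgt = etgt k,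
     xarr = xarr k \<cdot>\<^bsub>X\<^esub> xarr h, yarr = yarr k \<cdot>\<^bsub>Y\<^esub> yarr h\<rparr>"
  by (simp_all add: EM_def)

lemma GA_obj_simps [simp]:
  "xob (GA_obj M x) = OM (fA M) x" "xact (GA_obj M x) = mulA M x"
  "yob (GA_obj M x) = OM (fTh M) x" "yact (GA_obj M x) = lacth M x"
  "vmap (GA_obj M x) = ev M x" "wmap (GA_obj M x) = racth M x"
  by (simp_all add: GA_obj_def)

lemma GB_obj_simps [simp]:
  "xob (GB_obj M y) = OM (fT M) y" "xact (GB_obj M y) = lact M y"
  "yob (GB_obj M y) = OM (fB M) y" "yact (GB_obj M y) = mulB M y"
  "vmap (GB_obj M y) = ract M y" "wmap (GB_obj M y) = evh M y"
  by (simp_all add: GB_obj_def)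

lemma em_eps_simps [simp]:
  "esrc (em_epsA M E) = GA_obj M (xob E)" "etgt (em_epsA M E) = E"
  "xarr (em_epsA M E) = xact E" "yarr (em_epsA M E) = wmap E"
  "esrc (em_epsB M E) = GB_obj M (yob E)" "etgt (em_epsB M E) = E"
  "xarr (em_epsB M E) = vmap E" "yarr (em_epsB M E) = yact E"
  by (simp_all add: em_epsA_def em_epsB_def)

context morita
begin

lemmas T_functor = T.T.cat_functor_axioms
lemmas Th_functor = Th.T.cat_functor_axioms
lemmas A_functor = T.A.A.cat_functor_axioms
lemmas B_functor = T.B.A.cat_functor_axioms

lemma em_obj_typing:
  assumes "is_em_obj X Y M E"
  shows "xob E \<in> Obj X" "yob E \<in> Obj Y"
    "xact E \<in> Arr X" "Dom X (xact E) = OM (fA M) (xob E)" "Cod X (xact E) = xob E"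
    "yact E \<in> Arr Y" "Dom Y (yact E) = OM (fB M) (yob E)" "Cod Y (yact E) = yob E"
    "vmap E \<in> Arr X" "Dom X (vmap E) = OM (fT M) (yob E)" "Cod X (vmap E) = xob E"
    "wmap E \<in> Arr Y" "Dom Y (wmap E) = OM (fTh M) (xob E)" "Cod Y (wmap E) = yob E"
  using assms by (simp_all add: is_em_obj_def monad_algebra_def Let_def)

text \<open>The eight laws of an object read \<open>\<alpha>\<^sub>i\<^sub>j \<circ> M\<^sub>i\<^sub>j \<alpha>\<^sub>j\<^sub>k = \<alpha>\<^sub>i\<^sub>k \<circ> \<mu>\<^sub>i\<^sub>j\<^sub>k\<close>.  They are listed in the same order of
  triples as in \<open>multiplicative\<close>, so that the two lists can be paired.\<close>

lemma em_obj_axioms: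
  assumes "is_em_obj X Y M E"
  shows "xact E \<cdot>\<^bsub>X\<^esub> AM (fA M) (xact E) = xact E \<cdot>\<^bsub>X\<^esub> mulA M (xob E)"
    "yact E \<cdot>\<^bsub>Y\<^esub> AM (fB M) (yact E) = yact E \<cdot>\<^bsub>Y\<^esub> mulB M (yob E)"
    "xact E \<cdot>\<^bsub>X\<^esub> AM (fA M) (vmap E) = vmap E \<cdot>\<^bsub>X\<^esub> lact M (yob E)"
    "yact E \<cdot>\<^bsub>Y\<^esub> AM (fB M) (wmap E) = wmap E \<cdot>\<^bsub>Y\<^esub> lacth M (xob E)"
    "vmap E \<cdot>\<^bsub>X\<^esub> AM (fT M) (yact E) = vmap E \<cdot>\<^bsub>X\<^esub> ract M (yob E)"
    "wmap E \<cdot>\<^bsub>Y\<^esub> AM (fTh M) (xact E) = wmap E \<cdot>\<^bsub>Y\<^esub> racth M (xob E)"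
    "vmap E \<cdot>\<^bsub>X\<^esub> AM (fT M) (wmap E) = xact E \<cdot>\<^bsub>X\<^esub> ev M (xob E)"
    "wmap E \<cdot>\<^bsub>Y\<^esub> AM (fTh M) (vmap E) = yact E \<cdot>\<^bsub>Y\<^esub> evh M (yob E)"
    "xact E \<cdot>\<^bsub>X\<^esub> uniA M (xob E) = Idt X (xob E)"
    "yact E \<cdot>\<^bsub>Y\<^esub> uniB M (yob E) = Idt Y (yob E)"
  using assms by (simp_all add: is_em_obj_def monad_algebra_def Let_def)

lemma is_em_objI:
  assumes "xob E \<in> Obj X" "yob E \<in> Obj Y"
    and "xact E \<in> Hom X (OM (fA M) (xob E)) (xob E)" "yact E \<in> Hom Y (OM (fB M) (yob E)) (yob E)"
    and "vmap E \<in> Hom X (OM (fT M) (yob E)) (xob E)" "wmap E \<in> Hom Y (OM (fTh M) (xob E)) (yob E)"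
    and "xact E \<cdot>\<^bsub>X\<^esub> AM (fA M) (xact E) = xact E \<cdot>\<^bsub>X\<^esub> mulA M (xob E)"
    and "yact E \<cdot>\<^bsub>Y\<^esub> AM (fB M) (yact E) = yact E \<cdot>\<^bsub>Y\<^esub> mulB M (yob E)"
    and "xact E \<cdot>\<^bsub>X\<^esub> AM (fA M) (vmap E) = vmap E \<cdot>\<^bsub>X\<^esub> lact M (yob E)"
    and "yact E \<cdot>\<^bsub>Y\<^esub> AM (fB M) (wmap E) = wmap E \<cdot>\<^bsub>Y\<^esub> lacth M (xob E)"
    and "vmap E \<cdot>\<^bsub>X\<^esub> AM (fT M) (yact E) = vmap E \<cdot>\<^bsub>X\<^esub> ract M (yob E)"
    and "wmap E \<cdot>\<^bsub>Y\<^esub> AM (fTh M) (xact E) = wmap E \<cdot>\<^bsub>Y\<^esub> racth M (xob E)"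
    and "vmap E \<cdot>\<^bsub>X\<^esub> AM (fT M) (wmap E) = xact E \<cdot>\<^bsub>X\<^esub> ev M (xob E)"
    and "wmap E \<cdot>\<^bsub>Y\<^esub> AM (fTh M) (vmap E) = yact E \<cdot>\<^bsub>Y\<^esub> evh M (yob E)"
    and "xact E \<cdot>\<^bsub>X\<^esub> uniA M (xob E) = Idt X (xob E)"
    and "yact E \<cdot>\<^bsub>Y\<^esub> uniB M (yob E) = Idt Y (yob E)"
  shows "is_em_obj X Y M E"
  using assms unfolding is_em_obj_def monad_algebra_def Let_def by simp

lemma em_arr_typing:
  assumes "is_em_arr X Y M h"
  shows "is_em_obj X Y M (esrc h)" "is_em_obj X Y M (etgt h)"
    "xarr h \<in> Arr X" "Dom X (xarr h) = xob (esrc h)" "Cod X (xarr h) = xob (etgt h)"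
    "yarr h \<in> Arr Y" "Dom Y (yarr h) = yob (esrc h)" "Cod Y (yarr h) = yob (etgt h)"
  using assms by (simp_all add: is_em_arr_def algebra_morphism_def Let_def)

lemma em_arr_axioms:
  assumes "is_em_arr X Y M h"
  shows "xarr h \<cdot>\<^bsub>X\<^esub> xact (esrc h) = xact (etgt h) \<cdot>\<^bsub>X\<^esub> AM (fA M) (xarr h)"
    "yarr h \<cdot>\<^bsub>Y\<^esub> yact (esrc h) = yact (etgt h) \<cdot>\<^bsub>Y\<^esub> AM (fB M) (yarr h)"
    "yarr h \<cdot>\<^bsub>Y\<^esub> wmap (esrc h) = wmap (etgt h) \<cdot>\<^bsub>Y\<^esub> AM (fTh M) (xarr h)"
    "xarr h \<cdot>\<^bsub>X\<^esub> vmap (esrc h) = vmap (etgt h) \<cdot>\<^bsub>X\<^esub> AM (fT M) (yarr h)"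
  using assms by (simp_all add: is_em_arr_def algebra_morphism_def Let_def)

\<comment> \<open>Declared only here: while the predicates themselves are being unfolded, these rules would
  send the simplifier into a loop, since their premises would be unfolded as well.\<close>
declare em_obj_typing [simp] em_arr_typing [simp]

lemma is_em_arrI:
  assumes "is_em_obj X Y M (esrc h)" "is_em_obj X Y M (etgt h)"
    and "xarr h \<in> Hom X (xob (esrc h)) (xob (etgt h))" "yarr h \<in> Hom Y (yob (esrc h)) (yob (etgt h))"
    and "xarr h \<cdot>\<^bsub>X\<^esub> xact (esrc h) = xact (etgt h) \<cdot>\<^bsub>X\<^esub> AM (fA M) (xarr h)"
    and "yarr h \<cdot>\<^bsub>Y\<^esub> yact (esrc h) = yact (etgt h) \<cdot>\<^bsub>Y\<^esub> AM (fB M) (yarr h)"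
    and "yarr h \<cdot>\<^bsub>Y\<^esub> wmap (esrc h) = wmap (etgt h) \<cdot>\<^bsub>Y\<^esub> AM (fTh M) (xarr h)"
    and "xarr h \<cdot>\<^bsub>X\<^esub> vmap (esrc h) = vmap (etgt h) \<cdot>\<^bsub>X\<^esub> AM (fT M) (yarr h)"
  shows "is_em_arr X Y M h"
  using assms unfolding is_em_arr_def algebra_morphism_def Let_def by blast

lemma is_em_arr_Comp:
  assumes h: "is_em_arr X Y M h" and k: "is_em_arr X Y M k" and hk: "etgt h = esrc k"
  shows "is_em_arr X Y M (k \<cdot>\<^bsub>EM X Y M\<^esub> h)"
proof -
  note kk = em_arr_axioms[OF k, folded hk]
  have [simp]: "Dom X (xarr k) = xob (etgt h)" "Dom Y (yarr k) = yob (etgt h)"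
    using k hk by simp_all
  show ?thesis
    unfolding EM_simps
    by (rule is_em_arrI; unfold em_arr.simps;
        (intro equivariant_Comp[OF A_functor em_arr_axioms(1)[OF h] kk(1)]
        equivariant_Comp[OF B_functor em_arr_axioms(2)[OF h] kk(2)]
        equivariant_Comp[OF Th_functor em_arr_axioms(3)[OF h] kk(3)]
        equivariant_Comp[OF T_functor em_arr_axioms(4)[OF h] kk(4)])?)
      (use h k hk in simp_all)
qed

lemma category_EM: "category (EM X Y M)"
proof
  fix f a b assume f: "f \<in> Hom (EM X Y M) a b"
  then show "f \<cdot>\<^bsub>EM X Y M\<^esub> Idt (EM X Y M) a = f" "Idt (EM X Y M) b \<cdot>\<^bsub>EM X Y M\<^esub> f = f"
    by (auto intro!: em_arr.equality)
next
  fix E assume E: "E \<in> Obj (EM X Y M)"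
  then have "is_em_arr X Y M (Idt (EM X Y M) E)"
    by (intro is_em_arrI) simp_all
  then show "Idt (EM X Y M) E \<in> Hom (EM X Y M) E E"
    by simp
next
  fix f g a b c assume "f \<in> Hom (EM X Y M) a b" "g \<in> Hom (EM X Y M) b c"
  then show "g \<cdot>\<^bsub>EM X Y M\<^esub> f \<in> Hom (EM X Y M) a c"
    using is_em_arr_Comp[of f g] by simp
next
  fix f g h a b c d
  assume f: "f \<in> Hom (EM X Y M) a b" and g: "g \<in> Hom (EM X Y M) b c" and h: "h \<in> Hom (EM X Y M) c d"
  note fgh [simp] = f[unfolded mem_Hom EM_simps mem_Collect_eq] g[unfolded mem_Hom EM_simps mem_Collect_eq]
     h[unfolded mem_Hom EM_simps mem_Collect_eq]
  show "(h \<cdot>\<^bsub>EM X Y M\<^esub> g) \<cdot>\<^bsub>EM X Y M\<^esub> f = h \<cdot>\<^bsub>EM X Y M\<^esub> (g \<cdot>\<^bsub>EM X Y M\<^esub> f)"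
    by simp
qed simp_all

sublocale EM: category "EM X Y M" by (rule category_EM)

lemma cat_functor_UA: "cat_functor (EM X Y M) X (UA X Y M)"
  and cat_functor_UB: "cat_functor (EM X Y M) Y (UB X Y M)"
  by (rule cat_functorI; use EM.Comp_typing(1) EM.Idt_typing(1) in
      \<open>auto simp: UA_def UB_def category_EM T.A.A.C.category_axioms T.B.A.C.category_axioms\<close>)+

text \<open>A free object is a column of the matrix, acted on by the multiplication: its laws are the
  associativity laws whose last index is \<open>A\<close>.\<close>

lemma is_em_obj_GA: "x \<in> Obj X \<Longrightarrow> is_em_obj X Y M (GA_obj M x)"
  by (simp add: is_em_obj_def monad_algebra_def T.A.assoc T.A.unit_left e_left Th.l_mult
      e_right Th.l_unit Th.r_mult Th.l_r compath balanced)

lemma is_em_obj_GB: "y \<in> Obj Y \<Longrightarrow> is_em_obj X Y M (GB_obj M y)"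
  by (simp add: is_em_obj_def monad_algebra_def T.B.assoc T.B.unit_left eh_left T.l_mult
      eh_right T.l_unit T.r_mult T.l_r compat balancedh)

lemma is_em_arr_GA:
  assumes "f \<in> Arr X"
  shows "is_em_arr X Y M \<lparr>esrc = GA_obj M (Dom X f), etgt = GA_obj M (Cod X f),
     xarr = AM (fA M) f, yarr = AM (fTh M) f\<rparr>"
  using assms T.A.m.naturality[OF assms refl refl] Th.l.naturality[OF assms refl refl]
    Th.r.naturality[OF assms refl refl] e.naturality[OF assms refl refl]
  by (intro is_em_arrI) (simp_all add: is_em_obj_GA)

lemma is_em_arr_GB:
  assumes "f \<in> Arr Y"
  shows "is_em_arr X Y M \<lparr>esrc = GB_obj M (Dom Y f), etgt = GB_obj M (Cod Y f),
     xarr = AM (fT M) f, yarr = AM (fB M) f\<rparr>"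
  using assms T.B.m.naturality[OF assms refl refl] T.l.naturality[OF assms refl refl]
    T.r.naturality[OF assms refl refl] eh.naturality[OF assms refl refl]
  by (intro is_em_arrI) (simp_all add: is_em_obj_GB)

lemma cat_functor_GA: "cat_functor X (EM X Y M) (GA X M)"
  by (rule cat_functorI)
    (auto simp: GA_def category_EM T.A.A.C.category_axioms is_em_obj_GA is_em_arr_GA)

lemma cat_functor_GB: "cat_functor Y (EM X Y M) (GB Y M)"
  by (rule cat_functorI)
    (auto simp: GB_def category_EM T.B.A.C.category_axioms is_em_obj_GB is_em_arr_GB)

lemma U_apply [simp]:
  "is_em_obj X Y M E \<Longrightarrow> OM (UA X Y M) E = xob E" "is_em_obj X Y M E \<Longrightarrow> OM (UB X Y M) E = yob E"
  "is_em_arr X Y M h \<Longrightarrow> AM (UA X Y M) h = xarr h" "is_em_arr X Y M h \<Longrightarrow> AM (UB X Y M) h = yarr h"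
  by (simp_all add: UA_def UB_def)

lemma G_apply [simp]:
  "x \<in> Obj X \<Longrightarrow> OM (GA X M) x = GA_obj M x" "y \<in> Obj Y \<Longrightarrow> OM (GB Y M) y = GB_obj M y"
  "f \<in> Arr X \<Longrightarrow> AM (GA X M) f = \<lparr>esrc = GA_obj M (Dom X f), etgt = GA_obj M (Cod X f),
     xarr = AM (fA M) f, yarr = AM (fTh M) f\<rparr>"
  "g \<in> Arr Y \<Longrightarrow> AM (GB Y M) g = \<lparr>esrc = GB_obj M (Dom Y g), etgt = GB_obj M (Cod Y g),
     xarr = AM (fT M) g, yarr = AM (fB M) g\<rparr>"
  by (simp_all add: GA_def GB_def)

lemma UA_GA: "fcomp X (UA X Y M) (GA X M) = fA M"
  by (rule ftr_eqI[where C = X]) (simp_all add: is_em_obj_GA is_em_obj_GB is_em_arr_GA is_em_arr_GB)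

lemma UB_GB: "fcomp Y (UB X Y M) (GB Y M) = fB M"
  by (rule ftr_eqI[where C = Y]) (simp_all add: is_em_obj_GA is_em_obj_GB is_em_arr_GA is_em_arr_GB)

text \<open>The counit consists of two of the four actions of the object, so the squares that it has to satisfy
  are laws of the object, just as the action of an algebra is a morphism from the free algebra.\<close>

lemma is_em_arr_epsA: "is_em_obj X Y M E \<Longrightarrow> is_em_arr X Y M (em_epsA M E)"
  by (rule is_em_arrI) (simp_all add: is_em_obj_GA em_obj_axioms)

lemma is_em_arr_epsB: "is_em_obj X Y M E \<Longrightarrow> is_em_arr X Y M (em_epsB M E)"
  by (rule is_em_arrI) (simp_all add: is_em_obj_GB em_obj_axioms)

lemma adjunction_GA_UA:
  "adjunction X (EM X Y M) (GA X M) (UA X Y M) (uniA M) (\<lambda>E\<in>Obj (EM X Y M). em_epsA M E)"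
proof -
  have "nat_trans (EM X Y M) (EM X Y M) (fcomp (EM X Y M) (GA X M) (UA X Y M)) (fid (EM X Y M))
      (\<lambda>E\<in>Obj (EM X Y M). em_epsA M E)"
    by (rule nat_transI[OF cat_functor_fcomp[OF cat_functor_UA cat_functor_GA]
          cat_functor_fid[OF category_EM]])
      (auto simp: is_em_arr_epsA em_arr_axioms)
  moreover have "nat_trans X X (fid X) (fcomp X (UA X Y M) (GA X M)) (uniA M)"
    unfolding UA_GA by (rule T.A.u.nat_trans_axioms)
  ultimately show ?thesis
    by (intro adjunction.intro adjunction_axioms.intro cat_functor_GA cat_functor_UA)
      (simp_all add: is_em_obj_GA is_em_arr_epsA
        T.A.unit_right Th.r_unit em_obj_axioms)
qed

lemma adjunction_GB_UB:
  "adjunction Y (EM X Y M) (GB Y M) (UB X Y M) (uniB M) (\<lambda>E\<in>Obj (EM X Y M). em_epsB M E)"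
proof -
  have "nat_trans (EM X Y M) (EM X Y M) (fcomp (EM X Y M) (GB Y M) (UB X Y M)) (fid (EM X Y M))
      (\<lambda>E\<in>Obj (EM X Y M). em_epsB M E)"
    by (rule nat_transI[OF cat_functor_fcomp[OF cat_functor_UB cat_functor_GB]
          cat_functor_fid[OF category_EM]])
      (auto simp: is_em_arr_epsB em_arr_axioms)
  moreover have "nat_trans Y Y (fid Y) (fcomp Y (UB X Y M) (GB Y M)) (uniB M)"
    unfolding UB_GB by (rule T.B.u.nat_trans_axioms)
  ultimately show ?thesis
    by (intro adjunction.intro adjunction_axioms.intro cat_functor_GB cat_functor_UB)
      (simp_all add: is_em_obj_GB is_em_arr_epsB
        T.B.unit_right T.r_unit em_obj_axioms)
qed

end

section \<open>Relabelling a category along injections\<close>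

locale relabelling = category C for C :: "('o, 'm) cat" +
  fixes io :: "'o \<Rightarrow> 'p" and im :: "'m \<Rightarrow> 'n"
  assumes inj_io: "inj io" and inj_im: "inj im"
begin

abbreviation C' where "C' \<equiv> relabel io im C"

lemma relabel_simps [simp]:
  "Obj C' = io ` Obj C" "Arr C' = im ` Arr C"
  "Dom C' (im f) = io (Dom C f)" "Cod C' (im f) = io (Cod C f)"
  "Idt C' (io a) = im (Idt C a)" "im g \<cdot>\<^bsub>C'\<^esub> im f = im (g \<cdot>\<^bsub>C\<^esub> f)"
  using inj_io inj_im by (simp_all add: relabel_def)

lemma eq_iff [simp]: "io a = io b \<longleftrightarrow> a = b" "im f = im g \<longleftrightarrow> f = g"
  using inj_io inj_im by (auto dest: injD)

lemma inv_simps [simp]: "inv io (io a) = a" "inv im (im f) = f"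
  using inj_io inj_im by simp_all

lemma category_relabel: "category C'"
  by unfold_locales auto

sublocale C': category C' by (rule category_relabel)

lemma enc_apply [simp]:
  "a \<in> Obj C \<Longrightarrow> OM (enc io im C) a = io a" "f \<in> Arr C \<Longrightarrow> AM (enc io im C) f = im f"
  by (simp_all add: enc_def)

lemma dec_apply [simp]:
  "a \<in> Obj C \<Longrightarrow> OM (dec io im C) (io a) = a" "f \<in> Arr C \<Longrightarrow> AM (dec io im C) (im f) = f"
  by (simp_all add: dec_def)

lemma cat_functor_enc: "cat_functor C C' (enc io im C)"
  by (rule cat_functorI[OF category_axioms category_relabel]) (auto, simp_all add: enc_def)

lemma cat_functor_dec: "cat_functor C' C (dec io im C)"
  by (rule cat_functorI[OF category_relabel category_axioms]) (auto, simp_all add: dec_def)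

text \<open>The functors \<open>enc\<close> and \<open>dec\<close> are mutually inverse, so they transport an adjunction without changing its
  unit.\<close>

lemma adjunction_relabel:
  assumes "adjunction B C L R eta eps"
  shows "adjunction B C' (fcomp B (enc io im C) L) (fcomp C' R (dec io im C)) eta
           (\<lambda>z\<in>Obj C'. im (eps (inv io z)))"
proof -
  interpret adjunction B C L R eta eps by fact
  have L: "cat_functor B C' (fcomp B (enc io im C) L)"
    by (rule cat_functor_fcomp[OF L.cat_functor_axioms cat_functor_enc])
  have R: "cat_functor C' B (fcomp C' R (dec io im C))"
    by (rule cat_functor_fcomp[OF cat_functor_dec R.cat_functor_axioms])
  have RL: "fcomp B (fcomp C' R (dec io im C)) (fcomp B (enc io im C) L) = fcomp B R L"
    by (rule ftr_eqI[where C = B]) simp_all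
  have "nat_trans B B (fid B) (fcomp B (fcomp C' R (dec io im C)) (fcomp B (enc io im C) L)) eta"
    unfolding RL by (rule eta.nat_trans_axioms)
  moreover have "nat_trans C' C' (fcomp C' (fcomp B (enc io im C) L) (fcomp C' R (dec io im C)))
      (fid C') (\<lambda>z\<in>Obj C'. im (eps (inv io z)))"
    by (rule nat_transI[OF cat_functor_fcomp[OF R L] cat_functor_fid[OF category_relabel]])
      (use eps.naturality[OF _ refl refl] in auto)
  ultimately show ?thesis
    by (intro adjunction.intro adjunction_axioms.intro L R) (auto simp: triangle_L triangle_R)
qed

end

section \<open>Restriction along a morphism of Morita contexts\<close>

text \<open>The law \<open>\<alpha>\<^sub>i\<^sub>j \<circ> M\<^sub>i\<^sub>j \<alpha>\<^sub>j\<^sub>k = \<alpha>\<^sub>i\<^sub>k \<circ> \<mu>\<^sub>i\<^sub>j\<^sub>k\<close> survives when every action \<open>\<alpha>\<^sub>i\<^sub>j\<close> is precomposed with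
  \<open>\<phi>\<^sub>i\<^sub>j\<close>; here \<open>s\<close>, \<open>t\<close>, \<open>w\<close> stand for \<open>\<phi>\<^sub>i\<^sub>j\<close>, \<open>\<phi>\<^sub>j\<^sub>k\<close>, \<open>\<phi>\<^sub>i\<^sub>k\<close>.  Naturality of \<open>s\<close> brings \<open>\<alpha>\<close> next to
  \<open>P' \<beta>\<close>, where the law for the target context applies.\<close>

lemma restrict_action:
  assumes "nat_trans J I P P' s"
    and sq: "w \<cdot>\<^bsub>I\<^esub> \<mu> = \<mu>' \<cdot>\<^bsub>I\<^esub> s q' \<cdot>\<^bsub>I\<^esub> AM P t"
    and act: "\<alpha> \<cdot>\<^bsub>I\<^esub> AM P' \<beta> = \<gamma> \<cdot>\<^bsub>I\<^esub> \<mu>'"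
    and "t \<in> Arr J" "\<beta> \<in> Arr J" "Cod J t = q'" "Dom J \<beta> = q'" "Cod J \<beta> = q"
    and "\<mu> \<in> Arr I" "\<mu>' \<in> Arr I" "w \<in> Arr I" "\<alpha> \<in> Arr I" "\<gamma> \<in> Arr I"
    and "Dom I \<mu> = OM P (Dom J t)" "Dom I \<mu>' = OM P' q'" "Dom I \<alpha> = OM P' q"
    and "Cod I \<mu> = Dom I w" "Cod I \<mu>' = Cod I w" "Dom I \<gamma> = Cod I w" "Cod I \<gamma> = Cod I \<alpha>"
  shows "(\<alpha> \<cdot>\<^bsub>I\<^esub> s q) \<cdot>\<^bsub>I\<^esub> AM P (\<beta> \<cdot>\<^bsub>J\<^esub> t) = (\<gamma> \<cdot>\<^bsub>I\<^esub> w) \<cdot>\<^bsub>I\<^esub> \<mu>"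
proof -
  interpret s: nat_trans J I P P' s by fact
  note [simp] = assms(4-)
  have [simp]: "q' \<in> Obj J" "q \<in> Obj J"
    using s.F.C.Cod_in[of t] s.F.C.Cod_in[of \<beta>] by simp_all
  have "s q \<cdot>\<^bsub>I\<^esub> AM P \<beta> \<cdot>\<^bsub>I\<^esub> AM P t = AM P' \<beta> \<cdot>\<^bsub>I\<^esub> s q' \<cdot>\<^bsub>I\<^esub> AM P t"
    by (rule s.F.D.Comp_extend[OF s.naturality[symmetric]]) simp_all
  moreover have "\<alpha> \<cdot>\<^bsub>I\<^esub> AM P' \<beta> \<cdot>\<^bsub>I\<^esub> s q' \<cdot>\<^bsub>I\<^esub> AM P t = \<gamma> \<cdot>\<^bsub>I\<^esub> \<mu>' \<cdot>\<^bsub>I\<^esub> s q' \<cdot>\<^bsub>I\<^esub> AM P t"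
    by (rule s.F.D.Comp_extend[OF act]) simp_all
  ultimately show ?thesis
    by (simp add: sq)
qed

lemma restrict_equivariant:
  assumes "nat_trans J I P P' s"
    and act: "g \<cdot>\<^bsub>I\<^esub> \<alpha> = \<beta> \<cdot>\<^bsub>I\<^esub> AM P' f"
    and "f \<in> Arr J" "Dom J f = q" "Cod J f = q'"
    and "\<alpha> \<in> Arr I" "\<beta> \<in> Arr I" "g \<in> Arr I"
    and "Dom I \<alpha> = OM P' q" "Dom I \<beta> = OM P' q'" "Cod I \<alpha> = Dom I g" "Cod I \<beta> = Cod I g"
  shows "g \<cdot>\<^bsub>I\<^esub> (\<alpha> \<cdot>\<^bsub>I\<^esub> s q) = (\<beta> \<cdot>\<^bsub>I\<^esub> s q') \<cdot>\<^bsub>I\<^esub> AM P f"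
proof -
  interpret s: nat_trans J I P P' s by fact
  note [simp] = assms(3-)
  have [simp]: "q' \<in> Obj J" "q \<in> Obj J"
    using s.F.C.Cod_in[of f] s.F.C.Dom_in[of f] by simp_all
  have "g \<cdot>\<^bsub>I\<^esub> (\<alpha> \<cdot>\<^bsub>I\<^esub> s q) = \<beta> \<cdot>\<^bsub>I\<^esub> (AM P' f \<cdot>\<^bsub>I\<^esub> s q)"
    by (rule s.F.D.Comp_extend[OF act]) simp_all
  then show ?thesis
    by (simp add: s.naturality)
qed

text \<open>Restricting a free object along \<open>\<phi>\<close> and composing with the unit gives back the component of
  \<open>\<phi>\<close>.  This is how \<open>\<Upsilon>\<close> recovers \<open>\<phi>\<close> from the restriction functor.\<close>

lemma restrict_unit:
  assumes "nat_trans J I P P' s" "\<alpha> \<cdot>\<^bsub>I\<^esub> AM P' u = Idt I (OM P' q)"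
    and "u \<in> Arr J" "Dom J u = q" "Cod J u = q'"
    and "\<alpha> \<in> Arr I" "Dom I \<alpha> = OM P' q'"
  shows "\<alpha> \<cdot>\<^bsub>I\<^esub> s q' \<cdot>\<^bsub>I\<^esub> AM P u = s q"
proof -
  interpret s: nat_trans J I P P' s by fact
  note [simp] = assms(3-)
  have [simp]: "q' \<in> Obj J" "q \<in> Obj J"
    using s.F.C.Cod_in[of u] s.F.C.Dom_in[of u] by simp_all
  have "\<alpha> \<cdot>\<^bsub>I\<^esub> s q' \<cdot>\<^bsub>I\<^esub> AM P u = \<alpha> \<cdot>\<^bsub>I\<^esub> AM P' u \<cdot>\<^bsub>I\<^esub> s q"
    by (simp add: s.naturality)
  also have "\<dots> = (\<alpha> \<cdot>\<^bsub>I\<^esub> AM P' u) \<cdot>\<^bsub>I\<^esub> s q"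
    by simp
  finally show ?thesis
    by (simp only: assms(2)) simp
qed

lemma em_restrict_obj_simps [simp]:
  "xob (em_restrict_obj X Y p E) = xob E" "yob (em_restrict_obj X Y p E) = yob E"
  "xact (em_restrict_obj X Y p E) = xact E \<cdot>\<^bsub>X\<^esub> ph1 p (xob E)"
  "yact (em_restrict_obj X Y p E) = yact E \<cdot>\<^bsub>Y\<^esub> ph2 p (yob E)"
  "vmap (em_restrict_obj X Y p E) = vmap E \<cdot>\<^bsub>X\<^esub> ph3 p (yob E)"
  "wmap (em_restrict_obj X Y p E) = wmap E \<cdot>\<^bsub>Y\<^esub> ph4 p (xob E)"
  by (simp_all add: em_restrict_obj_def)

text \<open>Source and target are parameters of their own, so that identities and composites can be
  interpreted with the contexts that are already known to be their ends.\<close>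

locale morita_arrow =
  M: morita X Y M + M': morita X Y M' + morita_morphism X Y M M' "ph1 p" "ph2 p" "ph3 p" "ph4 p"
  for X :: "('xo, 'xm) cat" and Y :: "('yo, 'ym) cat" and M M' and p :: "('xo, 'xm, 'yo, 'ym) morita_arr" +
  assumes src [simp]: "src p = M" and tgt [simp]: "tgt p = M'"
begin

lemma is_em_obj_restrict:
  assumes E [simp]: "is_em_obj X Y M' E"
  shows "is_em_obj X Y M (em_restrict_obj X Y p E)"
proof -
  note [simp] = M'.em_obj_typing[OF E]
  show ?thesis
    by (rule M.is_em_objI; unfold em_restrict_obj_simps;
        (rule restrict_action[OF p1.nat_trans_axioms multiplicative(1) M'.em_obj_axioms(1)[OF E]]
          restrict_action[OF p2.nat_trans_axioms multiplicative(2) M'.em_obj_axioms(2)[OF E]]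
          restrict_action[OF p1.nat_trans_axioms multiplicative(3) M'.em_obj_axioms(3)[OF E]]
          restrict_action[OF p2.nat_trans_axioms multiplicative(4) M'.em_obj_axioms(4)[OF E]]
          restrict_action[OF p3.nat_trans_axioms multiplicative(5) M'.em_obj_axioms(5)[OF E]]
          restrict_action[OF p4.nat_trans_axioms multiplicative(6) M'.em_obj_axioms(6)[OF E]]
          restrict_action[OF p3.nat_trans_axioms multiplicative(7) M'.em_obj_axioms(7)[OF E]]
          restrict_action[OF p4.nat_trans_axioms multiplicative(8) M'.em_obj_axioms(8)[OF E]])?)
      (simp_all add: p1.unit p2.unit M'.em_obj_axioms(9,10))
qed

lemma is_em_arr_restrict:
  assumes h [simp]: "is_em_arr X Y M' h"
  shows "is_em_arr X Y M \<lparr>esrc = em_restrict_obj X Y p (esrc h),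
     etgt = em_restrict_obj X Y p (etgt h), xarr = xarr h, yarr = yarr h\<rparr>"
  by (rule M.is_em_arrI; unfold em_arr.simps em_restrict_obj_simps;
      (rule restrict_equivariant[OF p1.nat_trans_axioms M'.em_arr_axioms(1)[OF h]]
        restrict_equivariant[OF p2.nat_trans_axioms M'.em_arr_axioms(2)[OF h]]
        restrict_equivariant[OF p4.nat_trans_axioms M'.em_arr_axioms(3)[OF h]]
        restrict_equivariant[OF p3.nat_trans_axioms M'.em_arr_axioms(4)[OF h]])?)
    (simp_all add: is_em_obj_restrict)

lemma em_restrict_apply [simp]:
  "is_em_obj X Y M' E \<Longrightarrow> OM (em_restrict X Y p) E = em_restrict_obj X Y p E"
  "is_em_arr X Y M' h \<Longrightarrow> AM (em_restrict X Y p) h =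
     \<lparr>esrc = em_restrict_obj X Y p (esrc h), etgt = em_restrict_obj X Y p (etgt h),
      xarr = xarr h, yarr = yarr h\<rparr>"
  by (simp_all add: em_restrict_def)

lemma cat_functor_em_restrict: "cat_functor (EM X Y M') (EM X Y M) (em_restrict X Y p)"
proof (rule cat_functorI[OF M'.category_EM M.category_EM])
  show "OM (em_restrict X Y p) \<in> extensional (Obj (EM X Y M'))"
    "AM (em_restrict X Y p) \<in> extensional (Arr (EM X Y M'))"
    by (simp_all add: em_restrict_def)
  fix E assume "E \<in> Obj (EM X Y M')"
  then show "AM (em_restrict X Y p) (Idt (EM X Y M') E) = Idt (EM X Y M) (OM (em_restrict X Y p) E)"
    using M'.EM.Idt_typing(1)[of E] by simp
next
  fix f g
  assume fg: "f \<in> Arr (EM X Y M')" "g \<in> Arr (EM X Y M')" "Cod (EM X Y M') f = Dom (EM X Y M') g"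
  then show "AM (em_restrict X Y p) (g \<cdot>\<^bsub>EM X Y M'\<^esub> f) =
      AM (em_restrict X Y p) g \<cdot>\<^bsub>EM X Y M\<^esub> AM (em_restrict X Y p) f"
    using M'.EM.Comp_typing(1)[OF fg] by simp
qed (simp_all add: is_em_obj_restrict is_em_arr_restrict)

end

section \<open>Double adjunctions from Morita contexts\<close>

locale relabelled_EM = morita X Y M + relabelling "EM X Y M" io im
  for X :: "('xo, 'xm) cat" and Y :: "('yo, 'ym) cat" and M
    and io :: "('xo, 'xm, 'yo, 'ym) em_obj \<Rightarrow> 'zo" and im :: "('xo, 'xm, 'yo, 'ym) em_arr \<Rightarrow> 'zm"
begin

abbreviation G where "G \<equiv> Gamma_obj io im X Y M"

lemma Zc_Gamma_obj [simp]: "Zc G = relabel io im (EM X Y M)"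
  by (simp add: Gamma_obj_def Let_def)

lemma Gamma_obj_eta [simp]: "etaA G = uniA M" "etaB G = uniB M"
  by (simp_all add: Gamma_obj_def Let_def)

lemma Gamma_obj_apply [simp]:
  "x \<in> Obj X \<Longrightarrow> OM (LA G) x = io (GA_obj M x)"
  "y \<in> Obj Y \<Longrightarrow> OM (LB G) y = io (GB_obj M y)"
  "f \<in> Arr X \<Longrightarrow> AM (LA G) f = im (AM (GA X M) f)"
  "g \<in> Arr Y \<Longrightarrow> AM (LB G) g = im (AM (GB Y M) g)"
  "is_em_obj X Y M E \<Longrightarrow> OM (RA G) (io E) = xob E"
  "is_em_obj X Y M E \<Longrightarrow> OM (RB G) (io E) = yob E"
  "is_em_arr X Y M h \<Longrightarrow> AM (RA G) (im h) = xarr h"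
  "is_em_arr X Y M h \<Longrightarrow> AM (RB G) (im h) = yarr h"
  "is_em_obj X Y M E \<Longrightarrow> epsA G (io E) = im (em_epsA M E)"
  "is_em_obj X Y M E \<Longrightarrow> epsB G (io E) = im (em_epsB M E)"
  by (simp_all add: Gamma_obj_def Let_def is_em_obj_GA is_em_obj_GB is_em_arr_GA is_em_arr_GB)

lemma double_adjunction_Gamma_obj: "double_adjunction X Y G"
proof -
  have "(\<lambda>z\<in>Obj C'. im ((\<lambda>E\<in>Obj (EM X Y M). em_epsA M E) (inv io z))) =
      (\<lambda>z\<in>Obj C'. im (em_epsA M (inv io z)))"
    "(\<lambda>z\<in>Obj C'. im ((\<lambda>E\<in>Obj (EM X Y M). em_epsB M E) (inv io z))) =
      (\<lambda>z\<in>Obj C'. im (em_epsB M (inv io z)))"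
    by (auto intro!: restrict_ext)
  then show ?thesis
    using adjunction_relabel[OF adjunction_GA_UA] adjunction_relabel[OF adjunction_GB_UB]
    by (simp only: double_adjunction_def Gamma_obj_def Let_def dadj.simps)
qed

text \<open>This is an equality and not merely an isomorphism because \<open>U\<^sub>i G\<^sub>j = M\<^sub>i\<^sub>j\<close> holds strictly and functors and
  natural transformations are extensional.\<close>

lemma Upsilon_Gamma_obj: "Upsilon_obj X Y G = M"
proof -
  have "fcomp X (RA G) (LA G) = fA M" "fcomp X (RB G) (LA G) = fTh M"
    by (rule ftr_eqI[where C = X]; simp add: is_em_obj_GA is_em_arr_GA)+
  moreover have "fcomp Y (RA G) (LB G) = fT M" "fcomp Y (RB G) (LB G) = fB M"
    by (rule ftr_eqI[where C = Y]; simp add: is_em_obj_GB is_em_arr_GB)+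
  moreover have
    "(\<lambda>x\<in>Obj X. AM (RA G) (epsA G (OM (LA G) x))) = mulA M"
    "(\<lambda>x\<in>Obj X. AM (RB G) (epsB G (OM (LA G) x))) = lacth M"
    "(\<lambda>x\<in>Obj X. AM (RB G) (epsA G (OM (LA G) x))) = racth M"
    "(\<lambda>x\<in>Obj X. AM (RA G) (epsB G (OM (LA G) x))) = ev M"
    by (rule extensionalityI[where A = "Obj X"];
        simp add: is_em_obj_GA is_em_arr_epsA is_em_arr_epsB T.A.m.ext Th.l.ext Th.r.ext e.ext)+
  moreover have
    "(\<lambda>y\<in>Obj Y. AM (RB G) (epsB G (OM (LB G) y))) = mulB M"
    "(\<lambda>y\<in>Obj Y. AM (RA G) (epsA G (OM (LB G) y))) = lact M"
    "(\<lambda>y\<in>Obj Y. AM (RA G) (epsB G (OM (LB G) y))) = ract M"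
    "(\<lambda>y\<in>Obj Y. AM (RB G) (epsA G (OM (LB G) y))) = evh M"
    by (rule extensionalityI[where A = "Obj Y"];
        simp add: is_em_obj_GB is_em_arr_epsA is_em_arr_epsB T.B.m.ext T.l.ext T.r.ext eh.ext)+
  ultimately show ?thesis
    by (intro morita.equality) (simp_all add: Upsilon_obj_def)
qed

end

lemma relabelled_EM_I:
  "morita_context X Y M \<Longrightarrow> inj io \<Longrightarrow> inj im \<Longrightarrow> relabelled_EM X Y M io im"
  by (simp add: relabelled_EM_def relabelling_def relabelling_axioms_def morita_context_iff
      morita.category_EM)

locale relabelled_arrow =
  M: relabelled_EM X Y M io im + M': relabelled_EM X Y M' io im + morita_arrow X Y M M' p
  for X :: "('xo, 'xm) cat" and Y :: "('yo, 'ym) cat" and M M' and p :: "('xo, 'xm, 'yo, 'ym) morita_arr"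
    and io :: "('xo, 'xm, 'yo, 'ym) em_obj \<Rightarrow> 'zo" and im :: "('xo, 'xm, 'yo, 'ym) em_arr \<Rightarrow> 'zm"
begin

abbreviation F where "F \<equiv> afun (Gamma_arr io im X Y p)"

lemma cat_functor_Gamma_arr: "cat_functor M'.C' M.C' F"
  unfolding Gamma_arr_def Let_def dadj_arr.simps src tgt
  by (rule cat_functor_fcomp[OF cat_functor_fcomp[OF M'.cat_functor_dec cat_functor_em_restrict]
        M.cat_functor_enc])

sublocale F: cat_functor M'.C' M.C' F
  by (rule cat_functor_Gamma_arr)

lemma Gamma_arr_apply [simp]:
  "is_em_obj X Y M' E \<Longrightarrow> OM F (io E) = io (em_restrict_obj X Y p E)"
  "is_em_arr X Y M' h \<Longrightarrow> AM F (im h) = im \<lparr>esrc = em_restrict_obj X Y p (esrc h),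
      etgt = em_restrict_obj X Y p (etgt h), xarr = xarr h, yarr = yarr h\<rparr>"
  by (simp_all add: Gamma_arr_def Let_def is_em_obj_restrict is_em_arr_restrict)

lemma dadj_morphism_Gamma_arr: "dadj_morphism M.G M'.G F"
proof -
  interpret R: two_adjunctions X Y M'.C' "LA M'.G" "RA M'.G" "etaA M'.G" "epsA M'.G"
    "LB M'.G" "RB M'.G" "etaB M'.G" "epsB M'.G"
    using M'.double_adjunction_Gamma_obj by (simp add: double_adjunction_iff)
  have "fcomp M'.C' (RA M.G) F = RA M'.G" "fcomp M'.C' (RB M.G) F = RB M'.G"
    by (rule ftr_eqI[where C = M'.C'];
        (rule fcomp_ext R.A.R.functor_ext R.B.R.functor_ext)?;
        auto simp: is_em_obj_restrict is_em_arr_restrict)+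
  then show ?thesis
    by (simp add: dadj_morphism_def cat_functor_Gamma_arr)
qed

text \<open>The mate is the unit of the target context followed by the action of the restricted free object,
  so \<open>restrict_unit\<close> applies to both of its components.\<close>

lemma mateA_Gamma_arr:
  assumes x [simp]: "x \<in> Obj X"
  shows "AM (RA M.G) (mateA M.G M'.G F x) = ph1 p x" "AM (RB M.G) (mateA M.G M'.G F x) = ph4 p x"
proof -
  let ?h = "em_epsA M (em_restrict_obj X Y p (GA_obj M' x)) \<cdot>\<^bsub>EM X Y M\<^esub> AM (GA X M) (uniA M' x)"
  note arr = M.is_em_arr_epsA M'.is_em_obj_GA is_em_obj_restrict
  have "mateA M.G M'.G F x = im ?h"
    using M.is_em_arr_GA[of "uniA M' x"] by (simp add: mateA_def arr)
  moreover have "is_em_arr X Y M ?h"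
    by (rule M.is_em_arr_Comp) (use M.is_em_arr_GA[of "uniA M' x"] in \<open>simp_all add: arr\<close>)
  ultimately have "AM (RA M.G) (mateA M.G M'.G F x) = xarr ?h"
      "AM (RB M.G) (mateA M.G M'.G F x) = yarr ?h"
    by (simp_all only: M.Gamma_obj_apply)
  then show "AM (RA M.G) (mateA M.G M'.G F x) = ph1 p x" "AM (RB M.G) (mateA M.G M'.G F x) = ph4 p x"
    using restrict_unit[OF p1.nat_trans_axioms M'.T.A.unit_right[OF x]]
      restrict_unit[OF p4.nat_trans_axioms M'.Th.r_unit[OF x]] by simp_all
qed

lemma mateB_Gamma_arr:
  assumes y [simp]: "y \<in> Obj Y"
  shows "AM (RA M.G) (mateB M.G M'.G F y) = ph3 p y" "AM (RB M.G) (mateB M.G M'.G F y) = ph2 p y"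
proof -
  let ?h = "em_epsB M (em_restrict_obj X Y p (GB_obj M' y)) \<cdot>\<^bsub>EM X Y M\<^esub> AM (GB Y M) (uniB M' y)"
  note arr = M.is_em_arr_epsB M'.is_em_obj_GB is_em_obj_restrict
  have "mateB M.G M'.G F y = im ?h"
    using M.is_em_arr_GB[of "uniB M' y"] by (simp add: mateB_def arr)
  moreover have "is_em_arr X Y M ?h"
    by (rule M.is_em_arr_Comp) (use M.is_em_arr_GB[of "uniB M' y"] in \<open>simp_all add: arr\<close>)
  ultimately have "AM (RA M.G) (mateB M.G M'.G F y) = xarr ?h"
      "AM (RB M.G) (mateB M.G M'.G F y) = yarr ?h"
    by (simp_all only: M.Gamma_obj_apply)
  then show "AM (RA M.G) (mateB M.G M'.G F y) = ph3 p y" "AM (RB M.G) (mateB M.G M'.G F y) = ph2 p y"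
    using restrict_unit[OF p3.nat_trans_axioms M'.T.r_unit[OF y]]
      restrict_unit[OF p2.nat_trans_axioms M'.T.B.unit_right[OF y]] by simp_all
qed

lemma Gamma_arr_simps [simp]:
  "asrc (Gamma_arr io im X Y p) = M.G" "atgt (Gamma_arr io im X Y p) = M'.G"
  by (simp_all add: Gamma_arr_def Let_def)

lemma Upsilon_Gamma_arr: "Upsilon_arr X Y (Gamma_arr io im X Y p) = p"
proof -
  have "(\<lambda>x\<in>Obj X. AM (RA M.G) (mateA M.G M'.G F x)) = ph1 p"
      "(\<lambda>x\<in>Obj X. AM (RB M.G) (mateA M.G M'.G F x)) = ph4 p"
    by (rule extensionalityI[of _ "Obj X"]; simp add: mateA_Gamma_arr p1.ext p4.ext)+
  moreover have "(\<lambda>y\<in>Obj Y. AM (RA M.G) (mateB M.G M'.G F y)) = ph3 p"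
      "(\<lambda>y\<in>Obj Y. AM (RB M.G) (mateB M.G M'.G F y)) = ph2 p"
    by (rule extensionalityI[of _ "Obj Y"]; simp add: mateB_Gamma_arr p2.ext p3.ext)+
  ultimately show ?thesis
    by (simp add: Upsilon_arr_def Let_def M.Upsilon_Gamma_obj M'.Upsilon_Gamma_obj)
qed

end

lemma relabelled_arrow_I:
  assumes "p \<in> Hom (Mor X Y) M M'" "inj io" "inj im"
  shows "relabelled_arrow X Y M M' p io im"
  using assms
  by (auto simp: relabelled_arrow_def morita_arrow_def morita_arrow_axioms_def relabelled_EM_I
      morita_context_iff)

lemma Gamma_apply [simp]:
  "morita_context X Y M \<Longrightarrow> OM (Gamma io im X Y) M = Gamma_obj io im X Y M"
  "p \<in> Arr (Mor X Y) \<Longrightarrow> AM (Gamma io im X Y) p = Gamma_arr io im X Y p"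
  by (simp_all add: Gamma_def)

lemma Gamma_arr_in_Hom:
  assumes "p \<in> Hom (Mor X Y) M M'" "inj io" "inj im"
  shows "Gamma_arr io im X Y p \<in> Hom (Adj X Y) (Gamma_obj io im X Y M) (Gamma_obj io im X Y M')"
proof -
  interpret relabelled_arrow X Y M M' p io im
    using assms by (rule relabelled_arrow_I)
  show ?thesis
    using dadj_morphism_Gamma_arr M.double_adjunction_Gamma_obj M'.double_adjunction_Gamma_obj
    by simp
qed

lemma Gamma_arr_Idt:
  assumes M: "morita_context X Y M" and inj: "inj io" "inj im"
  shows "Gamma_arr io im X Y (Idt (Mor X Y) M) = Idt (Adj X Y) (Gamma_obj io im X Y M)"
proof -
  interpret Mor: category "Mor X Y" by (rule category_Mor)
  let ?i = "Idt (Mor X Y) M"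
  interpret relabelled_arrow X Y M M ?i io im
    by (rule relabelled_arrow_I[OF Mor.Idt_in inj]) (use M in simp)
  have restrict: "em_restrict_obj X Y ?i E = E" if "is_em_obj X Y M E" for E
    using that M.em_obj_typing[OF that] by (intro em_obj.equality) (simp_all add: Mor_def)
  have "F = fid M.C'"
    by (rule ftr_eqI[where C = M.C'];
        (rule F.functor_ext fid_ext)?; auto simp: restrict)
  then show ?thesis
    by (intro dadj_arr.equality) (simp_all add: Adj_def)
qed

lemma Gamma_arr_Comp:
  assumes p: "p \<in> Hom (Mor X Y) M M'" and q: "q \<in> Hom (Mor X Y) M' M''"
    and inj: "inj io" "inj im"
  shows "Gamma_arr io im X Y (q \<cdot>\<^bsub>Mor X Y\<^esub> p) = Gamma_arr io im X Y q \<cdot>\<^bsub>Adj X Y\<^esub> Gamma_arr io im X Y p"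
proof -
  interpret Mor: category "Mor X Y" by (rule category_Mor)
  let ?r = "q \<cdot>\<^bsub>Mor X Y\<^esub> p"
  interpret p: relabelled_arrow X Y M M' p io im
    by (rule relabelled_arrow_I[OF p inj])
  interpret q: relabelled_arrow X Y M' M'' q io im
    by (rule relabelled_arrow_I[OF q inj])
  interpret r: relabelled_arrow X Y M M'' ?r io im
    by (rule relabelled_arrow_I[OF Mor.Comp_in[OF p q] inj])
  have restrict: "em_restrict_obj X Y ?r E = em_restrict_obj X Y p (em_restrict_obj X Y q E)"
    if "is_em_obj X Y M'' E" for E
    using that q.M'.em_obj_typing[OF that] by (intro em_obj.equality) (simp_all add: Mor_def)
  have "r.F = fcomp q.M'.C' p.F q.F"
    by (rule ftr_eqI[where C = q.M'.C'];
        (rule r.F.functor_ext fcomp_ext)?;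
        auto simp: restrict q.is_em_obj_restrict q.is_em_arr_restrict)
  then show ?thesis
    by (intro dadj_arr.equality) (simp_all add: Adj_def)
qed

lemma cat_functor_Gamma:
  assumes inj: "inj io" "inj im"
  shows "cat_functor (Mor X Y) (Adj X Y) (Gamma io im X Y)"
proof -
  interpret Mor: category "Mor X Y" by (rule category_Mor)
  show ?thesis
  proof (rule cat_functorI[OF category_Mor category_Adj])
    show "OM (Gamma io im X Y) \<in> extensional (Obj (Mor X Y))"
      "AM (Gamma io im X Y) \<in> extensional (Arr (Mor X Y))"
      by (simp_all add: Gamma_def)
    fix M assume M: "M \<in> Obj (Mor X Y)"
    then interpret relabelled_EM X Y M io im using inj by (simp add: relabelled_EM_I)
    show "OM (Gamma io im X Y) M \<in> Obj (Adj X Y)"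
      using M double_adjunction_Gamma_obj by simp
    show "AM (Gamma io im X Y) (Idt (Mor X Y) M) = Idt (Adj X Y) (OM (Gamma io im X Y) M)"
      using M Mor.Idt_typing(1)[OF M] Gamma_arr_Idt[OF _ inj] Gamma_apply by simp
  next
    fix p assume p: "p \<in> Arr (Mor X Y)"
    then have "p \<in> Hom (Mor X Y) (src p) (tgt p)" by simp
    from Gamma_arr_in_Hom[OF this inj] p
    show "AM (Gamma io im X Y) p \<in> Arr (Adj X Y) \<and>
        Dom (Adj X Y) (AM (Gamma io im X Y) p) = OM (Gamma io im X Y) (Dom (Mor X Y) p) \<and>
        Cod (Adj X Y) (AM (Gamma io im X Y) p) = OM (Gamma io im X Y) (Cod (Mor X Y) p)"
      by auto
  next
    fix p q assume pq: "p \<in> Arr (Mor X Y)" "q \<in> Arr (Mor X Y)" "Cod (Mor X Y) p = Dom (Mor X Y) q"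
    then have "p \<in> Hom (Mor X Y) (src p) (src q)" "q \<in> Hom (Mor X Y) (src q) (tgt q)" by simp_all
    from Gamma_arr_Comp[OF this inj]
    show "AM (Gamma io im X Y) (q \<cdot>\<^bsub>Mor X Y\<^esub> p) =
        AM (Gamma io im X Y) q \<cdot>\<^bsub>Adj X Y\<^esub> AM (Gamma io im X Y) p"
      using pq Mor.Comp_typing(1)[OF pq] by simp
  qed
qed

section \<open>The comparison functor\<close>

text \<open>The Eilenberg-Moore object with actions \<open>\<alpha>\<^sub>i\<^sub>j = R\<^sub>i \<epsilon>\<^sup>j\<^sub>z\<close>.\<close>

definition comparison_obj where
  "comparison_obj Z z = \<lparr>
     xob = OM (RA Z) z, xact = AM (RA Z) (epsA Z z), yob = OM (RB Z) z, yact = AM (RB Z) (epsB Z z),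
     vmap = AM (RA Z) (epsB Z z), wmap = AM (RB Z) (epsA Z z)\<rparr>"

definition comparison_arr where
  "comparison_arr Z f = \<lparr>
     esrc = comparison_obj Z (Dom (Zc Z) f), etgt = comparison_obj Z (Cod (Zc Z) f),
     xarr = AM (RA Z) f, yarr = AM (RB Z) f\<rparr>"

text \<open>The comparison functor, composed with the relabelling of its target.\<close>

definition comparison where
  "comparison io im Z = \<lparr>
     OM = (\<lambda>z\<in>Obj (Zc Z). io (comparison_obj Z z)),
     AM = (\<lambda>f\<in>Arr (Zc Z). im (comparison_arr Z f))\<rparr>"

lemma comparison_obj_simps [simp]:
  "xob (comparison_obj Z z) = OM (RA Z) z" "xact (comparison_obj Z z) = AM (RA Z) (epsA Z z)"
  "yob (comparison_obj Z z) = OM (RB Z) z" "yact (comparison_obj Z z) = AM (RB Z) (epsB Z z)"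
  "vmap (comparison_obj Z z) = AM (RA Z) (epsB Z z)" "wmap (comparison_obj Z z) = AM (RB Z) (epsA Z z)"
  by (simp_all add: comparison_obj_def)

lemma comparison_arr_simps [simp]:
  "esrc (comparison_arr Z f) = comparison_obj Z (Dom (Zc Z) f)"
  "etgt (comparison_arr Z f) = comparison_obj Z (Cod (Zc Z) f)"
  "xarr (comparison_arr Z f) = AM (RA Z) f" "yarr (comparison_arr Z f) = AM (RB Z) f"
  by (simp_all add: comparison_arr_def)

lemma comparison_ext:
  "OM (comparison io im Z) \<in> extensional (Obj (Zc Z))"
  "AM (comparison io im Z) \<in> extensional (Arr (Zc Z))"
  by (simp_all add: comparison_def)

lemma comparison_apply [simp]:
  "z \<in> Obj (Zc Z) \<Longrightarrow> OM (comparison io im Z) z = io (comparison_obj Z z)"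
  "f \<in> Arr (Zc Z) \<Longrightarrow> AM (comparison io im Z) f = im (comparison_arr Z f)"
  by (simp_all add: comparison_def)

locale double_adjunction_comparison =
  two_adjunctions X Y "Zc Z" "LA Z" "RA Z" "etaA Z" "epsA Z" "LB Z" "RB Z" "etaB Z" "epsB Z" +
  U: relabelled_EM X Y "Upsilon_obj X Y Z" io im
  for X :: "('xo, 'xm) cat" and Y :: "('yo, 'ym) cat"
    and Z :: "('xo, 'xm, 'yo, 'ym, 'zo, 'zm) dadj"
    and io :: "('xo, 'xm, 'yo, 'ym) em_obj \<Rightarrow> 'zo" and im :: "('xo, 'xm, 'yo, 'ym) em_arr \<Rightarrow> 'zm"
begin

lemma Upsilon_obj_simps:
  "fA (Upsilon_obj X Y Z) = fcomp X (RA Z) (LA Z)" "fB (Upsilon_obj X Y Z) = fcomp Y (RB Z) (LB Z)"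
  "fT (Upsilon_obj X Y Z) = fcomp Y (RA Z) (LB Z)" "fTh (Upsilon_obj X Y Z) = fcomp X (RB Z) (LA Z)"
  "uniA (Upsilon_obj X Y Z) = etaA Z" "uniB (Upsilon_obj X Y Z) = etaB Z"
  "x \<in> Obj X \<Longrightarrow> mulA (Upsilon_obj X Y Z) x = AM (RA Z) (epsA Z (OM (LA Z) x))"
  "y \<in> Obj Y \<Longrightarrow> mulB (Upsilon_obj X Y Z) y = AM (RB Z) (epsB Z (OM (LB Z) y))"
  "y \<in> Obj Y \<Longrightarrow> lact (Upsilon_obj X Y Z) y = AM (RA Z) (epsA Z (OM (LB Z) y))"
  "y \<in> Obj Y \<Longrightarrow> ract (Upsilon_obj X Y Z) y = AM (RA Z) (epsB Z (OM (LB Z) y))"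
  "x \<in> Obj X \<Longrightarrow> lacth (Upsilon_obj X Y Z) x = AM (RB Z) (epsB Z (OM (LA Z) x))"
  "x \<in> Obj X \<Longrightarrow> racth (Upsilon_obj X Y Z) x = AM (RB Z) (epsA Z (OM (LA Z) x))"
  "x \<in> Obj X \<Longrightarrow> ev (Upsilon_obj X Y Z) x = AM (RA Z) (epsB Z (OM (LA Z) x))"
  "y \<in> Obj Y \<Longrightarrow> evh (Upsilon_obj X Y Z) y = AM (RB Z) (epsA Z (OM (LB Z) y))"
  by (simp_all add: Upsilon_obj_def)

lemmas exchange =
  A.counit_exchange[OF A.R.cat_functor_axioms] A.counit_exchange[OF B.R.cat_functor_axioms]
  B.counit_exchange[OF A.R.cat_functor_axioms] B.counit_exchange[OF B.R.cat_functor_axioms]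

text \<open>The laws are again naturality of the counits, at \<open>z\<close> itself instead of at an object in the image of
  a left adjoint.\<close>

lemma is_em_obj_comparison:
  assumes z [simp]: "z \<in> Obj (Zc Z)"
  shows "is_em_obj X Y (Upsilon_obj X Y Z) (comparison_obj Z z)"
  by (rule U.is_em_objI)
    (simp_all add: Upsilon_obj_simps exchange A.triangle_R B.triangle_R)

lemma is_em_arr_comparison:
  assumes f [simp]: "f \<in> Arr (Zc Z)"
  shows "is_em_arr X Y (Upsilon_obj X Y Z) (comparison_arr Z f)"
  by (rule U.is_em_arrI) (simp_all add: is_em_obj_comparison Upsilon_obj_simps exchange)

lemma cat_functor_comparison: "cat_functor (Zc Z) U.C' (comparison io im Z)"
proof (rule cat_functorI[OF A.L.D.category_axioms U.category_relabel comparison_ext])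
qed (auto simp: is_em_obj_comparison is_em_arr_comparison intro!: em_arr.equality)

lemma dadj_morphism_comparison: "dadj_morphism U.G Z (comparison io im Z)"
proof -
  have "fcomp (Zc Z) (RA U.G) (comparison io im Z) = RA Z"
    "fcomp (Zc Z) (RB U.G) (comparison io im Z) = RB Z"
    by (rule ftr_eqI[where C = "Zc Z"]; simp add: is_em_obj_comparison is_em_arr_comparison)+
  then show ?thesis
    by (simp add: dadj_morphism_def cat_functor_comparison)
qed

text \<open>The counit at \<open>L\<^sub>A x\<close> after the image of the unit at \<open>x\<close> is an identity by a triangle identity; this
  holds after both right adjoints.\<close>

lemma mateA_comparison:
  assumes x [simp]: "x \<in> Obj X"
  shows "AM (RA U.G) (mateA U.G Z (comparison io im Z) x) = Idt X (OM (RA Z) (OM (LA Z) x))"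
    "AM (RB U.G) (mateA U.G Z (comparison io im Z) x) = Idt Y (OM (RB Z) (OM (LA Z) x))"
proof -
  let ?M = "Upsilon_obj X Y Z"
  let ?h = "em_epsA ?M (comparison_obj Z (OM (LA Z) x)) \<cdot>\<^bsub>EM X Y ?M\<^esub> AM (GA X ?M) (etaA Z x)"
  have "mateA U.G Z (comparison io im Z) x = im ?h"
    using U.is_em_arr_GA[of "etaA Z x"]
    by (simp add: mateA_def U.is_em_arr_epsA is_em_obj_comparison)
  moreover have "is_em_arr X Y ?M ?h"
    by (rule U.is_em_arr_Comp)
      (use U.is_em_arr_GA[of "etaA Z x"] in \<open>simp_all add: U.is_em_arr_epsA is_em_obj_comparison\<close>)
  ultimately have "AM (RA U.G) (mateA U.G Z (comparison io im Z) x) = xarr ?h"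
      "AM (RB U.G) (mateA U.G Z (comparison io im Z) x) = yarr ?h"
    by (simp_all only: U.Gamma_obj_apply)
  then show "AM (RA U.G) (mateA U.G Z (comparison io im Z) x) = Idt X (OM (RA Z) (OM (LA Z) x))"
    "AM (RB U.G) (mateA U.G Z (comparison io im Z) x) = Idt Y (OM (RB Z) (OM (LA Z) x))"
    using arg_cong[OF A.triangle_L[OF x], of "AM (RA Z)"] arg_cong[OF A.triangle_L[OF x], of "AM (RB Z)"]
    by (simp_all add: Upsilon_obj_simps)
qed

lemma mateB_comparison:
  assumes y [simp]: "y \<in> Obj Y"
  shows "AM (RA U.G) (mateB U.G Z (comparison io im Z) y) = Idt X (OM (RA Z) (OM (LB Z) y))"
    "AM (RB U.G) (mateB U.G Z (comparison io im Z) y) = Idt Y (OM (RB Z) (OM (LB Z) y))"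
proof -
  let ?M = "Upsilon_obj X Y Z"
  let ?h = "em_epsB ?M (comparison_obj Z (OM (LB Z) y)) \<cdot>\<^bsub>EM X Y ?M\<^esub> AM (GB Y ?M) (etaB Z y)"
  have "mateB U.G Z (comparison io im Z) y = im ?h"
    using U.is_em_arr_GB[of "etaB Z y"]
    by (simp add: mateB_def U.is_em_arr_epsB is_em_obj_comparison)
  moreover have "is_em_arr X Y ?M ?h"
    by (rule U.is_em_arr_Comp)
      (use U.is_em_arr_GB[of "etaB Z y"] in \<open>simp_all add: U.is_em_arr_epsB is_em_obj_comparison\<close>)
  ultimately have "AM (RA U.G) (mateB U.G Z (comparison io im Z) y) = xarr ?h"
      "AM (RB U.G) (mateB U.G Z (comparison io im Z) y) = yarr ?h"
    by (simp_all only: U.Gamma_obj_apply)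
  then show "AM (RA U.G) (mateB U.G Z (comparison io im Z) y) = Idt X (OM (RA Z) (OM (LB Z) y))"
    "AM (RB U.G) (mateB U.G Z (comparison io im Z) y) = Idt Y (OM (RB Z) (OM (LB Z) y))"
    using arg_cong[OF B.triangle_L[OF y], of "AM (RA Z)"] arg_cong[OF B.triangle_L[OF y], of "AM (RB Z)"]
    by (simp_all add: Upsilon_obj_simps)
qed

end

text \<open>An arrow of double adjunctions is a functor in the opposite direction, so the comparison functor out
  of the apex of \<open>Z\<close> is an arrow into \<open>Z\<close>.\<close>

definition counit where
  "counit io im X Y Z = \<lparr>asrc = Gamma_obj io im X Y (Upsilon_obj X Y Z), atgt = Z,
     afun = comparison io im Z\<rparr>"

lemma comparison_I:
  assumes "double_adjunction X Y Z" "inj io" "inj im"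
  shows "double_adjunction_comparison X Y Z io im"
  using assms morita_context_Upsilon_obj
  by (auto simp: double_adjunction_iff intro!: double_adjunction_comparison.intro relabelled_EM_I)

lemma counit_in_Hom:
  assumes "double_adjunction X Y Z" "inj io" "inj im"
  shows "counit io im X Y Z \<in> Hom (Adj X Y) (Gamma_obj io im X Y (Upsilon_obj X Y Z)) Z"
proof -
  interpret double_adjunction_comparison X Y Z io im using assms by (rule comparison_I)
  show ?thesis
    using assms dadj_morphism_comparison U.double_adjunction_Gamma_obj by (simp add: counit_def)
qed

lemma Upsilon_counit:
  assumes "double_adjunction X Y Z" "inj io" "inj im"
  shows "Upsilon_arr X Y (counit io im X Y Z) = Idt (Mor X Y) (Upsilon_obj X Y Z)"
proof -
  interpret double_adjunction_comparison X Y Z io im using assms by (rule comparison_I)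
  show ?thesis
    by (intro morita_arr.equality)
      (auto simp: counit_def Upsilon_arr_def Let_def Mor_def U.Upsilon_Gamma_obj
         mateA_comparison mateB_comparison Upsilon_obj_simps intro!: restrict_ext)
qed

text \<open>Both sides send \<open>z\<close> to the objects \<open>R\<^sub>i F z = R'\<^sub>i z\<close>.  The actions are \<open>R\<^sub>i \<epsilon>\<^sup>j\<close> at \<open>F z\<close> on one side
  and \<open>R'\<^sub>i \<epsilon>'\<^sup>j\<close> at \<open>z\<close> precomposed with \<open>R\<^sub>i a\<^sub>j\<close> on the other, where \<open>a\<^sub>j\<close> is the mate; they agree by
  \<open>counit_mate\<close>.\<close>

lemma counit_naturality:
  assumes F: "F \<in> Hom (Adj X Y) Z Z'" and inj: "inj io" "inj im"
  shows "F \<cdot>\<^bsub>Adj X Y\<^esub> counit io im X Y Z =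
    counit io im X Y Z' \<cdot>\<^bsub>Adj X Y\<^esub> Gamma_arr io im X Y (Upsilon_arr X Y F)"
proof -
  have Z: "double_adjunction X Y Z" "double_adjunction X Y Z'" and F': "asrc F = Z" "atgt F = Z'"
    and mor: "dadj_morphism Z Z' (afun F)"
    using F by auto
  interpret Z: double_adjunction_comparison X Y Z io im using Z(1) inj by (rule comparison_I)
  interpret Z': double_adjunction_comparison X Y Z' io im using Z(2) inj by (rule comparison_I)
  interpret A: functor_over X "Zc Z" "LA Z" "RA Z" "etaA Z" "epsA Z"
    "Zc Z'" "LA Z'" "RA Z'" "etaA Z'" "epsA Z'" "afun F"
    by (rule dadj_morphism_functor_over) fact+
  interpret B: functor_over Y "Zc Z" "LB Z" "RB Z" "etaB Z" "epsB Z"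
    "Zc Z'" "LB Z'" "RB Z'" "etaB Z'" "epsB Z'" "afun F"
    by (rule dadj_morphism_functor_over) fact+
  interpret Ups: cat_functor "Adj X Y" "Mor X Y" "Upsilon X Y"
    by (rule cat_functor_Upsilon)
  let ?U = "Upsilon_arr X Y F"
  have "?U \<in> Hom (Mor X Y) (Upsilon_obj X Y Z) (Upsilon_obj X Y Z')"
    using Ups.AM_in[OF F] F Z Upsilon_apply(2)[of F X Y] by auto
  then interpret U: relabelled_arrow X Y "Upsilon_obj X Y Z" "Upsilon_obj X Y Z'" ?U io im
    using inj by (rule relabelled_arrow_I)
  have ph: "x \<in> Obj X \<Longrightarrow> ph1 ?U x = AM (RA Z) (A.a x)" "y \<in> Obj Y \<Longrightarrow> ph2 ?U y = AM (RB Z) (B.a y)"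
    "y \<in> Obj Y \<Longrightarrow> ph3 ?U y = AM (RA Z) (B.a y)" "x \<in> Obj X \<Longrightarrow> ph4 ?U x = AM (RB Z) (A.a x)" for x y
    by (simp_all add: Upsilon_arr_def Let_def F' mateA_eq mateB_eq)
  have obj: "comparison_obj Z (OM (afun F) z) = em_restrict_obj X Y ?U (comparison_obj Z' z)"
    if z [simp]: "z \<in> Obj (Zc Z')" for z
    using arg_cong[OF A.counit_mate[OF z], of "AM (RA Z)"] arg_cong[OF A.counit_mate[OF z], of "AM (RB Z)"]
      arg_cong[OF B.counit_mate[OF z], of "AM (RA Z)"] arg_cong[OF B.counit_mate[OF z], of "AM (RB Z)"]
    by (intro em_obj.equality) (simp_all add: ph)
  have "fcomp (Zc Z') (comparison io im Z) (afun F) = fcomp (Zc Z') U.F (comparison io im Z')"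
    by (rule ftr_eqI[where C = "Zc Z'"])
      (auto simp: obj Z'.is_em_obj_comparison Z'.is_em_arr_comparison intro!: em_arr.equality)
  then show ?thesis
    by (simp add: Adj_def counit_def F')
qed

section \<open>The adjunction between double adjunctions and Morita contexts\<close>

text \<open>The counits of \<open>\<Gamma> M\<close> at an Eilenberg-Moore object consist of the actions of that object, so
  the comparison functor rebuilds the object from them.\<close>

lemma (in relabelled_EM) counit_Gamma_obj:
  "counit io im X Y G = Idt (Adj X Y) G"
proof -
  have obj: "comparison_obj G (io E) = E" if "is_em_obj X Y M E" for E
    using that by (intro em_obj.equality) (simp_all add: is_em_arr_epsA is_em_arr_epsB)
  have "comparison_arr G (im h) = h" if "is_em_arr X Y M h" for h
    using that by (intro em_arr.equality) (simp_all add: obj)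
  then have "comparison io im G = fid C'"
    by (intro ftr_eqI[where C = C'])
      ((rule fid_ext comparison_ext[of io im G, unfolded Zc_Gamma_obj])?; auto simp: obj)+
  then show ?thesis
    by (simp add: counit_def Adj_def Upsilon_Gamma_obj)
qed

lemma Upsilon_Gamma:
  assumes "inj io" "inj im"
  shows "fcomp (Mor X Y) (Upsilon X Y) (Gamma io im X Y) = fid (Mor X Y)"
proof (rule ftr_eqI[where C = "Mor X Y"])
  fix M assume M: "M \<in> Obj (Mor X Y)"
  then interpret relabelled_EM X Y M io im using assms by (simp add: relabelled_EM_I)
  show "OM (fcomp (Mor X Y) (Upsilon X Y) (Gamma io im X Y)) M = OM (fid (Mor X Y)) M"
    using M by (simp add: double_adjunction_Gamma_obj Upsilon_Gamma_obj)
next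
  fix p assume p: "p \<in> Arr (Mor X Y)"
  then have p': "p \<in> Hom (Mor X Y) (src p) (tgt p)" by simp
  have "Gamma_arr io im X Y p \<in> Arr (Adj X Y)"
    using Gamma_arr_in_Hom[OF p' assms] by auto
  then show "AM (fcomp (Mor X Y) (Upsilon X Y) (Gamma io im X Y)) p = AM (fid (Mor X Y)) p"
    using p relabelled_arrow.Upsilon_Gamma_arr[OF relabelled_arrow_I[OF p' assms]]
    by (simp del: Adj_simps Mor_simps)
qed (rule fcomp_ext fid_ext)+

lemma adjunction_Gamma_Upsilon:
  fixes X :: "('xo, 'xm) cat" and Y :: "('yo, 'ym) cat"
    and io :: "('xo, 'xm, 'yo, 'ym) em_obj \<Rightarrow> 'zo" and im :: "('xo, 'xm, 'yo, 'ym) em_arr \<Rightarrow> 'zm"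
  assumes inj: "inj io" "inj im"
  shows "adjunction (Mor X Y) (Adj X Y) (Gamma io im X Y) (Upsilon X Y)
    (\<lambda>M\<in>Obj (Mor X Y). Idt (Mor X Y) M) (\<lambda>Z\<in>Obj (Adj X Y). counit io im X Y Z)"
proof -
  interpret Gam: cat_functor "Mor X Y" "Adj X Y" "Gamma io im X Y"
    by (rule cat_functor_Gamma[OF inj])
  interpret Ups: cat_functor "Adj X Y" "Mor X Y" "Upsilon X Y"
    by (rule cat_functor_Upsilon)
  have [simp]: "M \<in> Obj (Mor X Y) \<Longrightarrow> OM (Upsilon X Y) (OM (Gamma io im X Y) M) = M" for M
    using arg_cong[OF Upsilon_Gamma[OF inj, of X Y], of "\<lambda>F. OM F M"] by simp
  have "nat_trans (Mor X Y) (Mor X Y) (fid (Mor X Y)) (fid (Mor X Y)) (\<lambda>M\<in>Obj (Mor X Y). Idt (Mor X Y) M)"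
    by (rule nat_transI) (simp_all add: cat_functor_fid category_Mor del: Mor_simps)
  then have eta: "nat_trans (Mor X Y) (Mor X Y) (fid (Mor X Y))
      (fcomp (Mor X Y) (Upsilon X Y) (Gamma io im X Y)) (\<lambda>M\<in>Obj (Mor X Y). Idt (Mor X Y) M)"
    by (simp only: Upsilon_Gamma[OF inj])
  have eps: "nat_trans (Adj X Y) (Adj X Y) (fcomp (Adj X Y) (Gamma io im X Y) (Upsilon X Y)) (fid (Adj X Y))
      (\<lambda>Z\<in>Obj (Adj X Y). counit io im X Y Z)"
  proof (rule nat_transI[OF cat_functor_fcomp[OF cat_functor_Upsilon cat_functor_Gamma[OF inj]]
        cat_functor_fid[OF category_Adj]])
    fix Z :: "('xo, 'xm, 'yo, 'ym, 'zo, 'zm) dadj" assume "Z \<in> Obj (Adj X Y)"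
    then show "(\<lambda>Z\<in>Obj (Adj X Y). counit io im X Y Z) Z \<in> Arr (Adj X Y) \<and>
        Dom (Adj X Y) ((\<lambda>Z\<in>Obj (Adj X Y). counit io im X Y Z) Z) =
          OM (fcomp (Adj X Y) (Gamma io im X Y) (Upsilon X Y)) Z \<and>
        Cod (Adj X Y) ((\<lambda>Z\<in>Obj (Adj X Y). counit io im X Y Z) Z) = OM (fid (Adj X Y)) Z"
      using counit_in_Hom[OF _ inj, of X Y Z] by (auto simp: morita_context_Upsilon_obj)
  next
    fix F :: "('xo, 'xm, 'yo, 'ym, 'zo, 'zm) dadj_arr" assume F: "F \<in> Arr (Adj X Y)"
    then have F': "F \<in> Hom (Adj X Y) (asrc F) (atgt F)" by simp
    have "AM (Upsilon X Y) F \<in> Arr (Mor X Y)"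
      using F by (rule Ups.AM_typing(1))
    with F counit_naturality[OF F' inj]
    show "AM (fid (Adj X Y)) F \<cdot>\<^bsub>Adj X Y\<^esub> (\<lambda>Z\<in>Obj (Adj X Y). counit io im X Y Z) (Dom (Adj X Y) F) =
        (\<lambda>Z\<in>Obj (Adj X Y). counit io im X Y Z) (Cod (Adj X Y) F) \<cdot>\<^bsub>Adj X Y\<^esub>
        AM (fcomp (Adj X Y) (Gamma io im X Y) (Upsilon X Y)) F"
      by simp
  qed simp
  show ?thesis
  proof (intro adjunction.intro adjunction_axioms.intro eta eps Gam.cat_functor_axioms Ups.cat_functor_axioms)
    fix M assume M: "M \<in> Obj (Mor X Y)"
    then interpret relabelled_EM X Y M io im using inj by (simp add: relabelled_EM_I)
    have "G \<in> Obj (Adj X Y)" "OM (Gamma io im X Y) M = G"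
      using M by (simp_all add: double_adjunction_Gamma_obj)
    then show "(\<lambda>Z\<in>Obj (Adj X Y). counit io im X Y Z) (OM (Gamma io im X Y) M) \<cdot>\<^bsub>Adj X Y\<^esub>
        AM (Gamma io im X Y) ((\<lambda>M\<in>Obj (Mor X Y). Idt (Mor X Y) M) M) =
        Idt (Adj X Y) (OM (Gamma io im X Y) M)"
      using M counit_Gamma_obj by (simp del: Mor_simps Adj_simps Gamma_apply)
  next
    fix Z :: "('xo, 'xm, 'yo, 'ym, 'zo, 'zm) dadj" assume Z: "Z \<in> Obj (Adj X Y)"
    then have "AM (Upsilon X Y) (counit io im X Y Z) = Idt (Mor X Y) (OM (Upsilon X Y) Z)"
      using Upsilon_counit[OF _ inj, of X Y Z] counit_in_Hom[OF _ inj, of X Y Z] by auto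
    then show "AM (Upsilon X Y) ((\<lambda>Z\<in>Obj (Adj X Y). counit io im X Y Z) Z) \<cdot>\<^bsub>Mor X Y\<^esub>
        (\<lambda>M\<in>Obj (Mor X Y). Idt (Mor X Y) M) (OM (Upsilon X Y) Z) = Idt (Mor X Y) (OM (Upsilon X Y) Z)"
      using Z by (simp del: Mor_simps Adj_simps Upsilon_apply)
  qed
qed

text \<open>Faithfulness is immediate from \<open>R L = id\<close>.  For fullness, an arrow \<open>g : L a \<rightarrow> L b\<close> is \<open>L (R g)\<close>, because
  naturality of the counit at \<open>g\<close> is an equation whose counit components are identities.\<close>

lemma (in adjunction) fully_faithful_if_unit_counit_Idt:
  assumes RL: "fcomp C R L = fid C" and eps_L: "\<And>a. a \<in> Obj C \<Longrightarrow> eps (OM L a) = Idt D (OM L a)"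
  shows "full_functor C D L" "faithful_functor C D L"
proof -
  have RL_OM: "OM R (OM L a) = a" if "a \<in> Obj C" for a
    using arg_cong[OF RL, of "\<lambda>F. OM F a"] that by simp
  have RL_AM: "AM R (AM L f) = f" if "f \<in> Arr C" for f
    using arg_cong[OF RL, of "\<lambda>F. AM F f"] that by simp
  have "AM L (AM R g) = g" if "a \<in> Obj C" "b \<in> Obj C" "g \<in> Hom D (OM L a) (OM L b)" for a b g
    using that eps.naturality[of g "OM L a" "OM L b"] by (simp add: eps_L RL_OM)
  then show "full_functor C D L"
    unfolding full_functor_def using L.cat_functor_axioms RL_OM R.AM_in by metis
  show "faithful_functor C D L"
    unfolding faithful_functor_def using L.cat_functor_axioms RL_AM by (auto intro!: inj_onI) metis
qed

theorem proposition3p5p2: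
  fixes X :: "('xo, 'xm) cat" and Y :: "('yo, 'ym) cat"
    and io :: "('xo, 'xm, 'yo, 'ym) em_obj \<Rightarrow> 'zo"
    and im :: "('xo, 'xm, 'yo, 'ym) em_arr \<Rightarrow> 'zm"
  assumes "category X" and "category Y"
    and "inj io" and "inj im"
  shows "adjoint_pair (Mor X Y) (Adj X Y) (Gamma io im X Y) (Upsilon X Y) \<and>
    full_functor (Mor X Y) (Adj X Y) (Gamma io im X Y) \<and>
    faithful_functor (Mor X Y) (Adj X Y) (Gamma io im X Y)"
proof -
  interpret adjunction "Mor X Y" "Adj X Y" "Gamma io im X Y" "Upsilon X Y"
    "\<lambda>M\<in>Obj (Mor X Y). Idt (Mor X Y) M" "\<lambda>Z\<in>Obj (Adj X Y). counit io im X Y Z"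
    using assms(3,4) by (rule adjunction_Gamma_Upsilon)
  have "(\<lambda>Z\<in>Obj (Adj X Y). counit io im X Y Z) (OM (Gamma io im X Y) M) =
      Idt (Adj X Y) (OM (Gamma io im X Y) M)" if "M \<in> Obj (Mor X Y)" for M
    using that L.OM_Obj[OF that] relabelled_EM.counit_Gamma_obj[OF relabelled_EM_I[OF _ assms(3,4)]]
    by simp
  from fully_faithful_if_unit_counit_Idt[OF Upsilon_Gamma[OF assms(3,4)] this]
  show ?thesis
    using adjunction_axioms unfolding adjoint_pair_def by blast
qed

end
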